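(* Let $\alpha_j>-1$, $\beta_j>0$ for $j=1,2$. Then for $0\le u\le 1$ $$G^{2,0}_{2,2}\left[u\,\Big|\,{\alpha_1+\beta_1,\ \alpha_2+\beta_2\atop \alpha_1,\ \alpha_2}\right]=\frac{1}{\Gamma(\beta_1)\Gamma(\beta_2)}u^{\alpha_1}\int_{u}^1v^{\alpha_2-\alpha_1-\beta_1}(v-u)^{\beta_1-1}(1-v)^{\beta_2-1}\,dv$$ $$=\frac{1}{\Gamma(\beta_1)\Gamma(\beta_2)}u^{\alpha_2}\int_{u}^1v^{\alpha_1-\beta_2-\alpha_2}(v-u)^{\beta_2-1}(1-v)^{\beta_1-1}\,dv .$$ If $0\le u<1$ and $\alpha_1-\alpha_2\ne\pm\nu$ for all $\nu=0,1,\dots$, then these also equal $$\frac{\Gamma(\alpha_2-\alpha_1)}{\Gamma(\beta_1)\Gamma(\alpha_2+\beta_2-\alpha_1)}u^{\alpha_1}\,{}_2F_1(1-\beta_1,1+\alpha_1-\alpha_2-\beta_2;1+\alpha_1-\alpha_2;u)$$ $$+\frac{\Gamma(\alpha_1-\alpha_2)}{\Gamma(\beta_2)\Gamma(\alpha_1+\beta_1-\alpha_2)}u^{\alpha_2}\,{}_2F_1(1-\beta_2,1+\alpha_2-\alpha_1-\beta_1;1+\alpha_2-\alpha_1;u).$$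
   Context: Meijer G-function: $$G^{m,n}_{p,q}\left[z\,\Big|\,{a_1,\dots,a_p\atop b_1,\dots,b_q}\right]=\frac1{2\pi i}\int_{\kappa-i\infty}^{\kappa+i\infty}\frac{\prod_{j=1}^m\Gamma(b_j+s)\prod_{j=1}^n\Gamma(1-a_j-s)}{\prod_{j=m+1}^q\Gamma(1-b_j-s)\prod_{j=n+1}^p\Gamma(a_j+s)}\,z^{-s}\,ds,$$ where the real number $\kappa$ is such that all poles of $\Gamma(b_j+s)$, $j\le m$, lie to the left and all poles of $\Gamma(1-a_j-s)$, $j\le n$, lie to the right of the line $\Re s=\kappa$. In the present case the integrand is $\frac{\Gamma(\alpha_1+s)\Gamma(\alpha_2+s)}{\Gamma(\alpha_1+\beta_1+s)\Gamma(\alpha_2+\beta_2+s)}u^{-s}$ and $\kappa>\max(-\alpha_1,-\alpha_2)$. ${}_2F_1$ is the Gauss hypergeometric series, and $1/\Gamma$ is taken to be $0$ at the poles of $\Gamma$.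
   Formalization: At u=0 (where 0^{-s} is undefined and one integral always diverges) and at u=1 with β₁+β₂≤1 (where the G-integral diverges), equality is stated as a common one-sided limit in the extended reals; for 0<u<1, and at u=1 with β₁+β₂>1, it is literal. *)

theory Defs
  imports "HOL-Analysis.Analysis"
begin

section \<open>The Meijer G-function\<close>

text \<open>
  Parameter lists are indexed from 0.  Reciprocal Gamma factors are written with the entire
  function \<^const>\<open>rGamma\<close>, which is 0 at the poles of \<^const>\<open>Gamma\<close>.  The power
  is the principal branch.
\<close>

definition meijer_integrand ::
    "nat \<Rightarrow> nat \<Rightarrow> complex list \<Rightarrow> complex list \<Rightarrow> complex \<Rightarrow> complex \<Rightarrow> complex" where
  "meijer_integrand m n as bs z s =
     (\<Prod>j<m. Gamma (bs ! j + s)) * (\<Prod>j<n. Gamma (1 - as ! j - s)) *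
     (\<Prod>j\<in>{m..<length bs}. rGamma (1 - bs ! j - s)) *
     (\<Prod>j\<in>{n..<length as}. rGamma (as ! j + s)) * z powr (- s)"

text \<open>The poles of \<^const>\<open>Gamma\<close> are the non-positive integers.\<close>

definition meijer_line :: "nat \<Rightarrow> nat \<Rightarrow> complex list \<Rightarrow> complex list \<Rightarrow> real \<Rightarrow> bool" where
  "meijer_line m n as bs \<kappa> \<longleftrightarrow>
     (\<forall>j<m. \<forall>s. bs ! j + s \<in> \<int>\<^sub>\<le>\<^sub>0 \<longrightarrow> Re s < \<kappa>) \<and>
     (\<forall>j<n. \<forall>s. 1 - as ! j - s \<in> \<int>\<^sub>\<le>\<^sub>0 \<longrightarrow> \<kappa> < Re s)"

text \<open>
  The line integral exists with value \<open>w\<close> on every separating line.  It need not converge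
  absolutely; the Henstock--Kurzweil integral over the whole line is the improper integral in
  which both ends tend to infinity independently.  The factor \<open>\<i>\<close> is \<open>ds/dt\<close> for
  \<open>s = \<kappa> + \<i> t\<close>.
\<close>

definition has_meijer_G ::
    "nat \<Rightarrow> nat \<Rightarrow> complex list \<Rightarrow> complex list \<Rightarrow> complex \<Rightarrow> complex \<Rightarrow> bool" where
  "has_meijer_G m n as bs z w \<longleftrightarrow>
     (\<exists>\<kappa>. meijer_line m n as bs \<kappa>) \<and>
     (\<forall>\<kappa>. meijer_line m n as bs \<kappa> \<longrightarrow>
        ((\<lambda>t. meijer_integrand m n as bs z (Complex \<kappa> t) * \<i>)
           has_integral (2 * of_real pi * \<i> * w)) UNIV)"

definition meijer_G ::
    "nat \<Rightarrow> nat \<Rightarrow> complex list \<Rightarrow> complex list \<Rightarrow> complex \<Rightarrow> complex" where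
  "meijer_G m n as bs z = (THE w. has_meijer_G m n as bs z w)"

lemma has_meijer_G_unique:
  assumes "has_meijer_G m n as bs z w" "has_meijer_G m n as bs z w'"
  shows "w = w'"
proof -
  obtain \<kappa> where "meijer_line m n as bs \<kappa>"
    using assms(1) unfolding has_meijer_G_def by blast
  then have "2 * of_real pi * \<i> * w = 2 * of_real pi * \<i> * w'"
    using assms has_integral_unique unfolding has_meijer_G_def by blast
  then show ?thesis by simp
qed

lemma meijer_G_eqI: "has_meijer_G m n as bs z w \<Longrightarrow> meijer_G m n as bs z = w"
  unfolding meijer_G_def by (rule the_equality) (auto intro: has_meijer_G_unique)

lemma meijer_line_2_0:
  "meijer_line 2 0 as [of_real \<alpha>\<^sub>1, of_real \<alpha>\<^sub>2] \<kappa> \<longleftrightarrow> \<kappa> > max (- \<alpha>\<^sub>1) (- \<alpha>\<^sub>2)"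
proof -
  have *: "(\<forall>s. complex_of_real a + s \<in> \<int>\<^sub>\<le>\<^sub>0 \<longrightarrow> Re s < \<kappa>) \<longleftrightarrow> - a < \<kappa>" for a :: real
  proof
    assume H: "\<forall>s. complex_of_real a + s \<in> \<int>\<^sub>\<le>\<^sub>0 \<longrightarrow> Re s < \<kappa>"
    show "- a < \<kappa>" using H[rule_format, of "- of_real a"] by simp
  next
    assume H: "- a < \<kappa>"
    show "\<forall>s. complex_of_real a + s \<in> \<int>\<^sub>\<le>\<^sub>0 \<longrightarrow> Re s < \<kappa>"
    proof (intro allI impI)
      fix s assume "complex_of_real a + s \<in> \<int>\<^sub>\<le>\<^sub>0"
      then obtain k where k: "complex_of_real a + s = of_int k" "k \<le> 0"
        by (auto elim: nonpos_Ints_cases)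
      have "Re (complex_of_real a + s) = of_int k" using k(1) by simp
      then have "a + Re s \<le> 0" using k(2) by simp
      then show "Re s < \<kappa>" using H by linarith
    qed
  qed
  show ?thesis
    unfolding meijer_line_def by (auto simp: numeral_2_eq_2 less_Suc_eq *)
qed

section \<open>The integral and hypergeometric expressions\<close>

text \<open>The second integral in the theorem is this one with the indices 1 and 2 interchanged.\<close>

definition euler_integrand :: "real \<Rightarrow> real \<Rightarrow> real \<Rightarrow> real \<Rightarrow> real \<Rightarrow> real \<Rightarrow> real" where
  "euler_integrand \<alpha>\<^sub>1 \<beta>\<^sub>1 \<alpha>\<^sub>2 \<beta>\<^sub>2 u v =
     v powr (\<alpha>\<^sub>2 - \<alpha>\<^sub>1 - \<beta>\<^sub>1) * (v - u) powr (\<beta>\<^sub>1 - 1) * (1 - v) powr (\<beta>\<^sub>2 - 1)"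

definition euler_form :: "real \<Rightarrow> real \<Rightarrow> real \<Rightarrow> real \<Rightarrow> real \<Rightarrow> real" where
  "euler_form \<alpha>\<^sub>1 \<beta>\<^sub>1 \<alpha>\<^sub>2 \<beta>\<^sub>2 u =
     1 / (Gamma \<beta>\<^sub>1 * Gamma \<beta>\<^sub>2) * u powr \<alpha>\<^sub>1 *
     integral {u..1} (euler_integrand \<alpha>\<^sub>1 \<beta>\<^sub>1 \<alpha>\<^sub>2 \<beta>\<^sub>2 u)"

definition hyp2F1 :: "real \<Rightarrow> real \<Rightarrow> real \<Rightarrow> real \<Rightarrow> real" where
  "hyp2F1 a b c x = eval_fps (fps_hypergeo [a, b] [c] 1) x"

lemma hyp2F1_eq_suminf:
  "hyp2F1 a b c x =
     (\<Sum>k. pochhammer a k * pochhammer b k / (pochhammer c k * fact k) * x ^ k)"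
  by (simp add: hyp2F1_def eval_fps_def)

definition hypergeo_form :: "real \<Rightarrow> real \<Rightarrow> real \<Rightarrow> real \<Rightarrow> real \<Rightarrow> real" where
  "hypergeo_form \<alpha>\<^sub>1 \<beta>\<^sub>1 \<alpha>\<^sub>2 \<beta>\<^sub>2 u =
     Gamma (\<alpha>\<^sub>2 - \<alpha>\<^sub>1) * rGamma \<beta>\<^sub>1 * rGamma (\<alpha>\<^sub>2 + \<beta>\<^sub>2 - \<alpha>\<^sub>1) * u powr \<alpha>\<^sub>1 *
       hyp2F1 (1 - \<beta>\<^sub>1) (1 + \<alpha>\<^sub>1 - \<alpha>\<^sub>2 - \<beta>\<^sub>2) (1 + \<alpha>\<^sub>1 - \<alpha>\<^sub>2) u +
     Gamma (\<alpha>\<^sub>1 - \<alpha>\<^sub>2) * rGamma \<beta>\<^sub>2 * rGamma (\<alpha>\<^sub>1 + \<beta>\<^sub>1 - \<alpha>\<^sub>2) * u powr \<alpha>\<^sub>2 *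
       hyp2F1 (1 - \<beta>\<^sub>2) (1 + \<alpha>\<^sub>2 - \<alpha>\<^sub>1 - \<beta>\<^sub>1) (1 + \<alpha>\<^sub>2 - \<alpha>\<^sub>1) u"

text \<open>
  None of these expressions has a usable literal value at every endpoint: at \<open>u = 0\<close> the
  factor \<open>u powr (- s)\<close> is meaningless and the other forms may be a zero times a divergent
  integral, and at \<open>u = 1\<close> the line integral diverges when \<open>\<beta>\<^sub>1 + \<beta>\<^sub>2 \<le> 1\<close>.  Endpoint
  values are one-sided limits in \<^typ>\<open>ereal\<close>; for \<open>\<beta>\<^sub>1 + \<beta>\<^sub>2 > 1\<close> the point \<open>u = 1\<close> is
  also covered literally.
\<close>

end

theory Submission
  imports Defs "HOL-Probability.Probability" "HOL-Complex_Analysis.Complex_Analysis"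
    "HOL-Real_Asymp.Real_Asymp"
begin

text \<open>
  Put \<open>s = \<kappa> + \<i>t\<close> and \<open>u = exp (- x)\<close>.  The quotient \<open>\<Gamma>(\<alpha> + s) / \<Gamma>(\<alpha> + \<beta> + s)\<close> is
  \<open>1 / \<Gamma>(\<beta>)\<close> times the Beta integral of \<open>w\<close> to the power \<open>\<alpha> + s - 1\<close> and \<open>1 - w\<close> to the power
  \<open>\<beta> - 1\<close>.  After \<open>w = exp (- y)\<close> this reads: as a function of \<open>t\<close>, the quotient is a Fourier
  transform of an integrable function on the half line (\<open>log_beta_fourier\<close>).  A product of two
  such transforms is the transform of a convolution \<open>g\<close>, and the value of that convolution at
  \<open>x\<close> is, up to elementary factors, the Euler integral (\<open>log_beta_convolution\<close>).  So the first
  formula is Fourier inversion for \<open>g\<close> at the single point \<open>x\<close>.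

  The transform of \<open>g\<close> decays only like \<open>|t|\<close> to the power \<open>- (\<beta>\<^sub>1 + \<beta>\<^sub>2)\<close>, so the inversion
  integral need not converge absolutely.  It converges by Dini's argument wherever \<open>g\<close> is
  Hoelder continuous (\<open>fourier_inversion_Hoelder\<close>); the analytic input is the Riemann--Lebesgue
  lemma.  The substitution \<open>v = u + (1 - u) w\<close> writes the Euler integral as
  \<open>(1 - u)\<close> to the power \<open>\<beta>\<^sub>1 + \<beta>\<^sub>2 - 1\<close> times a function that is Lipschitz in \<open>u\<close> away from 0.
  Hence \<open>g\<close> is Lipschitz near every \<open>x > 0\<close>.  At \<open>x = 0\<close>, that is \<open>u = 1\<close>, it vanishes to the
  left and behaves like \<open>y\<close> to the power \<open>\<beta>\<^sub>1 + \<beta>\<^sub>2 - 1\<close> to the right, which is where the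
  condition \<open>\<beta>\<^sub>1 + \<beta>\<^sub>2 > 1\<close> enters.

  The two Euler integrals agree because interchanging the indices does not change the Meijer
  integrand, and its integral is unique.

  For the hypergeometric form, both powers in the Euler integral are expanded in binomial series
  in \<open>u / v\<close> and in \<open>v\<close> and integrated term by term.  With \<open>c = \<alpha>\<^sub>2 - \<alpha>\<^sub>1\<close> the term of index
  \<open>(j, k)\<close> contains the integral of \<open>v\<close> to the power \<open>c - j + k - 1\<close>, which contributes one
  piece from \<open>v = 1\<close> and one from \<open>v = u\<close>.  Each piece can be summed in one index by the partial
  fraction expansion of the Beta function, which holds for all arguments other than the
  non-positive integers (\<open>beta_series_eq_Gamma\<close>); the remaining sum is a Gauss series.  This is
  where \<open>c\<close> must not be an integer.

  At the endpoints, the same substituted form shows that the limits exist: the remaining integral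
  is monotone in \<open>u\<close>, and it is dominated by Beta integrals.
\<close>

section \<open>The Riemann--Lebesgue lemma\<close>

lemma integrable_mult_cis:
  fixes f :: "real \<Rightarrow> real"
  assumes "integrable lborel f"
  shows "integrable lborel (\<lambda>y. f y *\<^sub>R cis (t * y + c))"
  by (rule Bochner_Integration.integrable_bound[OF assms]) (use borel_measurable_integrable[OF assms] in \<open>auto intro!: borel_measurable_scaleR borel_measurable_continuous_onI[of "\<lambda>y. cis (t * y + c)"] continuous_intros\<close>)

text \<open>
  The antiderivative of \<open>cis (t * y)\<close> in \<open>y\<close> is bounded by \<open>1 / \<bar>t\<bar>\<close>.
\<close>
lemma riemann_lebesgue_interval:
  "((\<lambda>t. \<integral>y. indicat_real {a<..<b} y *\<^sub>R cis (t * y) \<partial>lborel) \<longlongrightarrow> 0) at_infinity"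
proof (cases "a < b")
  case True
  have bound: "norm (\<integral>y. indicat_real {a<..<b} y *\<^sub>R cis (t * y) \<partial>lborel) \<le> 2 / \<bar>t\<bar>" if "t \<noteq> 0" for t
  proof -
    have "(LBINT y=ereal a..ereal b. cis (t * y)) = cis (t * b) / (\<i> * of_real t) - cis (t * a) / (\<i> * of_real t)"
    proof (rule interval_integral_FTC_finite)
      show "continuous_on {min a b..max a b} (\<lambda>y. cis (t * y))"
        by (intro continuous_intros)
      show "((\<lambda>y. cis (t * y) / (\<i> * of_real t)) has_vector_derivative cis (t * x))
              (at x within {min a b..max a b})" for x
      proof -
        have "((\<lambda>y. exp (\<i> * of_real t * y) / (\<i> * of_real t)) has_field_derivative exp (\<i> * of_real t * of_real x)) (at (of_real x))"
          using that by (auto intro!: derivative_eq_intros)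
        then have "((\<lambda>y. exp (\<i> * of_real t * of_real y) / (\<i> * of_real t)) has_vector_derivative exp (\<i> * of_real t * of_real x))
              (at x within {min a b..max a b})"
          by (rule has_vector_derivative_real_field)
        then show ?thesis by (simp add: cis_conv_exp mult_ac)
      qed
    qed
    moreover have "(LBINT y=ereal a..ereal b. cis (t * y)) = (\<integral>y. indicat_real {a<..<b} y *\<^sub>R cis (t * y) \<partial>lborel)"
      using True by (simp add: interval_lebesgue_integral_def set_lebesgue_integral_def einterval_eq)
    ultimately have "norm (\<integral>y. indicat_real {a<..<b} y *\<^sub>R cis (t * y) \<partial>lborel)
        = norm (cis (t * b) / (\<i> * of_real t) - cis (t * a) / (\<i> * of_real t))" by simp
    also have "\<dots> \<le> norm (cis (t * b) / (\<i> * of_real t)) + norm (cis (t * a) / (\<i> * of_real t))"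
      by (rule norm_triangle_ineq4)
    also have "\<dots> = 2 / \<bar>t\<bar>" by (simp add: norm_divide norm_mult)
    finally show ?thesis .
  qed
  have "((\<lambda>t::real. 2 / \<bar>t\<bar>) \<longlongrightarrow> 0) at_infinity"
    using filterlim_norm_at_top[where 'a = real]
    by (intro real_tendsto_divide_at_top[OF tendsto_const]) (simp add: real_norm_def[abs_def])
  then show ?thesis
    by (rule Lim_null_comparison[rotated])
       (rule eventually_mono[OF eventually_not_equal_at_infinity[of 0] bound])
next
  case False
  then show ?thesis by simp
qed

text \<open>
  Functions vanishing at infinity are closed under uniform limits.  This is the form in which the
  Riemann--Lebesgue property passes from simpler to more general integrands.
\<close>
lemma tendsto_0_uniform_approx:
  fixes F :: "real \<Rightarrow> complex"
  assumes "\<And>e. e > 0 \<Longrightarrow> \<exists>G. (G \<longlongrightarrow> 0) at_infinity \<and> (\<forall>t. norm (F t - G t) \<le> e)"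
  shows "(F \<longlongrightarrow> 0) at_infinity"
proof (rule tendstoI)
  fix e :: real assume "e > 0"
  then obtain G where G: "(G \<longlongrightarrow> 0) at_infinity" "\<And>t. norm (F t - G t) \<le> e / 2"
    using assms[of "e / 2"] by auto
  have "eventually (\<lambda>t. dist (G t) 0 < e / 2) at_infinity"
    using tendstoD[OF G(1), of "e / 2"] \<open>e > 0\<close> by simp
  then show "eventually (\<lambda>t. dist (F t) 0 < e) at_infinity"
  proof eventually_elim
    case (elim t)
    have "norm (F t) \<le> norm (G t) + norm (F t - G t)" by (rule norm_triangle_sub)
    then show ?case using elim G(2)[of t] by simp
  qed
qed

text \<open>
  The transforms differ by at most the \<open>L\<^sup>1\<close> distance of the functions, so dominated pointwise
  convergence makes them converge uniformly.
\<close>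
lemma riemann_lebesgue_limit:
  fixes f :: "real \<Rightarrow> real"
  assumes s: "\<And>i::nat. integrable lborel (s i)"
    and RL: "\<And>i. ((\<lambda>t. \<integral>y. s i y *\<^sub>R cis (t * y) \<partial>lborel) \<longlongrightarrow> 0) at_infinity"
    and lim: "\<And>x. (\<lambda>i. s i x) \<longlonglongrightarrow> f x"
    and dom: "\<And>i x. \<bar>s i x\<bar> \<le> w x" and w: "integrable lborel w"
    and f: "integrable lborel f"
  shows "((\<lambda>t. \<integral>y. f y *\<^sub>R cis (t * y) \<partial>lborel) \<longlongrightarrow> 0) at_infinity"
proof (rule tendsto_0_uniform_approx)
  fix e :: real assume e: "e > 0"
  have fw: "\<bar>f x\<bar> \<le> w x" for x
    using lim[of x] by (intro LIMSEQ_le_const2[OF tendsto_rabs]) (use dom in auto)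
  have "(\<lambda>i. \<integral>y. \<bar>f y - s i y\<bar> \<partial>lborel) \<longlonglongrightarrow> integral\<^sup>L lborel (\<lambda>y::real. 0::real)"
  proof (rule integral_dominated_convergence[where w = "\<lambda>y. 2 * w y"])
    show "AE x in lborel. (\<lambda>i. \<bar>f x - s i x\<bar>) \<longlonglongrightarrow> 0"
    proof (rule AE_I2)
      fix x show "(\<lambda>i. \<bar>f x - s i x\<bar>) \<longlonglongrightarrow> 0"
        using tendsto_rabs[OF tendsto_diff[OF tendsto_const[of "f x"] lim[of x]]] by simp
    qed
    show "AE x in lborel. norm \<bar>f x - s i x\<bar> \<le> 2 * w x" for i
    proof (rule AE_I2)
      fix x show "norm \<bar>f x - s i x\<bar> \<le> 2 * w x" using fw[of x] dom[of i x] by auto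
    qed
  qed (use f s w in auto)
  then have "eventually (\<lambda>i. (\<integral>y. \<bar>f y - s i y\<bar> \<partial>lborel) < e) sequentially"
    using e by (auto intro: order_tendstoD)
  then obtain i where i: "(\<integral>y. \<bar>f y - s i y\<bar> \<partial>lborel) < e"
    by (meson eventually_happens' sequentially_bot)
  have "norm ((\<integral>y. f y *\<^sub>R cis (t * y) \<partial>lborel) - (\<integral>y. s i y *\<^sub>R cis (t * y) \<partial>lborel)) \<le> e" for t
  proof -
    have "(\<integral>y. f y *\<^sub>R cis (t * y) \<partial>lborel) - (\<integral>y. s i y *\<^sub>R cis (t * y) \<partial>lborel)
        = (\<integral>y. (f y - s i y) *\<^sub>R cis (t * y) \<partial>lborel)"
      using integrable_mult_cis[OF f, of t 0] integrable_mult_cis[OF s[of i], of t 0]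
      by (simp add: scaleR_left_diff_distrib)
    also have "norm \<dots> \<le> (\<integral>y. norm ((f y - s i y) *\<^sub>R cis (t * y)) \<partial>lborel)"
      by (rule integral_norm_bound)
    also have "\<dots> \<le> e" using i by simp
    finally show ?thesis .
  qed
  then show "\<exists>G. (G \<longlongrightarrow> 0) at_infinity \<and>
     (\<forall>t. norm ((\<integral>y. f y *\<^sub>R cis (t * y) \<partial>lborel) - G t) \<le> e)"
    using RL[of i] by blast
qed

lemma riemann_lebesgue_add:
  fixes f g :: "real \<Rightarrow> real"
  assumes "integrable lborel f" "integrable lborel g"
    and "((\<lambda>t. \<integral>y. f y *\<^sub>R cis (t * y) \<partial>lborel) \<longlongrightarrow> 0) at_infinity"
    and "((\<lambda>t. \<integral>y. g y *\<^sub>R cis (t * y) \<partial>lborel) \<longlongrightarrow> 0) at_infinity"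
  shows "((\<lambda>t. \<integral>y. (f y + c * g y) *\<^sub>R cis (t * y) \<partial>lborel) \<longlongrightarrow> 0) at_infinity"
proof -
  have "(\<integral>y. (f y + c * g y) *\<^sub>R cis (t * y) \<partial>lborel) =
     (\<integral>y. f y *\<^sub>R cis (t * y) \<partial>lborel) + c *\<^sub>R (\<integral>y. g y *\<^sub>R cis (t * y) \<partial>lborel)" for t
    using integrable_mult_cis[OF assms(1), of t 0] integrable_mult_cis[OF assms(2), of t 0]
    by (simp add: scaleR_left_distrib flip: scaleR_scaleR)
  moreover have "((\<lambda>t. (\<integral>y. f y *\<^sub>R cis (t * y) \<partial>lborel) +
      c *\<^sub>R (\<integral>y. g y *\<^sub>R cis (t * y) \<partial>lborel)) \<longlongrightarrow> 0 + c *\<^sub>R 0) at_infinity"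
    by (intro tendsto_intros assms)
  ultimately show ?thesis by simp
qed

text \<open>
  The sets with the Riemann--Lebesgue property form a Dynkin system once everything is cut down to a
  bounded interval, where constants are integrable.  Open intervals are stable under intersection
  and generate the Borel sets, so it is enough that the property holds for them, where the integral
  is elementary.
\<close>
lemma riemann_lebesgue_bounded_set:
  assumes "A \<in> sets borel"
  shows "((\<lambda>t. \<integral>y. indicat_real (A \<inter> {-n<..<n}) y *\<^sub>R cis (t * y) \<partial>lborel) \<longlongrightarrow> 0) at_infinity"
proof -
  have int: "integrable lborel (indicat_real (A \<inter> {-n<..<n}))" if "A \<in> sets borel" for A
    using that by (intro integrable_real_indicator) (auto intro!: emeasure_bounded_finite[unfolded infinity_ennreal_def] bounded_Int)
  define G :: "real set set" where "G = range (\<lambda>(a, b). {a<..<b})"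
  have gen: "sets borel = sigma_sets UNIV G"
    unfolding G_def box_real(1)[symmetric] by (subst borel_eq_box) simp
  have "{a<..<b} \<inter> {c<..<d} \<in> G" for a b c d :: real
    unfolding G_def by (rule image_eqI[of _ _ "(max a c, min b d)"]) auto
  then have "Int_stable G"
    unfolding Int_stable_def by (auto simp: G_def)
  moreover have "G \<subseteq> Pow UNIV" by simp
  moreover have "A \<in> sigma_sets UNIV G" using assms gen by simp
  ultimately show ?thesis
  proof (induction rule: sigma_sets_induct_disjoint)
    case (basic A)
    then obtain a b where "A = {a<..<b}" by (auto simp: G_def)
    then show ?case using riemann_lebesgue_interval[of "max a (-n)" "min b n"] by simp
  next
    case empty
    then show ?case by simp
  next
    case (compl A)
    then have A: "A \<in> sets borel" using gen by simp
    have "indicat_real ((UNIV - A) \<inter> {-n<..<n}) =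
        (\<lambda>y. indicat_real (UNIV \<inter> {-n<..<n}) y + (-1) * indicat_real (A \<inter> {-n<..<n}) y)"
      by (auto simp: indicator_def)
    then show ?case
      using riemann_lebesgue_add[OF int[of UNIV] int[OF A] _ compl.IH, of "-1"]
        riemann_lebesgue_interval[of "-n" n] by simp
  next
    case (union A)
    then have A: "A i \<in> sets borel" for i using gen by auto
    show ?case
    proof (rule riemann_lebesgue_limit[where s = "\<lambda>k y. indicat_real ((\<Union>i<k. A i) \<inter> {-n<..<n}) y"
          and w = "indicat_real {-n<..<n}"])
      show "integrable lborel (indicat_real ((\<Union>i<k. A i) \<inter> {-n<..<n}))" for k
        using A by (intro int) auto
      show "((\<lambda>t. \<integral>y. indicat_real ((\<Union>i<k. A i) \<inter> {-n<..<n}) y *\<^sub>R cis (t * y) \<partial>lborel) \<longlongrightarrow> 0)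
              at_infinity" for k
      proof (induction k)
        case (Suc k)
        have "indicat_real ((\<Union>i<Suc k. A i) \<inter> {-n<..<n}) =
            (\<lambda>y. indicat_real ((\<Union>i<k. A i) \<inter> {-n<..<n}) y + 1 * indicat_real (A k \<inter> {-n<..<n}) y)"
        proof -
          have "x \<notin> A i" if "x \<in> A k" "i < k" for x i
            using disjoint_family_onD[OF union(1), of k i] that by auto
          then show ?thesis by (auto simp: indicator_def less_Suc_eq fun_eq_iff)
        qed
        then show ?case
          using riemann_lebesgue_add[OF int int Suc union.IH, of k 1] A by simp
      qed simp
      show "(\<lambda>k. indicat_real ((\<Union>i<k. A i) \<inter> {-n<..<n}) x) \<longlonglongrightarrow> indicat_real (\<Union> (range A) \<inter> {-n<..<n}) x" for x
        by (simp add: indicator_inter_arith del: UN_simps) (intro tendsto_intros LIMSEQ_indicator_UN)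
      show "integrable lborel (indicat_real {-n<..<n})" using int[of UNIV] by simp
      show "integrable lborel (indicat_real (\<Union> (range A) \<inter> {-n<..<n}))" using A by (intro int) auto
    qed (auto simp: indicator_def)
  qed
qed

text \<open>
  Integrable functions are built from indicators by sums and dominated limits; a set of finite
  measure is the dominated limit of its bounded parts.
\<close>
theorem riemann_lebesgue:
  fixes f :: "real \<Rightarrow> real"
  assumes "integrable lborel f"
  shows "((\<lambda>t. \<integral>y. f y *\<^sub>R cis (t * y) \<partial>lborel) \<longlongrightarrow> 0) at_infinity"
  using assms
proof (induction rule: integrable_induct)
  case (base A c)
  have fin: "integrable lborel (indicat_real (A \<inter> B))" if "B \<in> sets borel" for B
    using base that by (intro integrable_real_indicator) (auto intro: le_less_trans[OF emeasure_mono])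
  have "((\<lambda>t. \<integral>y. indicat_real A y *\<^sub>R cis (t * y) \<partial>lborel) \<longlongrightarrow> 0) at_infinity"
  proof (rule riemann_lebesgue_limit[where s = "\<lambda>k y. indicat_real (A \<inter> {-real k<..<real k}) y"
        and w = "indicat_real A"])
    show "(\<lambda>k. indicat_real (A \<inter> {-real k<..<real k}) x) \<longlonglongrightarrow> indicat_real A x" for x
    proof (rule tendsto_eventually)
      obtain m :: nat where "\<bar>x\<bar> < real m" using reals_Archimedean2 by blast
      then show "eventually (\<lambda>k. indicat_real (A \<inter> {-real k<..<real k}) x = indicat_real A x) sequentially"
        by (intro eventually_sequentiallyI[of m]) (auto simp: indicator_def)
    qed
    show "integrable lborel (indicat_real A)" "integrable lborel (indicat_real A)"
      using fin[of UNIV] by simp_all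
    show "integrable lborel (indicat_real (A \<inter> {-real k<..<real k}))" for k
      by (rule fin) simp
    show "((\<lambda>t. \<integral>y. indicat_real (A \<inter> {-real k<..<real k}) y *\<^sub>R cis (t * y) \<partial>lborel) \<longlongrightarrow> 0) at_infinity" for k
      by (rule riemann_lebesgue_bounded_set) (use base in simp)
  qed (auto simp: indicator_def)
  then show ?case
    using riemann_lebesgue_add[of "\<lambda>_. 0" "indicat_real A" c] fin[of UNIV] by (simp add: mult.commute)
next
  case (add f g)
  then show ?case using riemann_lebesgue_add[of f g 1] by simp
next
  case (lim f s)
  then show ?case
    by (intro riemann_lebesgue_limit[where s = s and f = f and w = "\<lambda>x. 2 * \<bar>f x\<bar>"]) auto
qed

section \<open>Fourier inversion at a point of Hoelder continuity\<close>

definition fourier :: "(real \<Rightarrow> real) \<Rightarrow> real \<Rightarrow> complex" where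
  "fourier h t = (\<integral>y. h y *\<^sub>R cis (- t * y) \<partial>lborel)"

text \<open>
  The Gaussian centred at \<open>x\<close> can be inverted by an explicit integral.  It serves below to remove
  the value of a function at \<open>x\<close>.
\<close>
lemma fourier_gaussian:
  "integrable lborel (\<lambda>y. exp (- (y - x)\<^sup>2 / 2))"
  "fourier (\<lambda>y. exp (- (y - x)\<^sup>2 / 2)) t * cis (t * x) = of_real (sqrt (2 * pi) * exp (- t\<^sup>2 / 2))"
proof -
  have *: "exp (- y\<^sup>2 / 2) = sqrt (2 * pi) * std_normal_density y" for y
    by (simp add: std_normal_density_def)
  have int: "integrable lborel (\<lambda>y. exp (- y\<^sup>2 / 2) :: real)"
    unfolding * using integrable_std_normal_moment[of 0] by simp
  from lborel_integrable_real_affine[OF int, of 1 "- x"]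
  show "integrable lborel (\<lambda>y. exp (- (y - x)\<^sup>2 / 2))" by simp
  have "fourier (\<lambda>y. exp (- (y - x)\<^sup>2 / 2)) t * cis (t * x)
      = (\<integral>y. exp (- (y - x)\<^sup>2 / 2) *\<^sub>R cis (- t * (y - x)) \<partial>lborel)"
    unfolding fourier_def
    by (subst integral_mult_left_zero[symmetric]) (simp add: cis_mult algebra_simps)
  also have "\<dots> = (\<integral>y. exp (- y\<^sup>2 / 2) *\<^sub>R cis (- t * y) \<partial>lborel)"
    by (subst lborel_integral_real_affine[of 1 _ x]) simp_all
  also have "\<dots> = sqrt (2 * pi) *\<^sub>R (\<integral>y. std_normal_density y *\<^sub>R cis (- t * y) \<partial>lborel)"
    unfolding * by (simp flip: scaleR_scaleR)
  also have "(\<integral>y. std_normal_density y *\<^sub>R cis (- t * y) \<partial>lborel) = char std_normal_distribution (- t)"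
    unfolding char_def by (subst integral_density) (auto simp: cis_conv_exp mult_ac normal_density_nonneg)
  also have "\<dots> = of_real (exp (- t\<^sup>2 / 2))"
    by (simp add: char_std_normal_distribution)
  finally show "fourier (\<lambda>y. exp (- (y - x)\<^sup>2 / 2)) t * cis (t * x) = of_real (sqrt (2 * pi) * exp (- t\<^sup>2 / 2))"
    by (simp add: scaleR_conv_of_real)
qed

lemma continuous_fourier:
  assumes "integrable lborel h"
  shows "continuous_on A (fourier h)"
proof -
  have "isCont (fourier h) t" for t
  proof (rule isCont_def[THEN iffD2, OF tendsto_at_iff_sequentially[THEN iffD2]], safe)
    fix X assume X: "\<forall>i. X i \<in> UNIV - {t}" "X \<longlonglongrightarrow> t"
    show "(fourier h \<circ> X) \<longlonglongrightarrow> fourier h t"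
      unfolding fourier_def o_def
    proof (rule integral_dominated_convergence[where w = "\<lambda>y. \<bar>h y\<bar>"])
      have *: "(\<lambda>y. h y *\<^sub>R cis (- t * y)) \<in> borel_measurable lborel" for t
        using borel_measurable_integrable[OF integrable_mult_cis[OF assms, of "-t" 0]] by simp
      show "(\<lambda>y. h y *\<^sub>R cis (- t * y)) \<in> borel_measurable lborel"
        "(\<lambda>y. h y *\<^sub>R cis (- X i * y)) \<in> borel_measurable lborel" for i
        by (fact *)+
      show "AE y in lborel. (\<lambda>i. h y *\<^sub>R cis (- X i * y)) \<longlonglongrightarrow> h y *\<^sub>R cis (- t * y)"
        using X(2) by (intro AE_I2 tendsto_intros)
    qed (use assms in auto)
  qed
  then show ?thesis by (simp add: continuous_at_imp_continuous_on)
qed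

lemma integral_Icc_eq_lebesgue:
  fixes f :: "real \<Rightarrow> complex"
  assumes "continuous_on {a..b} f"
  shows "integral {a..b} f = (\<integral>t. indicat_real {a..b} t *\<^sub>R f t \<partial>lborel)"
  using set_borel_integral_eq_integral(2)[OF borel_integrable_atLeastAtMost'[OF assms]]
  by (simp add: set_lebesgue_integral_def)

text \<open>
  Multiplication by \<open>y - x\<close> is what integration in \<open>t\<close> undoes: \<open>(y - x) exp (- \<i> t (y - x))\<close> is the
  derivative in \<open>t\<close> of \<open>\<i> exp (- \<i> t (y - x))\<close>.  The integral over a bounded range of \<open>t\<close> is
  therefore a difference of two boundary values of the transform of \<open>k\<close>.
\<close>
lemma fourier_partial_inversion:
  fixes k :: "real \<Rightarrow> real"
  assumes k: "integrable lborel k" and h: "integrable lborel (\<lambda>y. (y - x) * k y)" and "a \<le> b"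
  shows "integral {a..b} (\<lambda>t. fourier (\<lambda>y. (y - x) * k y) t * cis (t * x))
     = \<i> * (fourier k b * cis (b * x) - fourier k a * cis (a * x))"
proof -
  let ?h = "\<lambda>y. (y - x) * k y"
  let ?F = "\<lambda>t y. indicat_real {a..b} t *\<^sub>R (?h y *\<^sub>R cis (- t * (y - x)))"
  have [measurable]: "k \<in> borel_measurable borel" "cis \<in> borel_measurable borel"
    using k by (auto intro!: borel_measurable_continuous_onI continuous_intros)
  have eq: "fourier f t * cis (t * x) = (\<integral>y. f y *\<^sub>R cis (- t * (y - x)) \<partial>lborel)" for f t
    unfolding fourier_def
    by (subst integral_mult_left_zero[symmetric]) (simp add: cis_mult algebra_simps)
  have "continuous_on {a..b} (\<lambda>t. fourier ?h t * cis (t * x))"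
    by (intro continuous_intros continuous_fourier h)
  then have "integral {a..b} (\<lambda>t. fourier ?h t * cis (t * x)) = (\<integral>t. indicat_real {a..b} t *\<^sub>R (fourier ?h t * cis (t * x)) \<partial>lborel)"
    by (rule integral_Icc_eq_lebesgue)
  also have "\<dots> = (\<integral>t. (\<integral>y. ?F t y \<partial>lborel) \<partial>lborel)"
    unfolding eq by (simp del: scaleR_scaleR)
  also have "\<dots> = (\<integral>y. (\<integral>t. ?F t y \<partial>lborel) \<partial>lborel)"
  proof (rule lborel_pair.Fubini_integral[symmetric], rule lborel_pair.Fubini_integrable)
    show "integrable lborel (\<lambda>t. \<integral>y. norm (case (t, y) of (t, y) \<Rightarrow> ?F t y) \<partial>lborel)"
    proof -
      have "integrable lborel (indicat_real {a..b})" 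
        by (intro integrable_real_indicator) (auto simp: emeasure_lborel_Icc_eq)
      then show ?thesis by (simp add: abs_mult)
    qed
    show "AE t in lborel. integrable lborel (\<lambda>y. case (t, y) of (t, y) \<Rightarrow> ?F t y)"
    proof (rule AE_I2)
      fix t
      have "integrable lborel (\<lambda>y. ?h y *\<^sub>R cis (- t * (y - x)))"
        using integrable_mult_cis[OF h, of "- t" "t * x"] by (simp add: algebra_simps)
      then show "integrable lborel (\<lambda>y. case (t, y) of (t, y) \<Rightarrow> ?F t y)"
        by (simp only: prod.case integrable_scaleR_right)
    qed
  qed measurable
  also have "(\<lambda>y. \<integral>t. ?F t y \<partial>lborel) = (\<lambda>y. \<i> * (k y *\<^sub>R cis (- b * (y - x))) - \<i> * (k y *\<^sub>R cis (- a * (y - x))))"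
  proof
    fix y
    have int: "((\<lambda>t. ?h y *\<^sub>R cis (- t * (y - x))) has_integral
        \<i> * (k y *\<^sub>R cis (- b * (y - x))) - \<i> * (k y *\<^sub>R cis (- a * (y - x)))) {a..b}"
    proof (rule fundamental_theorem_of_calculus[OF \<open>a \<le> b\<close>])
      fix t
      have "((\<lambda>t. \<i> * (of_real (k y) * exp (- (\<i> * of_real (y - x)) * t))) has_field_derivative
           of_real (?h y) * exp (- (\<i> * of_real (y - x)) * of_real t)) (at (of_real t))"
        by (auto intro!: derivative_eq_intros simp: algebra_simps)
      from has_vector_derivative_real_field[OF this]
      show "((\<lambda>t. \<i> * (k y *\<^sub>R cis (- t * (y - x)))) has_vector_derivative
            ?h y *\<^sub>R cis (- t * (y - x))) (at t within {a..b})"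
        by (simp add: cis_conv_exp scaleR_conv_of_real algebra_simps)
    qed
    have cont: "continuous_on {a..b} (\<lambda>t. ?h y *\<^sub>R cis (- t * (y - x)))"
      by (intro continuous_intros)
    show "(\<integral>t. ?F t y \<partial>lborel) = \<i> * (k y *\<^sub>R cis (- b * (y - x))) - \<i> * (k y *\<^sub>R cis (- a * (y - x)))"
      unfolding integral_Icc_eq_lebesgue[OF cont, symmetric] by (rule integral_unique[OF int])
  qed
  also have "(\<integral>y. \<i> * (k y *\<^sub>R cis (- b * (y - x))) - \<i> * (k y *\<^sub>R cis (- a * (y - x))) \<partial>lborel)
     = \<i> * (\<integral>y. k y *\<^sub>R cis (- b * (y - x)) \<partial>lborel) - \<i> * (\<integral>y. k y *\<^sub>R cis (- a * (y - x)) \<partial>lborel)"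
  proof -
    have *: "integrable lborel (\<lambda>y. k y *\<^sub>R cis (- b * (y - x)))" for b
      using integrable_mult_cis[OF k, of "- b" "b * x"] by (simp add: algebra_simps)
    show ?thesis
      by (simp only: Bochner_Integration.integral_diff[OF integrable_mult_right[OF *] integrable_mult_right[OF *]]
            integral_mult_right_zero)
  qed
  finally show ?thesis by (simp add: eq algebra_simps)
qed

text \<open>
  On the real line the Henstock--Kurzweil integral is improper in the sense that both ends may tend
  to infinity independently, which is expressed by a product filter.
\<close>
lemma has_integral_UNIV_lim:
  fixes f :: "real \<Rightarrow> complex"
  assumes int: "\<And>a b. f integrable_on {a..b}"
    and lim: "((\<lambda>(a, b). integral {a..b} f) \<longlongrightarrow> I) (at_bot \<times>\<^sub>F at_top)"
  shows "(f has_integral I) UNIV"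
  unfolding has_integral_alt'
proof (intro conjI allI impI)
  fix e :: real assume "e > 0"
  have "\<forall>\<^sub>F p in at_bot \<times>\<^sub>F at_top. dist (case p of (a, b) \<Rightarrow> integral {a..b} f) I < e"
    using tendstoD[OF lim \<open>e > 0\<close>] .
  then obtain P Q where PQ: "eventually P at_bot" "eventually Q at_top"
     "\<And>a b. P a \<Longrightarrow> Q b \<Longrightarrow> norm (integral {a..b} f - I) < e"
    unfolding eventually_prod_filter by (auto simp: dist_norm)
  obtain A B where AB: "\<And>a. a \<le> A \<Longrightarrow> P a" "\<And>b. b \<ge> B \<Longrightarrow> Q b"
    using PQ(1,2) by (auto simp: eventually_at_bot_linorder eventually_at_top_linorder)
  define R where "R = \<bar>A\<bar> + \<bar>B\<bar> + 1"
  have "norm (integral {a..b} f - I) < e" if "ball 0 R \<subseteq> {a..b}" for a b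
  proof (rule PQ(3))
    have "- (\<bar>A\<bar> + \<bar>B\<bar>) \<in> ball 0 R" "\<bar>A\<bar> + \<bar>B\<bar> \<in> ball 0 R"
      by (auto simp: R_def)
    then have "- (\<bar>A\<bar> + \<bar>B\<bar>) \<in> {a..b}" "\<bar>A\<bar> + \<bar>B\<bar> \<in> {a..b}"
      using that by blast+
    then show "P a" "Q b" by (auto intro!: AB)
  qed
  moreover have "R > 0" by (simp add: R_def)
  ultimately show "\<exists>B>0. \<forall>a b. ball 0 B \<subseteq> cbox a b \<longrightarrow>
     norm (integral (cbox a b) (\<lambda>x. if x \<in> UNIV then f x else 0) - I) < e"
    by auto
qed (use int in auto)

text \<open>
  Subtracting \<open>h x\<close> times the Gaussian at \<open>x\<close> reduces the claim to a function \<open>g\<close> with \<open>g x = 0\<close>.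
  By the Hoelder condition \<open>k y = g y / (y - x)\<close> is still integrable (Dini's condition), and then
  the partial integrals are boundary values of the transform of \<open>k\<close>, which tend to 0 by the
  Riemann--Lebesgue lemma.  The two ends are treated separately, so they may tend to infinity
  independently of each other.
\<close>
theorem fourier_inversion_Hoelder:
  fixes h :: "real \<Rightarrow> real"
  assumes h: "integrable lborel h" and "\<delta> > 0"
    and Hoelder: "(\<lambda>y. h y - h x) \<in> O[at x](\<lambda>y. \<bar>y - x\<bar> powr \<delta>)"
  shows "((\<lambda>t. fourier h t * cis (t * x)) has_integral of_real (2 * pi * h x)) UNIV"
proof -
  define \<phi> where "\<phi> y = exp (- (y - x)\<^sup>2 / 2)" for y
  define g where "g y = h y - h x * \<phi> y" for y
  define k where "k y = g y / (y - x)" for y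
  have \<phi>: "integrable lborel \<phi>"
    unfolding \<phi>_def by (rule fourier_gaussian)
  have g: "integrable lborel g" unfolding g_def using h \<phi> by auto
  have [measurable]: "g \<in> borel_measurable borel" using g by auto
  have gk: "(y - x) * k y = g y" for y
    by (simp add: k_def g_def \<phi>_def)
  have k: "integrable lborel k"
  proof -
    \<comment> \<open>The Gaussian itself is Lipschitz at \<open>x\<close>, so the exponent of \<open>g\<close> is capped at 1.\<close>
    define \<delta>' where "\<delta>' = min \<delta> 1"
    have \<delta>': "\<delta>' > 0" using \<open>\<delta> > 0\<close> by (simp add: \<delta>'_def)
    obtain c where c: "c > 0" "eventually (\<lambda>y. \<bar>h y - h x\<bar> \<le> c * \<bar>y - x\<bar> powr \<delta>) (at x)"
      using Hoelder by (elim landau_o.bigE) auto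
    define C where "C = c + \<bar>h x\<bar>"
    have "C > 0" using c by (simp add: C_def)
    have "eventually (\<lambda>y. \<bar>y - x\<bar> < 1) (at x)"
      unfolding eventually_at by (intro exI[of _ 1]) (auto simp: dist_real_def)
    then have "eventually (\<lambda>y. \<bar>g y\<bar> \<le> C * \<bar>y - x\<bar> powr \<delta>') (at x)"
      using c(2)
    proof eventually_elim
      case (elim y)
      let ?w = "\<bar>y - x\<bar>"
      have "0 \<le> 1 - \<phi> y" "1 - \<phi> y \<le> ?w\<^sup>2 / 2"
        using exp_ge_add_one_self[of "- (y - x)\<^sup>2 / 2"] by (auto simp: \<phi>_def)
      moreover have "?w\<^sup>2 \<le> ?w powr \<delta>'"
        using powr_mono'[of \<delta>' 2 ?w] elim by (auto simp: \<delta>'_def powr_numeral)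
      ultimately have "\<bar>1 - \<phi> y\<bar> \<le> ?w powr \<delta>'" by auto
      then have 1: "\<bar>h x * (1 - \<phi> y)\<bar> \<le> \<bar>h x\<bar> * ?w powr \<delta>'"
        by (simp add: abs_mult mult_left_mono)
      have "?w powr \<delta> \<le> ?w powr \<delta>'"
        using powr_mono'[of \<delta>' \<delta> ?w] elim by (auto simp: \<delta>'_def)
      then have 2: "\<bar>h y - h x\<bar> \<le> c * ?w powr \<delta>'"
        using elim(2) mult_left_mono[of _ _ c] c(1) by (smt (verit))
      have "\<bar>g y\<bar> = \<bar>(h y - h x) + h x * (1 - \<phi> y)\<bar>" by (simp add: g_def algebra_simps)
      also have "\<dots> \<le> C * ?w powr \<delta>'" using 1 2 by (simp add: C_def algebra_simps)
      finally show ?case .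
    qed
    then obtain r where r: "r > 0" "\<And>y. y \<noteq> x \<Longrightarrow> \<bar>y - x\<bar> < r \<Longrightarrow> \<bar>g y\<bar> \<le> C * \<bar>y - x\<bar> powr \<delta>'"
      unfolding eventually_at by (auto simp: dist_real_def)
    have int0: "integrable lborel (\<lambda>y. indicat_real {-r..r} y * \<bar>y\<bar> powr (\<delta>' - 1))"
    proof -
      have "(\<lambda>y. y powr (\<delta>' - 1)) integrable_on {0..r}"
        using \<delta>' r by (intro integrable_on_powr_from_0) auto
      then have "(\<lambda>y. y powr (\<delta>' - 1)) absolutely_integrable_on {0..r}"
        by (intro nonnegative_absolutely_integrable_1) auto
      then have "integrable lborel (\<lambda>y. indicat_real {0..r} y * y powr (\<delta>' - 1))"
        by (simp add: set_integrable_def integrable_completion)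
      note int = this lborel_integrable_real_affine[OF this, of "-1" 0]
      have "indicat_real {-r..r} y * \<bar>y\<bar> powr (\<delta>' - 1) =
         indicat_real {0..r} y * y powr (\<delta>' - 1) + indicat_real {0..r} (- y) * (- y) powr (\<delta>' - 1)" for y
        by (auto simp: indicator_def)
      then show ?thesis using int by simp
    qed
    have "integrable lborel (\<lambda>y. C * (indicat_real {-r..r} (y - x) * \<bar>y - x\<bar> powr (\<delta>' - 1)) + \<bar>g y\<bar> / r)"
      using lborel_integrable_real_affine[OF int0, of 1 "- x"] g by auto
    then show ?thesis
    proof (rule Bochner_Integration.integrable_bound)
      show "k \<in> borel_measurable lborel" unfolding k_def by measurable
      show "AE y in lborel. norm (k y) \<le> norm (C * (indicat_real {-r..r} (y - x) * \<bar>y - x\<bar> powr (\<delta>' - 1)) + \<bar>g y\<bar> / r)"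
      proof (rule AE_I2)
        fix y
        consider "y = x" | "y \<noteq> x" "\<bar>y - x\<bar> < r" | "r \<le> \<bar>y - x\<bar>" by linarith
        then show "norm (k y) \<le> norm (C * (indicat_real {-r..r} (y - x) * \<bar>y - x\<bar> powr (\<delta>' - 1)) + \<bar>g y\<bar> / r)"
        proof cases
          case 2
          have "norm (k y) = \<bar>g y\<bar> / \<bar>y - x\<bar>" by (simp add: k_def abs_divide)
          also have "\<dots> \<le> C * \<bar>y - x\<bar> powr \<delta>' / \<bar>y - x\<bar>"
            using r(2)[of y] 2 by (intro divide_right_mono) auto
          also have "\<dots> = C * \<bar>y - x\<bar> powr (\<delta>' - 1)"
            using 2 by (simp add: powr_diff)
          finally have "norm (k y) \<le> C * \<bar>y - x\<bar> powr (\<delta>' - 1)" .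
          moreover have "0 \<le> \<bar>g y\<bar> / r" using r by simp
          ultimately have "norm (k y) \<le> C * \<bar>y - x\<bar> powr (\<delta>' - 1) + \<bar>g y\<bar> / r" by linarith
          also have "\<dots> = C * (indicat_real {-r..r} (y - x) * \<bar>y - x\<bar> powr (\<delta>' - 1)) + \<bar>g y\<bar> / r"
            using 2 by (simp add: indicator_def abs_less_iff)
          finally show ?thesis by simp
        next
          case 3
          have "norm (k y) = \<bar>g y\<bar> / \<bar>y - x\<bar>" by (simp add: k_def abs_divide)
          also have "\<dots> \<le> \<bar>g y\<bar> / r" using 3 r by (intro divide_left_mono mult_pos_pos) auto
          finally show ?thesis using r \<open>C > 0\<close> by (auto intro!: order_trans[OF _ abs_ge_self] add_increasing)
        qed (simp add: k_def)
      qed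
    qed
  qed
  have tail: "((\<lambda>t. fourier k t * cis (t * x)) \<longlongrightarrow> 0) at_infinity"
  proof (rule Lim_null_comparison)
    \<comment> \<open>The transform is taken with \<open>- t\<close>, the Riemann--Lebesgue lemma with \<open>t\<close>.\<close>
    have "filterlim (\<lambda>t::real. - t) at_infinity at_infinity"
      using filterlim_norm_at_top[where 'a = real]
      by (simp add: filterlim_at_infinity_conv_norm_at_top real_norm_def[abs_def])
    from filterlim_compose[OF riemann_lebesgue[OF k] this]
    show "((\<lambda>t. norm (fourier k t)) \<longlongrightarrow> 0) at_infinity"
      unfolding fourier_def by (intro tendsto_norm_zero) simp
  qed (simp add: norm_mult)
  have part: "integral {a..b} (\<lambda>t. fourier g t * cis (t * x))
     = \<i> * (fourier k b * cis (b * x) - fourier k a * cis (a * x))" if "a \<le> b" for a b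
    using fourier_partial_inversion[OF k _ that, of x] g by (simp add: gk)
  have "((\<lambda>t. fourier g t * cis (t * x)) has_integral 0) UNIV"
  proof (rule has_integral_UNIV_lim)
    show "(\<lambda>t. fourier g t * cis (t * x)) integrable_on {a..b}" for a b
      by (intro integrable_continuous_real continuous_intros continuous_fourier g)
    have "((\<lambda>(a, b). \<i> * (fourier k b * cis (b * x) - fourier k a * cis (a * x))) \<longlongrightarrow> \<i> * (0 - 0)) (at_bot \<times>\<^sub>F at_top)"
      unfolding case_prod_beta'
      by (intro tendsto_intros filterlim_compose[OF tail]
           filterlim_compose[OF _ filterlim_fst] filterlim_compose[OF _ filterlim_snd])
         (auto intro: filterlim_at_infinity_imp_norm_at_top filterlim_mono[OF filterlim_ident] simp: at_bot_le_at_infinity at_top_le_at_infinity)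
    moreover have "\<forall>\<^sub>F p in at_bot \<times>\<^sub>F at_top. \<i> * (fourier k (snd p) * cis (snd p * x) - fourier k (fst p) * cis (fst p * x))
        = integral {fst p..snd p} (\<lambda>t. fourier g t * cis (t * x))"
      unfolding eventually_prod_filter
      by (intro exI[of _ "\<lambda>a. a \<le> 0"] exI[of _ "\<lambda>b. b \<ge> 0"])
         (auto simp: eventually_le_at_bot eventually_ge_at_top part)
    ultimately show "((\<lambda>(a, b). integral {a..b} (\<lambda>t. fourier g t * cis (t * x))) \<longlongrightarrow> 0) (at_bot \<times>\<^sub>F at_top)"
      unfolding case_prod_beta' by (subst tendsto_cong[OF eventually_mono, rotated]) auto
  qed
  moreover have "((\<lambda>t. fourier \<phi> t * cis (t * x)) has_integral of_real (2 * pi)) UNIV"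
  proof -
    have "fourier \<phi> t * cis (t * x) = 2 * pi * std_normal_density t" for t
    proof -
      have "sqrt (2 * pi) * exp (- t\<^sup>2 / 2) = 2 * pi / sqrt (2 * pi) * exp (- t\<^sup>2 / 2)"
        using real_div_sqrt[of "2 * pi"] by simp
      then have "sqrt (2 * pi) * exp (- t\<^sup>2 / 2) = 2 * pi * std_normal_density t"
        by (simp add: std_normal_density_def)
      then show ?thesis unfolding \<phi>_def fourier_gaussian(2) by simp
    qed
    moreover have "integrable lborel std_normal_density" "integral\<^sup>L lborel std_normal_density = 1"
      using integrable_std_normal_moment[of 0] integral_std_normal_moment_even[of 0] by simp_all
    ultimately show ?thesis
      using has_integral_integral_lborel[of "\<lambda>t. complex_of_real (2 * pi * std_normal_density t)"] by simp
  qed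
  ultimately have "((\<lambda>t. fourier g t * cis (t * x) + of_real (h x) * (fourier \<phi> t * cis (t * x))) has_integral
      0 + of_real (h x) * of_real (2 * pi)) UNIV"
    by (intro has_integral_add has_integral_mult_right)
  moreover have "fourier g t = fourier h t - of_real (h x) * fourier \<phi> t" for t
    unfolding fourier_def g_def
    using integrable_mult_cis[OF h, of "-t" 0] integrable_mult_cis[OF \<phi>, of "-t" 0]
    by (simp add: scaleR_left_diff_distrib flip: scaleR_scaleR scaleR_conv_of_real)
  ultimately show ?thesis by (simp add: algebra_simps)
qed

section \<open>Fourier transforms of convolutions\<close>

text \<open>
  Fubini's theorem for \<open>f p * g (y - p)\<close>, where \<open>cis (- t * y)\<close> splits into the factors with
  \<open>p\<close> and \<open>y - p\<close>.
\<close>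
lemma convolution_fourier:
  fixes f g :: "real \<Rightarrow> real"
  assumes f: "integrable lborel f" and g: "integrable lborel g"
  defines "h \<equiv> \<lambda>y. \<integral>p. f p * g (y - p) \<partial>lborel"
  shows "integrable lborel h" "fourier h t = fourier f t * fourier g t"
proof -
  have [measurable]: "f \<in> borel_measurable borel" "g \<in> borel_measurable borel" "cis \<in> borel_measurable borel"
    using f g by (auto intro!: borel_measurable_continuous_onI continuous_intros)
  have shift: "integrable lborel (\<lambda>y. G (y - p))" if "integrable lborel G" for G :: "real \<Rightarrow> real" and p
    using lborel_integrable_real_affine[OF that, of 1 "- p"] by simp
  have shiftI: "(\<integral>y. G (y - p) \<partial>lborel) = integral\<^sup>L lborel G" for G :: "real \<Rightarrow> 'a::euclidean_space" and p
    by (subst (2) lborel_integral_real_affine[of 1 _ "- p"]) simp_all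
  have prod: "integrable (lborel \<Otimes>\<^sub>M lborel) (\<lambda>(p, y). f p * g (y - p))"
  proof (rule lborel_pair.Fubini_integrable)
    have "(\<lambda>p. \<integral>y. norm (case (p, y) of (p, y) \<Rightarrow> f p * g (y - p)) \<partial>lborel) = (\<lambda>p. \<bar>f p\<bar> * (\<integral>y. \<bar>g y\<bar> \<partial>lborel))"
      using shiftI[of "\<lambda>y. \<bar>g y\<bar>"] by (simp add: abs_mult)
    then show "integrable lborel (\<lambda>p. \<integral>y. norm (case (p, y) of (p, y) \<Rightarrow> f p * g (y - p)) \<partial>lborel)"
      using f by simp
  qed (use shift[OF g] in auto)
  from lborel_pair.integrable_snd[OF prod] show "integrable lborel h" by (simp add: h_def)
  have prod': "integrable (lborel \<Otimes>\<^sub>M lborel) (\<lambda>(p, y). (f p * g (y - p)) *\<^sub>R cis (- t * y))"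
    by (rule Bochner_Integration.integrable_bound[OF prod]) auto
  have "fourier h t = (\<integral>y. (\<integral>p. (f p * g (y - p)) *\<^sub>R cis (- t * y) \<partial>lborel) \<partial>lborel)"
    unfolding fourier_def h_def by (simp only: scaleR_conv_of_real integral_mult_left_zero integral_complex_of_real)
  also have "\<dots> = (\<integral>p. (\<integral>y. (f p * g (y - p)) *\<^sub>R cis (- t * y) \<partial>lborel) \<partial>lborel)"
    by (rule lborel_pair.Fubini_integral[OF prod'])
  also have "(\<lambda>p. \<integral>y. (f p * g (y - p)) *\<^sub>R cis (- t * y) \<partial>lborel) = (\<lambda>p. (f p *\<^sub>R cis (- t * p)) * fourier g t)"
  proof
    fix p
    have "(\<lambda>y. (f p * g (y - p)) *\<^sub>R cis (- t * y)) = (\<lambda>y. (f p *\<^sub>R cis (- t * p)) * (g (y - p) *\<^sub>R cis (- t * (y - p))))"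
      by (simp add: cis_mult algebra_simps)
    then have "(\<integral>y. (f p * g (y - p)) *\<^sub>R cis (- t * y) \<partial>lborel)
        = (f p *\<^sub>R cis (- t * p)) * (\<integral>y. g (y - p) *\<^sub>R cis (- t * (y - p)) \<partial>lborel)"
      by (simp only: integral_mult_right_zero)
    then show "(\<integral>y. (f p * g (y - p)) *\<^sub>R cis (- t * y) \<partial>lborel) = (f p *\<^sub>R cis (- t * p)) * fourier g t"
      by (simp only: shiftI[of "\<lambda>y. g y *\<^sub>R cis (- t * y)" p] fourier_def)
  qed
  also have "(\<integral>p. (f p *\<^sub>R cis (- t * p)) * fourier g t \<partial>lborel) = fourier f t * fourier g t"
    unfolding fourier_def by (rule integral_mult_left_zero)
  finally show "fourier h t = fourier f t * fourier g t" .
qed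

section \<open>Partial fractions of the Beta function\<close>

text \<open>
  The coefficient of \<open>x ^ k\<close> in \<open>(1 - x) powr (b - 1)\<close>, that is \<open>(- 1) ^ k * (b - 1 gchoose k)\<close>.
  The form with \<open>pochhammer\<close> is the one that occurs in hypergeometric series.
\<close>
definition binom_coeff :: "real \<Rightarrow> nat \<Rightarrow> real" where
  "binom_coeff b k = pochhammer (1 - b) k / fact k"

lemma binom_coeff_Suc: "binom_coeff b (Suc k) = binom_coeff b k * (1 - b / (real k + 1))"
  by (simp add: binom_coeff_def pochhammer_Suc field_simps)

lemma binom_coeff_sums:
  assumes "\<bar>x\<bar> < 1"
  shows "(\<lambda>k. binom_coeff b k * x ^ k) sums (1 - x) powr (b - 1)"
proof -
  have "(b - 1 gchoose k) * (- x) ^ k = binom_coeff b k * x ^ k" for k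
  proof -
    have "(- x) ^ k = (- 1) ^ k * x ^ k" by (rule power_minus)
    moreover have "(- 1 :: real) ^ k * (- 1) ^ k = 1" by (simp flip: power_mult_distrib)
    ultimately show ?thesis
      by (simp add: binom_coeff_def gbinomial_pochhammer field_simps)
  qed
  then show ?thesis using gen_binomial_real[of "- x" "b - 1"] assms by simp
qed

text \<open>
  From \<open>k \<ge> b\<close> on the coefficients keep their sign and decrease in absolute value, and the
  recurrence makes \<open>b\<close> times the summand the difference of consecutive absolute values.  The
  series telescopes.
\<close>
lemma summable_abs_binom_coeff:
  assumes "b > 0"
  shows "summable (\<lambda>k. \<bar>binom_coeff b k\<bar> / (real k + 1))"
proof -
  define N where "N = nat \<lceil>b\<rceil>"
  have "summable (\<lambda>k. \<bar>binom_coeff b (k + N)\<bar> / (real (k + N) + 1))"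
  proof (rule bounded_imp_summable)
    have step: "b * (\<bar>binom_coeff b (k + N)\<bar> / (real (k + N) + 1)) = \<bar>binom_coeff b (k + N)\<bar> - \<bar>binom_coeff b (Suc k + N)\<bar>" for k
    proof -
      have "b \<le> real N" unfolding N_def by linarith
      then have "0 \<le> 1 - b / (real (k + N) + 1)" by (simp add: field_simps)
      then have "\<bar>binom_coeff b (Suc (k + N))\<bar> = \<bar>binom_coeff b (k + N)\<bar> * (1 - b / (real (k + N) + 1))"
        by (simp only: binom_coeff_Suc abs_mult abs_of_nonneg)
      then show ?thesis by (simp add: algebra_simps)
    qed
    have "b * (\<Sum>k\<le>n. \<bar>binom_coeff b (k + N)\<bar> / (real (k + N) + 1)) = \<bar>binom_coeff b N\<bar> - \<bar>binom_coeff b (Suc n + N)\<bar>" for n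
      unfolding sum_distrib_left step by (subst sum_telescope) simp
    then have "b * (\<Sum>k\<le>n. \<bar>binom_coeff b (k + N)\<bar> / (real (k + N) + 1)) \<le> \<bar>binom_coeff b N\<bar>" for n
      by simp
    then show "(\<Sum>k\<le>n. \<bar>binom_coeff b (k + N)\<bar> / (real (k + N) + 1)) \<le> \<bar>binom_coeff b N\<bar> / b" for n
      using assms by (simp add: field_simps)
  qed auto
  then show ?thesis by (subst (asm) summable_iff_shift)
qed

lemma shifted_denominator_bound:
  fixes s :: complex
  assumes "\<And>k::nat. d \<le> norm (s + of_nat k)" "d > 0"
  shows "(real k + 1) / norm (s + of_nat k) \<le> 1 + (norm s + 1) / d"
proof -
  have "real k + 1 \<le> norm (s + of_nat k) + (norm s + 1)"
    using norm_triangle_ineq4[of "s + of_nat k" s] by (simp add: norm_of_nat)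
  then have "(real k + 1) / norm (s + of_nat k) \<le> (norm (s + of_nat k) + (norm s + 1)) / norm (s + of_nat k)"
    by (intro divide_right_mono) auto
  also have "\<dots> = 1 + (norm s + 1) / norm (s + of_nat k)"
    using assms(1)[of k] assms(2) by (auto simp: add_divide_distrib)
  also have "\<dots> \<le> 1 + (norm s + 1) / d"
    using assms(1)[of k] assms(2) by (intro add_left_mono divide_left_mono mult_pos_pos) auto
  finally show ?thesis .
qed


text \<open>
  Expanding \<open>(1 - x) powr (b - 1)\<close> in the Beta integral and integrating term by term gives the
  partial fraction series of the Beta function; the series makes sense for every \<open>s\<close> that is not a
  non-positive integer.
\<close>
definition beta_series :: "real \<Rightarrow> complex \<Rightarrow> complex" where
  "beta_series b s = (\<Sum>k. of_real (binom_coeff b k) / (s + of_nat k))"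

text \<open>
  The denominators grow like \<open>k\<close>, uniformly for \<open>s\<close> in a bounded set away from the poles, so the
  series is dominated by a multiple of \<open>summable_abs_binom_coeff\<close>.
\<close>
lemma beta_series_term_bound:
  fixes s :: complex
  assumes "\<And>k::nat. d \<le> norm (s + of_nat k)" "d > 0" "norm s \<le> R"
  shows "norm (of_real (binom_coeff b k) / (s + of_nat k)) \<le> (1 + (R + 1) / d) * (\<bar>binom_coeff b k\<bar> / (real k + 1))"
proof -
  have "norm (of_real (binom_coeff b k) / (s + of_nat k))
     = (\<bar>binom_coeff b k\<bar> / (real k + 1)) * ((real k + 1) / norm (s + of_nat k))"
    by (simp add: norm_divide)
  also have "\<dots> \<le> (\<bar>binom_coeff b k\<bar> / (real k + 1)) * (1 + (norm s + 1) / d)"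
    by (intro mult_left_mono shifted_denominator_bound assms) auto
  also have "\<dots> \<le> (\<bar>binom_coeff b k\<bar> / (real k + 1)) * (1 + (R + 1) / d)"
    using assms by (intro mult_left_mono add_left_mono divide_right_mono) auto
  finally show ?thesis by (simp only: mult.commute)
qed

lemma nonpos_Ints_distance:
  fixes s :: complex
  assumes "s \<notin> \<int>\<^sub>\<le>\<^sub>0"
  obtains d where "d > 0" "\<And>(k::nat) w. w \<in> cball s d \<Longrightarrow> d \<le> norm (w + of_nat k)" "cball s d \<subseteq> - \<int>\<^sub>\<le>\<^sub>0"
proof -
  have "open (- \<int>\<^sub>\<le>\<^sub>0 :: complex set)" by (simp add: open_Compl)
  then obtain e where e: "e > 0" "cball s e \<subseteq> - \<int>\<^sub>\<le>\<^sub>0"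
    using assms open_contains_cball[of "- \<int>\<^sub>\<le>\<^sub>0 :: complex set"] by (metis ComplI)
  have "e / 2 \<le> norm (w + of_nat k)" if "w \<in> cball s (e / 2)" for k :: nat and w
  proof -
    have "- of_nat k \<in> (\<int>\<^sub>\<le>\<^sub>0 :: complex set)" by simp
    then have "- of_nat k \<notin> cball s e" using e(2) by blast
    then have "e < norm (s + of_nat k)" by (simp add: dist_norm)
    also have "\<dots> \<le> norm (w + of_nat k) + norm (s - w)"
      using norm_triangle_ineq[of "w + of_nat k" "s - w"] by (simp add: algebra_simps)
    finally show ?thesis using that by (simp add: dist_norm)
  qed
  moreover have "cball s (e / 2) \<subseteq> - \<int>\<^sub>\<le>\<^sub>0" using e by (auto simp: subset_iff)
  ultimately show ?thesis using that[of "e / 2"] e by auto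
qed

lemma beta_series_summable:
  fixes s :: complex
  assumes "b > 0" "s \<notin> \<int>\<^sub>\<le>\<^sub>0"
  shows "summable (\<lambda>k. norm (of_real (binom_coeff b k) / (s + of_nat k)))"
proof -
  obtain d where d: "d > 0" "\<And>(k::nat) w. w \<in> cball s d \<Longrightarrow> d \<le> norm (w + of_nat k)"
    using nonpos_Ints_distance[OF assms(2)] by metis
  show ?thesis
    by (rule summable_comparison_test'[OF summable_mult[OF summable_abs_binom_coeff[OF assms(1)]], of 0])
       (use beta_series_term_bound[of d s "norm s" b] d in auto)
qed

lemma beta_series_holomorphic:
  assumes "b > 0"
  shows "beta_series b holomorphic_on - \<int>\<^sub>\<le>\<^sub>0"
proof (rule holomorphic_uniform_sequence[where f = "\<lambda>n s. \<Sum>k<n. of_real (binom_coeff b k) / (s + of_nat k)"])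
  show "(\<lambda>s. \<Sum>k<n. complex_of_real (binom_coeff b k) / (s + of_nat k)) holomorphic_on - \<int>\<^sub>\<le>\<^sub>0" for n
    by (intro holomorphic_intros) (auto simp: add_eq_0_iff2)
  fix s :: complex assume "s \<in> - \<int>\<^sub>\<le>\<^sub>0"
  then obtain d where d: "d > 0" "\<And>(k::nat) w. w \<in> cball s d \<Longrightarrow> d \<le> norm (w + of_nat k)" "cball s d \<subseteq> - \<int>\<^sub>\<le>\<^sub>0"
    using nonpos_Ints_distance[of s] by auto
  have "uniform_limit (cball s d) (\<lambda>n s. \<Sum>k<n. of_real (binom_coeff b k) / (s + of_nat k)) (beta_series b) sequentially"
    unfolding beta_series_def
  proof (rule Weierstrass_m_test)
    show "summable (\<lambda>k. (1 + (norm s + d + 1) / d) * (\<bar>binom_coeff b k\<bar> / (real k + 1)))"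
      by (intro summable_mult summable_abs_binom_coeff assms)
    show "norm (of_real (binom_coeff b k) / (w + of_nat k)) \<le> (1 + (norm s + d + 1) / d) * (\<bar>binom_coeff b k\<bar> / (real k + 1))"
      if "w \<in> cball s d" for k w
    proof (rule beta_series_term_bound)
      show "norm w \<le> norm s + d"
        using that norm_triangle_ineq2[of w s] by (simp add: dist_norm norm_minus_commute)
    qed (use d that in auto)
  qed
  then show "\<exists>d>0. cball s d \<subseteq> - \<int>\<^sub>\<le>\<^sub>0 \<and> uniform_limit (cball s d) (\<lambda>n s. \<Sum>k<n. complex_of_real (binom_coeff b k) / (s + of_nat k)) (beta_series b) sequentially"
    using d by blast
qed (simp add: open_Compl)

text \<open>
  The Laplace transforms of the individual terms in the expansion of a Beta integral.
\<close>
lemma exp_decay_integral: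
  fixes z :: complex
  assumes "Re z > 0"
  shows "integrable lborel (\<lambda>y. indicat_real {0<..} y *\<^sub>R exp (- z * of_real y))"
    and "(\<integral>y. indicat_real {0<..} y *\<^sub>R exp (- z * of_real y) \<partial>lborel) = 1 / z"
    and "(\<integral>y. norm (indicat_real {0<..} y *\<^sub>R exp (- z * of_real y)) \<partial>lborel) = 1 / Re z"
proof -
  let ?f = "\<lambda>y. exp (- z * of_real y)"
  have lim: "((\<lambda>y. exp (- Re z * y)) \<longlongrightarrow> 0) at_top"
    using assms by real_asymp
  have z0: "z \<noteq> 0" using assms by auto
  have n: "norm (?f y) = exp (- Re z * y)" for y by simp
  have A: "(((\<lambda>y. - (exp (- Re z * y) / Re z)) \<circ> real_of_ereal) \<longlongrightarrow> - (1 / Re z)) (at_right 0)"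
    unfolding zero_ereal_def ereal_tendsto_simps
    by (rule tendsto_eq_intros refl)+ (use assms in auto)
  have B: "(((\<lambda>y. - (exp (- Re z * y) / Re z)) \<circ> real_of_ereal) \<longlongrightarrow> 0) (at_left \<infinity>)"
    unfolding ereal_tendsto_simps
    using tendsto_minus[OF tendsto_divide[OF lim tendsto_const[of "Re z"]]] assms by simp
  have real: "set_integrable lborel (einterval 0 \<infinity>) (\<lambda>y. exp (- Re z * y))"
    "(LBINT y=0..\<infinity>. exp (- Re z * y)) = 0 - (- (1 / Re z))"
    by (rule interval_integral_FTC_nonneg[OF _ _ _ _ A B];
        use assms in \<open>auto intro!: derivative_eq_intros\<close>)+
  have int: "set_integrable lborel (einterval 0 \<infinity>) ?f"
    unfolding set_integrable_def
    by (rule Bochner_Integration.integrable_bound[OF real(1)[unfolded set_integrable_def]])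
       (auto simp: n[simplified] intro!: borel_measurable_scaleR borel_measurable_continuous_onI continuous_intros)
  have A': "(((\<lambda>y. - (?f y / z)) \<circ> real_of_ereal) \<longlongrightarrow> - (1 / z)) (at_right 0)"
    unfolding zero_ereal_def ereal_tendsto_simps
    by (rule tendsto_eq_intros refl)+ (use assms in auto)
  have "((\<lambda>y. ?f y) \<longlongrightarrow> 0) at_top"
    by (rule Lim_null_comparison[OF _ lim]) (simp add: n[simplified])
  then have B': "(((\<lambda>y. - (?f y / z)) \<circ> real_of_ereal) \<longlongrightarrow> 0) (at_left \<infinity>)"
    unfolding ereal_tendsto_simps
    using tendsto_minus[OF tendsto_divide[OF _ tendsto_const[of z]], of ?f 0 at_top] z0 by simp
  have cplx: "(LBINT y=0..\<infinity>. ?f y) = 0 - (- (1 / z))"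
  proof (rule interval_integral_FTC_integrable[OF _ _ _ int A' B'])
    fix x :: real
    have "((\<lambda>w. - (exp (- z * w) / z)) has_field_derivative ?f x) (at (of_real x))"
      using assms by (auto intro!: derivative_eq_intros)
    from has_vector_derivative_real_field[OF this]
    show "((\<lambda>y. - (?f y / z)) has_vector_derivative ?f x) (at x)" by simp
    show "isCont ?f x" by (intro continuous_intros)
  qed auto
  show "integrable lborel (\<lambda>y. indicat_real {0<..} y *\<^sub>R ?f y)"
    using int by (simp add: set_integrable_def zero_ereal_def)
  show "(\<integral>y. indicat_real {0<..} y *\<^sub>R ?f y \<partial>lborel) = 1 / z"
    using cplx by (simp add: interval_lebesgue_integral_def set_lebesgue_integral_def zero_ereal_def)
  show "(\<integral>y. norm (indicat_real {0<..} y *\<^sub>R ?f y) \<partial>lborel) = 1 / Re z"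
    using real(2) by (simp add: interval_lebesgue_integral_def set_lebesgue_integral_def zero_ereal_def n[simplified])
qed


text \<open>
  Term by term integration of the binomial series of \<open>(1 - exp (- y)) powr (b - 1)\<close>.  It gives at
  once that the Laplace integral converges absolutely for every \<open>s\<close> in the right half plane and
  that it is the partial fraction series.
\<close>
lemma beta_laplace:
  assumes "b > 0" "Re s > 0"
  shows "integrable lborel (\<lambda>y. (indicat_real {0<..} y * (1 - exp (- y)) powr (b - 1)) *\<^sub>R exp (- s * of_real y))"
    and "(\<integral>y. (indicat_real {0<..} y * (1 - exp (- y)) powr (b - 1)) *\<^sub>R exp (- s * of_real y) \<partial>lborel) = beta_series b s"
proof -
  define f :: "nat \<Rightarrow> real \<Rightarrow> complex"
    where "f k y = of_real (binom_coeff b k) * (indicat_real {0<..} y *\<^sub>R exp (- (s + of_nat k) * of_real y))" for k y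
  have Re: "Re (s + of_nat k) > 0" for k using assms by simp
  have eq: "f k y = of_real (binom_coeff b k * exp (- y) ^ k) * (indicat_real {0<..} y *\<^sub>R exp (- s * of_real y))" for k y
  proof -
    have "exp (- (s + of_nat k) * of_real y) = of_real (exp (- y) ^ k) * exp (- s * of_real y)"
      by (simp add: algebra_simps exp_diff exp_minus power_inverse flip: exp_of_nat_mult exp_of_real)
         (simp add: field_simps)
    then show ?thesis by (simp add: f_def)
  qed
  have sums: "(\<lambda>k. f k y) sums ((indicat_real {0<..} y * (1 - exp (- y)) powr (b - 1)) *\<^sub>R exp (- s * of_real y))" for y
  proof (cases "y > 0")
    case True
    have "(\<lambda>k. binom_coeff b k * exp (- y) ^ k) sums (1 - exp (- y)) powr (b - 1)"
      using True by (intro binom_coeff_sums) simp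
    from sums_mult2[OF sums_of_real[OF this]] show ?thesis
      using True by (simp only: eq) (simp add: scaleR_conv_of_real)
  qed (simp add: eq)
  have 1: "integrable lborel (f k)" for k
    unfolding f_def by (intro integrable_mult_right exp_decay_integral Re)
  have 2: "AE y in lborel. summable (\<lambda>k. norm (f k y))"
  proof (rule AE_I2)
    fix y :: real
    show "summable (\<lambda>k. norm (f k y))"
    proof (cases "y > 0")
      case True
      have "summable (\<lambda>k. norm (binom_coeff b k * exp (- y) ^ k))"
      proof (rule powser_insidea)
        show "summable (\<lambda>k. binom_coeff b k * exp (- y / 2) ^ k)"
          using binom_coeff_sums[of "exp (- y / 2)" b] True by (auto simp: sums_iff)
      qed (use True in auto)
      from summable_mult2[OF this, of "norm (indicat_real {0<..} y *\<^sub>R exp (- s * of_real y))"]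
      show ?thesis unfolding eq norm_mult norm_of_real by (simp add: abs_mult power_abs)
    qed (simp add: eq)
  qed
  have 3: "summable (\<lambda>k. \<integral>y. norm (f k y) \<partial>lborel)"
  proof -
    have "(\<integral>y. norm (f k y) \<partial>lborel) = \<bar>binom_coeff b k\<bar> * (1 / Re (s + of_nat k))" for k
      unfolding f_def norm_mult using exp_decay_integral(3)[OF Re] by simp
    moreover have "summable (\<lambda>k. norm (complex_of_real (binom_coeff b k) / (of_real (Re s) + of_nat k)))"
      using assms by (intro beta_series_summable) (auto simp: of_real_in_nonpos_Ints_iff dest: nonpos_Ints_nonpos)
    moreover have "norm (complex_of_real (binom_coeff b k) / (of_real (Re s) + of_nat k)) = \<bar>binom_coeff b k\<bar> * (1 / Re (s + of_nat k))" for k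
    proof -
      have "complex_of_real (Re s) + of_nat k = of_real (Re s + real k)" by simp
      then have "norm (complex_of_real (Re s) + of_nat k) = Re s + real k"
        using Re[of k] by (simp only: norm_of_real) simp
      then show ?thesis by (simp add: norm_divide)
    qed
    ultimately show ?thesis by simp
  qed
  have lim: "(\<Sum>k. f k y) = (indicat_real {0<..} y * (1 - exp (- y)) powr (b - 1)) *\<^sub>R exp (- s * of_real y)" for y
    using sums by (simp add: sums_iff)
  show "integrable lborel (\<lambda>y. (indicat_real {0<..} y * (1 - exp (- y)) powr (b - 1)) *\<^sub>R exp (- s * of_real y))"
    using integrable_suminf[OF 1 2 3] by (simp add: lim)
  have "integral\<^sup>L lborel (f k) = of_real (binom_coeff b k) / (s + of_nat k)" for k
    unfolding f_def by (simp only: integral_mult_right_zero exp_decay_integral(2)[OF Re]) simp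
  then show "(\<integral>y. (indicat_real {0<..} y * (1 - exp (- y)) powr (b - 1)) *\<^sub>R exp (- s * of_real y) \<partial>lborel) = beta_series b s"
    using integral_suminf[OF 1 2 3] by (simp add: lim beta_series_def)
qed

text \<open>
  For a positive argument the Laplace integral turns into Euler's Beta integral under
  \<open>w = 1 - exp (- y)\<close>.
\<close>
lemma beta_series_real:
  assumes "b > 0" "x > 0"
  shows "beta_series b (of_real x) = of_real (Beta x b)"
proof -
  define f where "f w = w powr (b - 1) * (1 - w) powr (x - 1)" for w :: real
  define h where "h y = exp (- x * y) * (1 - exp (- y)) powr (b - 1)" for y
  have fg: "f (1 - exp (- y)) * exp (- y) = h y" for y
  proof -
    have "exp (- y) powr (x - 1) * exp (- y) = exp (- x * y)"
      by (simp add: powr_def algebra_simps flip: exp_add)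
    then show ?thesis by (simp add: f_def h_def mult_ac)
  qed
  have eq: "indicat_real {0<..} y *\<^sub>R complex_of_real (h y)
      = (indicat_real {0<..} y * (1 - exp (- y)) powr (b - 1)) *\<^sub>R exp (- of_real x * of_real y)" for y
    by (simp add: h_def scaleR_conv_of_real exp_of_real [symmetric] mult_ac)
  have "integrable lborel (\<lambda>y. indicat_real {0<..} y *\<^sub>R complex_of_real (h y))"
    unfolding eq by (rule beta_laplace(1)) (use assms in auto)
  then have "integrable lborel (\<lambda>y. complex_of_real (indicat_real {0<..} y * h y))"
    by (simp only: scaleR_conv_of_real of_real_mult)
  then have int: "set_integrable lborel (einterval 0 \<infinity>) (\<lambda>y. f (1 - exp (- y)) * exp (- y))"
    unfolding fg set_integrable_def by (simp add: zero_ereal_def complex_of_real_integrable_eq del: of_real_mult)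
  have lim0: "((\<lambda>y::real. 1 - exp (- y)) \<longlongrightarrow> 0) (at_right 0)"
    by (rule tendsto_eq_intros refl)+ auto
  have lim1: "((\<lambda>y::real. 1 - exp (- y)) \<longlongrightarrow> 1) at_top"
    by real_asymp
  have sub: "(LBINT w=0..1. f w) = (LBINT y=0..\<infinity>. f (1 - exp (- y)) * exp (- y))"
  proof (rule interval_integral_substitution_nonneg(2)[where g = "\<lambda>y. 1 - exp (- y)" and g' = "\<lambda>y. exp (- y)" and f = f])
    show "DERIV (\<lambda>y. 1 - exp (- y)) y :> exp (- y)" for y :: real
      by (auto intro!: derivative_eq_intros)
    show "isCont f (1 - exp (- y))" if "0 < ereal y" for y
      unfolding f_def using that by (intro continuous_intros) auto
    show "((ereal \<circ> (\<lambda>y. 1 - exp (- y)) \<circ> real_of_ereal) \<longlongrightarrow> 0) (at_right 0)"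
      unfolding zero_ereal_def ereal_tendsto_simps using lim0 by (simp add: o_def)
    show "((ereal \<circ> (\<lambda>y. 1 - exp (- y)) \<circ> real_of_ereal) \<longlongrightarrow> 1) (at_left \<infinity>)"
      unfolding one_ereal_def ereal_tendsto_simps using lim1 by (simp add: o_def)
  qed (use int in \<open>auto simp: f_def\<close>)
  have "(LBINT w=0..1. f w) = Beta b x"
  proof -
    have "set_integrable lborel {0..1} f"
      unfolding f_def by (rule integrable_Beta[OF assms])
    then have "(LBINT w=ereal 0..ereal 1. f w) = integral {0..1} f"
      by (intro interval_integral_eq_integral) auto
    then show ?thesis
      using has_integral_Beta_real[OF assms] by (simp add: f_def[abs_def] integral_unique zero_ereal_def one_ereal_def)
  qed
  then have "(\<integral>y. indicat_real {0<..} y * h y \<partial>lborel) = Beta x b"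
    using sub unfolding fg
    by (simp add: interval_lebesgue_integral_def set_lebesgue_integral_def zero_ereal_def Beta_commute)
  then have "(\<integral>y. indicat_real {0<..} y *\<^sub>R complex_of_real (h y) \<partial>lborel) = of_real (Beta x b)"
    by (simp only: scaleR_conv_of_real of_real_mult[symmetric] integral_complex_of_real)
  then show ?thesis
    using beta_laplace(2)[OF assms(1), of "of_real x"] assms(2) by (simp only: eq) simp
qed

text \<open>
  Both sides are holomorphic off the non-positive integers, a connected set because only countably
  many points are missing from the plane, and they agree on the positive real axis.  This covers
  the complex arguments of the line integral as well as the negative real arguments in the
  hypergeometric form.
\<close>
theorem beta_series_eq_Gamma:
  assumes "b > 0" "s \<notin> \<int>\<^sub>\<le>\<^sub>0"
  shows "beta_series b s = Gamma s * Gamma (of_real b) * rGamma (s + of_real b)"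
proof -
  have "beta_series b s - Gamma s * Gamma (of_real b) * rGamma (s + of_real b) = 0"
  proof (rule analytic_continuation[where w = s and f = "\<lambda>s. beta_series b s - Gamma s * Gamma (of_real b) * rGamma (s + of_real b)"
        and U = "of_real ` {0<..}" and \<xi> = 1 and S = "- \<int>\<^sub>\<le>\<^sub>0"])
    show "(\<lambda>s. beta_series b s - Gamma s * Gamma (of_real b) * rGamma (s + of_real b)) holomorphic_on - \<int>\<^sub>\<le>\<^sub>0"
      by (intro holomorphic_intros beta_series_holomorphic assms) auto
    show "open (- \<int>\<^sub>\<le>\<^sub>0 :: complex set)" by (simp add: open_Compl)
    have "countable (\<int>\<^sub>\<le>\<^sub>0 :: complex set)"
      unfolding nonpos_Ints_def by (auto intro: countable_subset[of _ "range of_int"])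
    then show "connected (- \<int>\<^sub>\<le>\<^sub>0 :: complex set)"
      using connected_open_diff_countable[of "UNIV :: complex set" "\<int>\<^sub>\<le>\<^sub>0"] convex_connected[OF convex_UNIV]
      by (simp add: Compl_eq_Diff_UNIV)
    show "(1 :: complex) islimpt of_real ` {0<..}"
      unfolding islimpt_approachable
    proof (intro allI impI)
      fix e :: real assume "e > 0"
      then show "\<exists>x'\<in>of_real ` {0<..}. x' \<noteq> (1 :: complex) \<and> dist x' 1 < e"
        by (intro bexI[of _ "of_real (1 + e / 2)"]) (auto simp: dist_norm complex_eq_iff)
    qed
    show "complex_of_real ` {0<..} \<subseteq> - \<int>\<^sub>\<le>\<^sub>0"
      by (auto simp: of_real_in_nonpos_Ints_iff) (meson nonpos_Ints_nonpos not_less)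
    fix z :: complex assume "z \<in> of_real ` {0<..}"
    then obtain x where x: "x > 0" "z = of_real x" by auto
    have "Beta x b = Gamma x * Gamma b * rGamma (x + b)"
      by (simp add: Beta_def rGamma_inverse_Gamma field_simps)
    then show "beta_series b z - Gamma z * Gamma (of_real b) * rGamma (z + of_real b) = 0"
      using beta_series_real[OF assms(1) x(1)] x
      by (simp add: Gamma_complex_of_real rGamma_complex_of_real flip: of_real_add)
  qed (use assms in auto)
  then show ?thesis by simp
qed

section \<open>The Euler integral as a function of its lower end point\<close>

text \<open>
  What remains of the Euler integral from \<open>u\<close> to 1 after \<open>v = u + (1 - u) * w\<close>, with the factor
  \<open>(1 - u) powr (b\<^sub>1 + b\<^sub>2 - 1)\<close> taken out.  The lower end point \<open>u\<close> now appears only in a factor that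
  is smooth for \<open>u > 0\<close> and monotone in \<open>u\<close>; the singularities at both ends sit in a fixed Beta
  weight.
\<close>
definition euler_kernel :: "real \<Rightarrow> real \<Rightarrow> real \<Rightarrow> real \<Rightarrow> real" where
  "euler_kernel c b\<^sub>1 b\<^sub>2 u =
     (\<integral>w. indicat_real {0..1} w * ((u + (1 - u) * w) powr c * (w powr (b\<^sub>1 - 1) * (1 - w) powr (b\<^sub>2 - 1))) \<partial>lborel)"

lemma beta_integral:
  assumes "b\<^sub>1 > 0" "b\<^sub>2 > (0::real)"
  shows "integrable lborel (\<lambda>w. indicat_real {0..1} w * (w powr (b\<^sub>1 - 1) * (1 - w) powr (b\<^sub>2 - 1)))"
    and "(\<integral>w. indicat_real {0..1} w * (w powr (b\<^sub>1 - 1) * (1 - w) powr (b\<^sub>2 - 1)) \<partial>lborel) = Beta b\<^sub>1 b\<^sub>2"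
proof -
  have 1: "set_integrable lborel {0..1} (\<lambda>w. w powr (b\<^sub>1 - 1) * (1 - w) powr (b\<^sub>2 - 1))"
    by (rule integrable_Beta[OF assms])
  then show "integrable lborel (\<lambda>w. indicat_real {0..1} w * (w powr (b\<^sub>1 - 1) * (1 - w) powr (b\<^sub>2 - 1)))"
    by (simp add: set_integrable_def)
  show "(\<integral>w. indicat_real {0..1} w * (w powr (b\<^sub>1 - 1) * (1 - w) powr (b\<^sub>2 - 1)) \<partial>lborel) = Beta b\<^sub>1 b\<^sub>2"
    using set_borel_integral_eq_integral(2)[OF 1] integral_unique[OF has_integral_Beta_real[OF assms]]
    by (simp add: set_lebesgue_integral_def)
qed

lemma Beta_pos: "a > 0 \<Longrightarrow> b > 0 \<Longrightarrow> Beta a b > (0::real)"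
  by (simp add: Beta_def Gamma_real_pos)

text \<open>
  The base is a convex combination of 1 with either of \<open>u\<close> and \<open>w\<close>.
\<close>
lemma kernel_base_bounds:
  assumes "0 < u" "u \<le> (1::real)" "0 \<le> w" "w \<le> 1"
  shows "u \<le> u + (1 - u) * w" "w \<le> u + (1 - u) * w" "u + (1 - u) * w \<le> 1"
proof -
  show "u \<le> u + (1 - u) * w" using assms by simp
  have "0 \<le> u * (1 - w)" using assms by simp
  then show "w \<le> u + (1 - u) * w" by (simp add: algebra_simps)
  have "0 \<le> (1 - u) * (1 - w)" using assms by simp
  then show "u + (1 - u) * w \<le> 1" by (simp add: algebra_simps)
qed

lemma abs_le_abs_of_nonneg: "a \<le> b \<Longrightarrow> 0 \<le> a \<Longrightarrow> \<bar>a\<bar> \<le> \<bar>b :: real\<bar>"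
  by simp

lemma euler_kernel_integrable:
  assumes "b\<^sub>1 > 0" "b\<^sub>2 > 0" "0 < u" "u \<le> 1"
  shows "integrable lborel (\<lambda>w. indicat_real {0..1} w * ((u + (1 - u) * w) powr c * (w powr (b\<^sub>1 - 1) * (1 - w) powr (b\<^sub>2 - 1))))"
proof -
  have "(u + (1 - u) * w) powr c \<le> 1 + u powr c" if "w \<in> {0..1}" for w
  proof (cases "c \<ge> 0")
    case True
    have "(u + (1 - u) * w) powr c \<le> 1 powr c"
      using True kernel_base_bounds[of u w] assms that by (intro powr_mono2) auto
    moreover have "0 \<le> u powr c" by simp
    ultimately show ?thesis unfolding powr_one_eq_one by linarith
  next
    case False
    then have "(u + (1 - u) * w) powr c \<le> u powr c"
      using kernel_base_bounds[of u w] assms that by (intro powr_mono2') auto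
    then show ?thesis by simp
  qed
  then have "indicat_real {0..1} w * ((u + (1 - u) * w) powr c * (w powr (b\<^sub>1 - 1) * (1 - w) powr (b\<^sub>2 - 1)))
      \<le> (1 + u powr c) * (indicat_real {0..1} w * (w powr (b\<^sub>1 - 1) * (1 - w) powr (b\<^sub>2 - 1)))" for w
    by (cases "w \<in> {0..1}") (simp_all add: mult_right_mono)
  moreover have "0 \<le> indicat_real {0..1} w * ((u + (1 - u) * w) powr c * (w powr (b\<^sub>1 - 1) * (1 - w) powr (b\<^sub>2 - 1)))" for w
    by simp
  ultimately have "norm (indicat_real {0..1} w * ((u + (1 - u) * w) powr c * (w powr (b\<^sub>1 - 1) * (1 - w) powr (b\<^sub>2 - 1))))
      \<le> norm ((1 + u powr c) * (indicat_real {0..1} w * (w powr (b\<^sub>1 - 1) * (1 - w) powr (b\<^sub>2 - 1))))" for w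
    unfolding real_norm_def by (rule abs_le_abs_of_nonneg)
  moreover have "(\<lambda>w. indicat_real {0..1} w * ((u + (1 - u) * w) powr c * (w powr (b\<^sub>1 - 1) * (1 - w) powr (b\<^sub>2 - 1)))) \<in> borel_measurable lborel"
    by measurable
  ultimately show ?thesis
    by (intro Bochner_Integration.integrable_bound[OF integrable_mult_right[OF beta_integral(1)[OF assms(1,2)], of "1 + u powr c"]] AE_I2)
qed

text \<open>
  Comparison of the kernel with a Beta integral whose first parameter may differ from \<open>b\<^sub>1\<close>, so that
  part of the singularity at \<open>w = 0\<close> can be traded for a factor depending on \<open>u\<close>.
\<close>
lemma euler_kernel_le_Beta:
  assumes "b\<^sub>1 > 0" "b\<^sub>2 > 0" "0 < u" "u \<le> 1" "b\<^sub>1' > 0"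
    and "\<And>w. 0 < w \<Longrightarrow> w < 1 \<Longrightarrow> (u + (1 - u) * w) powr c * w powr (b\<^sub>1 - 1) \<le> C * w powr (b\<^sub>1' - 1)"
  shows "euler_kernel c b\<^sub>1 b\<^sub>2 u \<le> C * Beta b\<^sub>1' b\<^sub>2"
proof -
  have "euler_kernel c b\<^sub>1 b\<^sub>2 u \<le> (\<integral>w. C * (indicat_real {0..1} w * (w powr (b\<^sub>1' - 1) * (1 - w) powr (b\<^sub>2 - 1))) \<partial>lborel)"
    unfolding euler_kernel_def
  proof (rule integral_mono[OF euler_kernel_integrable integrable_mult_right[OF beta_integral(1)]])
    fix w :: real
    show "indicat_real {0..1} w * ((u + (1 - u) * w) powr c * (w powr (b\<^sub>1 - 1) * (1 - w) powr (b\<^sub>2 - 1)))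
       \<le> C * (indicat_real {0..1} w * (w powr (b\<^sub>1' - 1) * (1 - w) powr (b\<^sub>2 - 1)))"
    proof (cases "0 < w \<and> w < 1")
      case True
      then have "(u + (1 - u) * w) powr c * w powr (b\<^sub>1 - 1) * (1 - w) powr (b\<^sub>2 - 1)
          \<le> C * w powr (b\<^sub>1' - 1) * (1 - w) powr (b\<^sub>2 - 1)"
        by (intro mult_right_mono assms) auto
      then show ?thesis using True by (simp add: indicator_def mult_ac)
    next
      case False
      then have "w \<notin> {0..1} \<or> w = 0 \<or> w = 1" by auto
      then show ?thesis by auto
    qed
  qed (use assms in auto)
  then show ?thesis using beta_integral(2)[of b\<^sub>1' b\<^sub>2] assms by simp
qed

lemma Beta_le_euler_kernel:
  assumes "b\<^sub>1 > 0" "b\<^sub>2 > 0" "0 < u" "u \<le> 1" "b\<^sub>1' > 0"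
    and "\<And>w. 0 < w \<Longrightarrow> w < 1 \<Longrightarrow> C * w powr (b\<^sub>1' - 1) \<le> (u + (1 - u) * w) powr c * w powr (b\<^sub>1 - 1)"
  shows "C * Beta b\<^sub>1' b\<^sub>2 \<le> euler_kernel c b\<^sub>1 b\<^sub>2 u"
proof -
  have "(\<integral>w. C * (indicat_real {0..1} w * (w powr (b\<^sub>1' - 1) * (1 - w) powr (b\<^sub>2 - 1))) \<partial>lborel) \<le> euler_kernel c b\<^sub>1 b\<^sub>2 u"
    unfolding euler_kernel_def
  proof (rule integral_mono[OF integrable_mult_right[OF beta_integral(1)] euler_kernel_integrable])
    fix w :: real
    show "C * (indicat_real {0..1} w * (w powr (b\<^sub>1' - 1) * (1 - w) powr (b\<^sub>2 - 1)))
       \<le> indicat_real {0..1} w * ((u + (1 - u) * w) powr c * (w powr (b\<^sub>1 - 1) * (1 - w) powr (b\<^sub>2 - 1)))"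
    proof (cases "0 < w \<and> w < 1")
      case True
      then have "C * w powr (b\<^sub>1' - 1) * (1 - w) powr (b\<^sub>2 - 1)
         \<le> (u + (1 - u) * w) powr c * w powr (b\<^sub>1 - 1) * (1 - w) powr (b\<^sub>2 - 1)"
        by (intro mult_right_mono assms) auto
      then show ?thesis using True by (simp add: indicator_def mult_ac)
    next
      case False
      then have "w \<notin> {0..1} \<or> w = 0 \<or> w = 1" by auto
      then show ?thesis by auto
    qed
  qed (use assms in auto)
  then show ?thesis using beta_integral(2)[of b\<^sub>1' b\<^sub>2] assms by simp
qed

text \<open>
  The integrand depends on \<open>u\<close> through \<open>x powr c\<close>, which is Lipschitz on \<open>{u\<^sub>0..1}\<close>, and the
  bases for two values of \<open>u\<close> differ by at most the distance of these values.
\<close>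
lemma euler_kernel_Lipschitz:
  assumes "b\<^sub>1 > 0" "b\<^sub>2 > 0" "0 < u\<^sub>0"
  obtains L where "\<And>u u'. u \<in> {u\<^sub>0..1} \<Longrightarrow> u' \<in> {u\<^sub>0..1} \<Longrightarrow>
     \<bar>euler_kernel c b\<^sub>1 b\<^sub>2 u - euler_kernel c b\<^sub>1 b\<^sub>2 u'\<bar> \<le> L * \<bar>u - u'\<bar>"
proof -
  define M where "M = \<bar>c\<bar> * (1 + u\<^sub>0 powr (c - 1))"
  have M: "M \<ge> 0" by (simp add: M_def)
  have powr_lip: "\<bar>x powr c - y powr c\<bar> \<le> M * \<bar>x - y\<bar>" if "x \<in> {u\<^sub>0..1}" "y \<in> {u\<^sub>0..1}" for x y
  proof (rule field_differentiable_bound[of "{u\<^sub>0..1}" "\<lambda>x. x powr c" "\<lambda>x. c * x powr (c - 1)" M x y, unfolded real_norm_def])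
    fix z assume z: "z \<in> {u\<^sub>0..1}"
    then show "((\<lambda>x. x powr c) has_field_derivative c * z powr (c - 1)) (at z within {u\<^sub>0..1})"
      using assms by (auto intro!: derivative_eq_intros)
    have "z powr (c - 1) \<le> 1 + u\<^sub>0 powr (c - 1)"
    proof (cases "c \<ge> 1")
      case True
      have "z powr (c - 1) \<le> 1 powr (c - 1)"
        using True z assms by (intro powr_mono2) auto
      moreover have "0 \<le> u\<^sub>0 powr (c - 1)" by simp
      ultimately show ?thesis unfolding powr_one_eq_one by linarith
    next
      case False
      then have "z powr (c - 1) \<le> u\<^sub>0 powr (c - 1)"
        using z assms by (intro powr_mono2') auto
      then show ?thesis by simp
    qed
    then show "\<bar>c * z powr (c - 1)\<bar> \<le> M"
      by (simp add: M_def abs_mult mult_left_mono)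
  qed (use that in auto)
  have "\<bar>euler_kernel c b\<^sub>1 b\<^sub>2 u - euler_kernel c b\<^sub>1 b\<^sub>2 u'\<bar> \<le> (M * Beta b\<^sub>1 b\<^sub>2) * \<bar>u - u'\<bar>"
    if u: "u \<in> {u\<^sub>0..1}" "u' \<in> {u\<^sub>0..1}" for u u'
  proof -
    let ?W = "\<lambda>w. w powr (b\<^sub>1 - 1) * (1 - w) powr (b\<^sub>2 - 1)"
    let ?f = "\<lambda>u w. indicat_real {0..1} w * ((u + (1 - u) * w) powr c * ?W w)"
    have int: "integrable lborel (?f u)" "integrable lborel (?f u')"
      using u assms by (auto intro!: euler_kernel_integrable)
    have "\<bar>euler_kernel c b\<^sub>1 b\<^sub>2 u - euler_kernel c b\<^sub>1 b\<^sub>2 u'\<bar> = \<bar>\<integral>w. ?f u w - ?f u' w \<partial>lborel\<bar>"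
      using int by (simp add: euler_kernel_def)
    also have "\<dots> \<le> (\<integral>w. (M * \<bar>u - u'\<bar>) * (indicat_real {0..1} w * ?W w) \<partial>lborel)"
    proof (rule order_trans[OF integral_abs_bound integral_mono])
      show "integrable lborel (\<lambda>w. \<bar>?f u w - ?f u' w\<bar>)" using int by auto
      show "integrable lborel (\<lambda>w. (M * \<bar>u - u'\<bar>) * (indicat_real {0..1} w * ?W w))"
        using beta_integral(1) assms by auto
      fix w :: real
      show "\<bar>?f u w - ?f u' w\<bar> \<le> (M * \<bar>u - u'\<bar>) * (indicat_real {0..1} w * ?W w)"
      proof (cases "w \<in> {0..1}")
        case True
        let ?x = "u + (1 - u) * w" and ?y = "u' + (1 - u') * w"
        have "?x \<in> {u\<^sub>0..1}" "?y \<in> {u\<^sub>0..1}"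
          using order_trans[OF _ kernel_base_bounds(1)[of u w], of u\<^sub>0] kernel_base_bounds(3)[of u w]
            order_trans[OF _ kernel_base_bounds(1)[of u' w], of u\<^sub>0] kernel_base_bounds(3)[of u' w] True u assms
          by (simp_all del: le_add_same_cancel1)
        then have "\<bar>?x powr c - ?y powr c\<bar> \<le> M * \<bar>?x - ?y\<bar>" by (rule powr_lip)
        also have "?x - ?y = (u - u') * (1 - w)" by (simp add: algebra_simps)
        also have "M * \<bar>(u - u') * (1 - w)\<bar> \<le> M * \<bar>u - u'\<bar>"
          using True M by (auto simp: abs_mult intro!: mult_left_mono mult_left_le)
        finally have "\<bar>?x powr c - ?y powr c\<bar> * ?W w \<le> M * \<bar>u - u'\<bar> * ?W w"
          by (intro mult_right_mono) auto
        moreover have "?f u w - ?f u' w = (?x powr c - ?y powr c) * ?W w"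
          using True by (simp add: algebra_simps)
        ultimately show ?thesis using True by (simp add: abs_mult)
      qed simp
    qed
    also have "\<dots> = (M * Beta b\<^sub>1 b\<^sub>2) * \<bar>u - u'\<bar>"
      using beta_integral(2) assms by (simp add: mult_ac)
    finally show ?thesis .
  qed
  then show ?thesis using that by blast
qed

lemma euler_integral_eq_kernel:
  assumes "\<beta>\<^sub>1 > 0" "\<beta>\<^sub>2 > 0" "0 < u" "u < 1"
  shows "set_integrable lborel {u..1} (euler_integrand \<alpha>\<^sub>1 \<beta>\<^sub>1 \<alpha>\<^sub>2 \<beta>\<^sub>2 u)"
    and "(\<integral>v. indicat_real {u..1} v * euler_integrand \<alpha>\<^sub>1 \<beta>\<^sub>1 \<alpha>\<^sub>2 \<beta>\<^sub>2 u v \<partial>lborel)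
       = (1 - u) powr (\<beta>\<^sub>1 + \<beta>\<^sub>2 - 1) * euler_kernel (\<alpha>\<^sub>2 - \<alpha>\<^sub>1 - \<beta>\<^sub>1) \<beta>\<^sub>1 \<beta>\<^sub>2 u"
proof -
  let ?g = "\<lambda>v. indicat_real {u..1} v * euler_integrand \<alpha>\<^sub>1 \<beta>\<^sub>1 \<alpha>\<^sub>2 \<beta>\<^sub>2 u v"
  let ?k = "\<lambda>w. indicat_real {0..1} w * ((u + (1 - u) * w) powr (\<alpha>\<^sub>2 - \<alpha>\<^sub>1 - \<beta>\<^sub>1) * (w powr (\<beta>\<^sub>1 - 1) * (1 - w) powr (\<beta>\<^sub>2 - 1)))"
  have eq: "?g (u + (1 - u) * w) = (1 - u) powr (\<beta>\<^sub>1 + \<beta>\<^sub>2 - 2) * ?k w" for w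
  proof (cases "w \<in> {0..1}")
    case True
    have "u + (1 - u) * w \<in> {u..1}" using kernel_base_bounds[of u w] True assms by auto
    moreover have "u + (1 - u) * w - u = (1 - u) * w" "1 - (u + (1 - u) * w) = (1 - u) * (1 - w)"
      by (auto simp: algebra_simps)
    moreover have "(1 - u) powr (\<beta>\<^sub>1 + \<beta>\<^sub>2 - 2) = (1 - u) powr (\<beta>\<^sub>1 - 1) * (1 - u) powr (\<beta>\<^sub>2 - 1)"
      by (simp add: algebra_simps flip: powr_add)
    ultimately show ?thesis
      using True assms by (simp add: euler_integrand_def powr_mult)
  next
    case False
    have "u + (1 - u) * w \<notin> {u..1}"
    proof
      assume *: "u + (1 - u) * w \<in> {u..1}"
      then have "0 \<le> (1 - u) * w" "0 \<le> (1 - u) * (1 - w)" by (auto simp: algebra_simps)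
      then show False using False assms by (auto simp: zero_le_mult_iff)
    qed
    then show ?thesis using False by simp
  qed
  have k: "integrable lborel ?k" using assms by (intro euler_kernel_integrable) auto
  have "integrable lborel (\<lambda>w. ?g (u + (1 - u) * w))"
    unfolding eq using k by (rule integrable_mult_right)
  then have g: "integrable lborel ?g"
    using lborel_integrable_real_affine_iff[of "1 - u" ?g u] assms by simp
  then show "set_integrable lborel {u..1} (euler_integrand \<alpha>\<^sub>1 \<beta>\<^sub>1 \<alpha>\<^sub>2 \<beta>\<^sub>2 u)"
    by (simp add: set_integrable_def)
  have "(\<integral>v. ?g v \<partial>lborel) = \<bar>1 - u\<bar> *\<^sub>R (\<integral>w. ?g (u + (1 - u) * w) \<partial>lborel)"
    using assms by (intro lborel_integral_real_affine) auto
  also have "\<dots> = (1 - u) powr (\<beta>\<^sub>1 + \<beta>\<^sub>2 - 1) * euler_kernel (\<alpha>\<^sub>2 - \<alpha>\<^sub>1 - \<beta>\<^sub>1) \<beta>\<^sub>1 \<beta>\<^sub>2 u"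
  proof -
    have "(1 - u) powr (\<beta>\<^sub>1 + \<beta>\<^sub>2 - 1) = (1 - u) powr (1 + (\<beta>\<^sub>1 + \<beta>\<^sub>2 - 2))" by simp
    also have "\<dots> = (1 - u) * (1 - u) powr (\<beta>\<^sub>1 + \<beta>\<^sub>2 - 2)"
      using assms by (subst powr_add) simp
    finally show ?thesis using assms unfolding eq euler_kernel_def by simp
  qed
  finally show "(\<integral>v. ?g v \<partial>lborel) = (1 - u) powr (\<beta>\<^sub>1 + \<beta>\<^sub>2 - 1) * euler_kernel (\<alpha>\<^sub>2 - \<alpha>\<^sub>1 - \<beta>\<^sub>1) \<beta>\<^sub>1 \<beta>\<^sub>2 u" .
qed

lemma euler_form_eq_kernel:
  assumes "\<beta>\<^sub>1 > 0" "\<beta>\<^sub>2 > 0" "0 < u" "u < 1"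
  shows "euler_integrand \<alpha>\<^sub>1 \<beta>\<^sub>1 \<alpha>\<^sub>2 \<beta>\<^sub>2 u integrable_on {u..1}"
    and "euler_form \<alpha>\<^sub>1 \<beta>\<^sub>1 \<alpha>\<^sub>2 \<beta>\<^sub>2 u = 1 / (Gamma \<beta>\<^sub>1 * Gamma \<beta>\<^sub>2) * u powr \<alpha>\<^sub>1 *
      ((1 - u) powr (\<beta>\<^sub>1 + \<beta>\<^sub>2 - 1) * euler_kernel (\<alpha>\<^sub>2 - \<alpha>\<^sub>1 - \<beta>\<^sub>1) \<beta>\<^sub>1 \<beta>\<^sub>2 u)"
  using set_borel_integral_eq_integral[OF euler_integral_eq_kernel(1)[OF assms, of \<alpha>\<^sub>1 \<alpha>\<^sub>2]]
    euler_integral_eq_kernel(2)[OF assms, of \<alpha>\<^sub>1 \<alpha>\<^sub>2]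
  by (auto simp: euler_form_def set_lebesgue_integral_def)

section \<open>The line integral as Fourier inversion\<close>

text \<open>
  The integrand of the Beta integral in the logarithmic variable \<open>y = - ln w\<close>.
\<close>
definition log_beta :: "real \<Rightarrow> real \<Rightarrow> real \<Rightarrow> real" where
  "log_beta a b y = indicat_real {0<..} y * exp (- a * y) * (1 - exp (- y)) powr (b - 1)"

lemma log_beta_fourier:
  assumes "a > 0" "b > 0"
  shows "integrable lborel (log_beta a b)"
    and "fourier (log_beta a b) t = Gamma (Complex a t) * Gamma (of_real b) * rGamma (Complex a t + of_real b)"
proof -
  have eq: "(indicat_real {0<..} y * (1 - exp (- y)) powr (b - 1)) *\<^sub>R exp (- Complex a t * of_real y)
      = log_beta a b y *\<^sub>R cis (- t * y)" for y t
  proof -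
    have "- Complex a t * of_real y = of_real (- a * y) + \<i> * of_real (- t * y)"
      by (simp add: complex_eq_iff)
    then have "exp (- Complex a t * of_real y) = of_real (exp (- a * y)) * cis (- t * y)"
      by (simp only: exp_add cis_conv_exp exp_of_real)
    then show ?thesis by (simp add: log_beta_def scaleR_conv_of_real)
  qed
  have 1: "Re (Complex a t) > 0" for t using assms by simp
  have 2: "Complex a t \<notin> \<int>\<^sub>\<le>\<^sub>0" for t
    using assms by (auto elim!: nonpos_Ints_cases simp: complex_eq_iff)
  have "integrable lborel (\<lambda>y. log_beta a b y *\<^sub>R cis (- 0 * y))"
    using beta_laplace(1)[OF assms(2) 1[of 0]] unfolding eq .
  then show "integrable lborel (log_beta a b)"
    by (simp add: scaleR_conv_of_real complex_of_real_integrable_eq)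
  show "fourier (log_beta a b) t = Gamma (Complex a t) * Gamma (of_real b) * rGamma (Complex a t + of_real b)"
    using beta_laplace(2)[OF assms(2) 1[of t]] beta_series_eq_Gamma[OF assms(2) 2[of t]]
    unfolding eq by (simp add: fourier_def)
qed

text \<open>
  At \<open>y\<close> the convolution is an integral over \<open>0 < p < y\<close>; the substitution \<open>v = exp (p - y)\<close> maps it
  increasingly to the range from \<open>u = exp (- y)\<close> to 1 and gives the Euler integrand.
\<close>
lemma log_beta_convolution:
  fixes \<alpha>\<^sub>1 \<alpha>\<^sub>2 \<kappa> y :: real
  assumes "\<beta>\<^sub>1 > 0" "\<beta>\<^sub>2 > 0"
  defines "g \<equiv> \<lambda>y. \<integral>p. log_beta (\<alpha>\<^sub>1 + \<kappa>) \<beta>\<^sub>1 p * log_beta (\<alpha>\<^sub>2 + \<kappa>) \<beta>\<^sub>2 (y - p) \<partial>lborel"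
  shows "y \<le> 0 \<Longrightarrow> g y = 0"
    and "y > 0 \<Longrightarrow> g y = exp (- (\<alpha>\<^sub>1 + \<kappa>) * y) *
          (\<integral>v. indicat_real {exp (- y)..1} v * euler_integrand \<alpha>\<^sub>1 \<beta>\<^sub>1 \<alpha>\<^sub>2 \<beta>\<^sub>2 (exp (- y)) v \<partial>lborel)"
proof -
  assume "y \<le> 0"
  then have "log_beta (\<alpha>\<^sub>1 + \<kappa>) \<beta>\<^sub>1 p * log_beta (\<alpha>\<^sub>2 + \<kappa>) \<beta>\<^sub>2 (y - p) = 0" for p
    by (auto simp: log_beta_def indicator_def)
  then show "g y = 0" unfolding g_def by (simp only: Bochner_Integration.integral_zero)
next
  assume y: "y > 0"
  define f where "f = euler_integrand \<alpha>\<^sub>1 \<beta>\<^sub>1 \<alpha>\<^sub>2 \<beta>\<^sub>2 (exp (- y))"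
  \<comment> \<open>The two sides also agree for \<open>p = 0\<close> and \<open>p = y\<close>, since \<open>0 powr a = 0\<close>.\<close>
  have eq: "log_beta (\<alpha>\<^sub>1 + \<kappa>) \<beta>\<^sub>1 p * log_beta (\<alpha>\<^sub>2 + \<kappa>) \<beta>\<^sub>2 (y - p)
      = exp (- (\<alpha>\<^sub>1 + \<kappa>) * y) * (f (exp (p - y)) * exp (p - y) * indicat_real {0..y} p)" for p
  proof (cases "0 < p \<and> p < y")
    case True
    have "exp (p - y) - exp (- y) = exp (p - y) * (1 - exp (- p))"
      by (simp add: algebra_simps flip: exp_add)
    then have "(exp (p - y) - exp (- y)) powr (\<beta>\<^sub>1 - 1) = exp ((\<beta>\<^sub>1 - 1) * (p - y)) * (1 - exp (- p)) powr (\<beta>\<^sub>1 - 1)"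
      using True by (simp add: powr_mult exp_powr_real mult.commute)
    then have f: "f (exp (p - y)) = (exp ((\<alpha>\<^sub>2 - \<alpha>\<^sub>1 - \<beta>\<^sub>1) * (p - y)) * exp ((\<beta>\<^sub>1 - 1) * (p - y)))
        * (1 - exp (- p)) powr (\<beta>\<^sub>1 - 1) * (1 - exp (p - y)) powr (\<beta>\<^sub>2 - 1)"
      by (simp add: f_def euler_integrand_def exp_powr_real mult_ac)
    have "exp (- (\<alpha>\<^sub>1 + \<kappa>) * y) * (exp ((\<alpha>\<^sub>2 - \<alpha>\<^sub>1 - \<beta>\<^sub>1) * (p - y)) * exp ((\<beta>\<^sub>1 - 1) * (p - y))) * exp (p - y)
        = exp (- (\<alpha>\<^sub>1 + \<kappa>) * p) * exp (- (\<alpha>\<^sub>2 + \<kappa>) * (y - p))"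
      unfolding exp_add[symmetric] by (rule arg_cong[where f = exp]) (simp add: algebra_simps)
    then show ?thesis using True unfolding f by (simp add: log_beta_def mult_ac)
  next
    case False
    then have "p \<notin> {0..y} \<or> p = 0 \<or> p = y" using y by auto
    then show ?thesis by (auto simp: log_beta_def f_def euler_integrand_def indicator_def)
  qed
  have int: "set_integrable lborel {exp (0 - y)..exp (y - y)} f"
    unfolding f_def using euler_integral_eq_kernel(1)[of \<beta>\<^sub>1 \<beta>\<^sub>2 "exp (- y)"] assms y by simp
  have "(\<integral>v. f v * indicat_real {exp (0 - y)..exp (y - y)} v \<partial>lborel) =
      (\<integral>p. f (exp (p - y)) * exp (p - y) * indicat_real {0..y} p \<partial>lborel)"
    by (rule integral_substitution(2)[where g = "\<lambda>p. exp (p - y)" and g' = "\<lambda>p. exp (p - y)" and a = 0 and b = y])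
       (use y int in \<open>auto intro!: derivative_eq_intros continuous_intros\<close>)
  then show "g y = exp (- (\<alpha>\<^sub>1 + \<kappa>) * y) * (\<integral>v. indicat_real {exp (- y)..1} v * euler_integrand \<alpha>\<^sub>1 \<beta>\<^sub>1 \<alpha>\<^sub>2 \<beta>\<^sub>2 (exp (- y)) v \<partial>lborel)"
    unfolding g_def eq by (simp add: f_def mult.commute)
qed

lemma has_real_derivative_bigo:
  assumes "(f has_real_derivative D) (at x)"
  shows "(\<lambda>y. f y - f x) \<in> O[at x](\<lambda>y. \<bar>y - x\<bar> powr 1)"
proof -
  have "((\<lambda>y. (f y - f x) / (y - x)) \<longlongrightarrow> D) (at x)"
    using assms by (simp add: has_field_derivative_iff)
  then have "(\<lambda>y. f y - f x) \<in> O[at x](\<lambda>y. y - x)"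
    by (rule bigoI_tendsto) (auto simp: eventually_at_filter)
  then show ?thesis by (simp add: landau_o.big.abs)
qed

text \<open>
  For \<open>x > 0\<close> the function is a differentiable factor times a Lipschitz one, and \<open>\<delta> = 1\<close> will do.
  At \<open>x = 0\<close> the kernel stays bounded and \<open>1 - exp (- y) \<le> y\<close> leaves \<open>\<delta> = \<beta>\<^sub>1 + \<beta>\<^sub>2 - 1\<close>.
\<close>
lemma kernel_profile_Hoelder:
  assumes "\<beta>\<^sub>1 > 0" "\<beta>\<^sub>2 > 0" "x > 0 \<or> x = 0 \<and> \<beta>\<^sub>1 + \<beta>\<^sub>2 > 1"
    and g0: "\<And>y. y \<le> 0 \<Longrightarrow> g y = 0"
    and g1: "\<And>y. y > 0 \<Longrightarrow> g y = exp (- a * y) * ((1 - exp (- y)) powr (\<beta>\<^sub>1 + \<beta>\<^sub>2 - 1) * euler_kernel c \<beta>\<^sub>1 \<beta>\<^sub>2 (exp (- y)))"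
  obtains \<delta> where "\<delta> > 0" "(\<lambda>y. g y - g x) \<in> O[at x](\<lambda>y. \<bar>y - x\<bar> powr \<delta>)"
proof (cases "x > 0")
  case True
  define A where "A y = exp (- a * y) * (1 - exp (- y)) powr (\<beta>\<^sub>1 + \<beta>\<^sub>2 - 1)" for y
  define K where "K y = euler_kernel c \<beta>\<^sub>1 \<beta>\<^sub>2 (exp (- y))" for y
  obtain D where D: "(A has_real_derivative D) (at x)"
  proof -
    let ?e = "\<beta>\<^sub>1 + \<beta>\<^sub>2 - 1"
    have "((\<lambda>y. exp (- a * y)) has_real_derivative - a * exp (- a * x)) (at x)"
      by (auto intro!: derivative_eq_intros)
    moreover have "((\<lambda>y. (1 - exp (- y)) powr ?e) has_real_derivative
        ?e * (1 - exp (- x)) powr (?e - of_nat 1) * exp (- x)) (at x)"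
      by (rule DERIV_fun_powr) (use True in \<open>auto intro!: derivative_eq_intros\<close>)
    ultimately show ?thesis unfolding A_def by (rule that[unfolded A_def, OF DERIV_mult])
  qed
  \<comment> \<open>For \<open>y\<close> between 0 and \<open>2 * x\<close> the end point \<open>exp (- y)\<close> stays away from 0.\<close>
  have "exp (- (2 * x)) > 0" by simp
  from euler_kernel_Lipschitz[OF assms(1,2) this, of c] obtain L where
    L: "\<And>u u'. u \<in> {exp (- (2 * x))..1} \<Longrightarrow> u' \<in> {exp (- (2 * x))..1} \<Longrightarrow>
      \<bar>euler_kernel c \<beta>\<^sub>1 \<beta>\<^sub>2 u - euler_kernel c \<beta>\<^sub>1 \<beta>\<^sub>2 u'\<bar> \<le> L * \<bar>u - u'\<bar>" by blast
  have near: "eventually (\<lambda>y. 0 < y \<and> y < 2 * x) (at x)"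
    using True by (intro eventually_conj order_tendstoD[OF tendsto_ident_at]) auto
  have "(\<lambda>y. K y - K x) \<in> O[at x](\<lambda>y. exp (- y) - exp (- x))"
  proof (rule bigoI[of _ L])
    show "eventually (\<lambda>y. norm (K y - K x) \<le> L * norm (exp (- y) - exp (- x))) (at x)"
      using near
    proof eventually_elim
      case (elim y)
      then show ?case unfolding K_def real_norm_def using True by (intro L) auto
    qed
  qed
  also have "(\<lambda>y. exp (- y) - exp (- x)) \<in> O[at x](\<lambda>y. \<bar>y - x\<bar> powr 1)"
    by (rule has_real_derivative_bigo[of "\<lambda>y. exp (- y)" "- exp (- x)"])
       (auto intro!: derivative_eq_intros)
  finally have K: "(\<lambda>y. K y - K x) \<in> O[at x](\<lambda>y. \<bar>y - x\<bar> powr 1)" .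
  have "(A \<longlongrightarrow> A x) (at x)" using DERIV_isCont[OF D] by (simp add: isCont_def)
  then have A1: "A \<in> O[at x](\<lambda>_. 1)" by (intro bigoI_tendsto[of _ _ "A x"]) auto
  have "(\<lambda>y. A y * (K y - K x)) \<in> O[at x](\<lambda>y. 1 * \<bar>y - x\<bar> powr 1)"
    by (rule landau_o.big.mult[OF A1 K])
  moreover have "(\<lambda>y. K x * (A y - A x)) \<in> O[at x](\<lambda>y. \<bar>y - x\<bar> powr 1)"
    using has_real_derivative_bigo[OF D] by simp
  ultimately have "(\<lambda>y. A y * (K y - K x) + K x * (A y - A x)) \<in> O[at x](\<lambda>y. \<bar>y - x\<bar> powr 1)"
    by (intro sum_in_bigo) auto
  moreover have "eventually (\<lambda>y. g y - g x = A y * (K y - K x) + K x * (A y - A x)) (at x)"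
    using near
  proof eventually_elim
    case (elim y)
    then show ?case using True g1[of y] g1[of x] by (simp add: A_def K_def algebra_simps)
  qed
  ultimately have "(\<lambda>y. g y - g x) \<in> O[at x](\<lambda>y. \<bar>y - x\<bar> powr 1)"
    by (subst landau_o.big.in_cong) 
  then show ?thesis using that[of 1] by simp
next
  case False
  then have x: "x = 0" "\<beta>\<^sub>1 + \<beta>\<^sub>2 > 1" using assms(3) by auto
  let ?\<delta> = "\<beta>\<^sub>1 + \<beta>\<^sub>2 - 1"
  have "exp (- 1 :: real) > 0" by simp
  from euler_kernel_Lipschitz[OF assms(1,2) this, of c] obtain L where
    L: "\<And>u u'. u \<in> {exp (- 1)..1} \<Longrightarrow> u' \<in> {exp (- 1)..1} \<Longrightarrow>
      \<bar>euler_kernel c \<beta>\<^sub>1 \<beta>\<^sub>2 u - euler_kernel c \<beta>\<^sub>1 \<beta>\<^sub>2 u'\<bar> \<le> L * \<bar>u - u'\<bar>" by blast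
  define M where "M = \<bar>euler_kernel c \<beta>\<^sub>1 \<beta>\<^sub>2 1\<bar> + \<bar>L\<bar>"
  have "(\<lambda>y. g y - g x) \<in> O[at x](\<lambda>y. \<bar>y - x\<bar> powr ?\<delta>)"
  proof (rule bigoI[of _ "exp \<bar>a\<bar> * M"])
    have "eventually (\<lambda>y::real. \<bar>y\<bar> < 1) (at 0)"
      unfolding eventually_at by (intro exI[of _ 1]) (auto simp: dist_real_def)
    then show "eventually (\<lambda>y. norm (g y - g x) \<le> exp \<bar>a\<bar> * M * norm (\<bar>y - x\<bar> powr ?\<delta>)) (at x)"
      unfolding x(1)
    proof eventually_elim
      case (elim y)
      show ?case
      proof (cases "y > 0")
        case True
        have "- a * y \<le> \<bar>a\<bar>" using True elim
          by (smt (verit) mult_left_le mult_minus_left mult_nonneg_nonneg)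
        then have 1: "exp (- a * y) \<le> exp \<bar>a\<bar>" by simp
        have "1 - exp (- y) \<le> y" using exp_ge_add_one_self[of "- y"] by simp
        then have 2: "(1 - exp (- y)) powr ?\<delta> \<le> y powr ?\<delta>"
          using x True by (intro powr_mono2) auto
        have "\<bar>euler_kernel c \<beta>\<^sub>1 \<beta>\<^sub>2 (exp (- y)) - euler_kernel c \<beta>\<^sub>1 \<beta>\<^sub>2 1\<bar> \<le> L * \<bar>exp (- y) - 1\<bar>"
          using True elim by (intro L) auto
        also have "\<dots> \<le> \<bar>L\<bar> * 1"
          using True by (intro mult_mono) auto
        finally have 3: "\<bar>euler_kernel c \<beta>\<^sub>1 \<beta>\<^sub>2 (exp (- y))\<bar> \<le> M" by (simp add: M_def)
        have "norm (g y - g 0) = exp (- a * y) * ((1 - exp (- y)) powr ?\<delta> * \<bar>euler_kernel c \<beta>\<^sub>1 \<beta>\<^sub>2 (exp (- y))\<bar>)"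
          using True g0[of 0] g1[of y] by (simp add: abs_mult)
        also have "\<dots> \<le> exp \<bar>a\<bar> * (y powr ?\<delta> * M)"
          by (intro mult_mono 1 2 3) auto
        finally show ?thesis using True by (simp add: mult_ac)
      next
        case False
        then show ?thesis using g0[of y] g0[of 0] by (simp add: M_def)
      qed
    qed
  qed
  then show ?thesis using that[of ?\<delta>] x by simp
qed

text \<open>
  In terms of \<open>x = - ln u\<close> the integrand on the line through \<open>\<kappa>\<close> is the Fourier transform of the
  convolution of two \<open>log_beta\<close> functions, times \<open>cis (t * x)\<close> and a constant.  The inversion
  theorem evaluates the integral on every admissible line.
\<close>
theorem has_meijer_G_euler_form:
  fixes \<alpha>\<^sub>1 \<alpha>\<^sub>2 \<beta>\<^sub>1 \<beta>\<^sub>2 u :: real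
  assumes "\<beta>\<^sub>1 > 0" "\<beta>\<^sub>2 > 0" "0 < u \<and> u < 1 \<or> u = 1 \<and> \<beta>\<^sub>1 + \<beta>\<^sub>2 > 1"
  shows "has_meijer_G 2 0 [of_real (\<alpha>\<^sub>1 + \<beta>\<^sub>1), of_real (\<alpha>\<^sub>2 + \<beta>\<^sub>2)] [of_real \<alpha>\<^sub>1, of_real \<alpha>\<^sub>2]
         (of_real u) (of_real (euler_form \<alpha>\<^sub>1 \<beta>\<^sub>1 \<alpha>\<^sub>2 \<beta>\<^sub>2 u))"
  unfolding has_meijer_G_def meijer_line_2_0
proof (intro conjI allI impI)
  show "\<exists>\<kappa>. \<kappa> > max (- \<alpha>\<^sub>1) (- \<alpha>\<^sub>2)" by (rule gt_ex)
  fix \<kappa> assume \<kappa>: "\<kappa> > max (- \<alpha>\<^sub>1) (- \<alpha>\<^sub>2)"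
  then have a: "\<alpha>\<^sub>1 + \<kappa> > 0" "\<alpha>\<^sub>2 + \<kappa> > 0" by auto
  define x where "x = - ln u"
  have u: "u > 0" "u = exp (- x)" using assms(3) by (auto simp: x_def)
  have x: "x > 0 \<or> x = 0 \<and> \<beta>\<^sub>1 + \<beta>\<^sub>2 > 1" using assms(3) by (auto simp: x_def)
  define g where "g y = (\<integral>p. log_beta (\<alpha>\<^sub>1 + \<kappa>) \<beta>\<^sub>1 p * log_beta (\<alpha>\<^sub>2 + \<kappa>) \<beta>\<^sub>2 (y - p) \<partial>lborel)" for y
  have g: "integrable lborel g"
    unfolding g_def by (intro convolution_fourier(1) log_beta_fourier a assms)
  have Fg: "fourier g t = (Gamma (Complex (\<alpha>\<^sub>1 + \<kappa>) t) * Gamma (of_real \<beta>\<^sub>1) * rGamma (Complex (\<alpha>\<^sub>1 + \<kappa>) t + of_real \<beta>\<^sub>1))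
      * (Gamma (Complex (\<alpha>\<^sub>2 + \<kappa>) t) * Gamma (of_real \<beta>\<^sub>2) * rGamma (Complex (\<alpha>\<^sub>2 + \<kappa>) t + of_real \<beta>\<^sub>2))" for t
    unfolding g_def
    by (simp only: convolution_fourier(2)[OF log_beta_fourier(1)[OF a(1) assms(1)] log_beta_fourier(1)[OF a(2) assms(2)]]
        log_beta_fourier(2)[OF a(1) assms(1)] log_beta_fourier(2)[OF a(2) assms(2)])
  have g0: "g y = 0" if "y \<le> 0" for y
    unfolding g_def using log_beta_convolution(1)[OF assms(1,2) that] .
  have g1: "g y = exp (- (\<alpha>\<^sub>1 + \<kappa>) * y) * (\<integral>v. indicat_real {exp (- y)..1} v * euler_integrand \<alpha>\<^sub>1 \<beta>\<^sub>1 \<alpha>\<^sub>2 \<beta>\<^sub>2 (exp (- y)) v \<partial>lborel)"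
    if "y > 0" for y
    unfolding g_def using log_beta_convolution(2)[OF assms(1,2) that] .
  have "g y = exp (- (\<alpha>\<^sub>1 + \<kappa>) * y) * ((1 - exp (- y)) powr (\<beta>\<^sub>1 + \<beta>\<^sub>2 - 1) * euler_kernel (\<alpha>\<^sub>2 - \<alpha>\<^sub>1 - \<beta>\<^sub>1) \<beta>\<^sub>1 \<beta>\<^sub>2 (exp (- y)))"
    if "y > 0" for y
    using g1[OF that] euler_integral_eq_kernel(2)[OF assms(1,2), of "exp (- y)"] that by simp
  from kernel_profile_Hoelder[OF assms(1,2) x g0 this] obtain \<delta>
    where "\<delta> > 0" "(\<lambda>y. g y - g x) \<in> O[at x](\<lambda>y. \<bar>y - x\<bar> powr \<delta>)" by blast
  from fourier_inversion_Hoelder[OF g this]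
  have inv: "((\<lambda>t. fourier g t * cis (t * x)) has_integral of_real (2 * pi * g x)) UNIV" .
  \<comment> \<open>The factor \<open>exp (\<kappa> * x)\<close> is the modulus of \<open>u powr (- s)\<close>; the Gamma values come from the
    Beta integrals.\<close>
  define C where "C = \<i> * of_real (exp (\<kappa> * x) / (Gamma \<beta>\<^sub>1 * Gamma \<beta>\<^sub>2))"
  have nz: "Gamma \<beta>\<^sub>1 \<noteq> 0" "Gamma \<beta>\<^sub>2 \<noteq> 0" 
    using Gamma_real_pos[OF assms(1)] Gamma_real_pos[OF assms(2)] by auto
  \<comment> \<open>At \<open>x = 0\<close> both sides are 0: \<open>g 0 = 0\<close>, and the Euler integral runs over a single point.\<close>
  have form: "euler_form \<alpha>\<^sub>1 \<beta>\<^sub>1 \<alpha>\<^sub>2 \<beta>\<^sub>2 u = g x * exp (\<kappa> * x) / (Gamma \<beta>\<^sub>1 * Gamma \<beta>\<^sub>2)"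
  proof (cases "x > 0")
    case True
    then have u1: "u < 1" using u(2) by (metis exp_less_one_iff neg_less_0_iff_less)
    have E: "integral {u..1} (euler_integrand \<alpha>\<^sub>1 \<beta>\<^sub>1 \<alpha>\<^sub>2 \<beta>\<^sub>2 u) = (\<integral>v. indicat_real {u..1} v * euler_integrand \<alpha>\<^sub>1 \<beta>\<^sub>1 \<alpha>\<^sub>2 \<beta>\<^sub>2 u v \<partial>lborel)"
      using set_borel_integral_eq_integral(2)[OF euler_integral_eq_kernel(1)[OF assms(1,2) u(1) u1, of \<alpha>\<^sub>1 \<alpha>\<^sub>2]]
      by (simp add: set_lebesgue_integral_def)
    have "u powr \<alpha>\<^sub>1 = exp (- \<alpha>\<^sub>1 * x)"
      using u(1) by (simp add: powr_def x_def)
    then have "u powr \<alpha>\<^sub>1 = exp (- (\<alpha>\<^sub>1 + \<kappa>) * x) * exp (\<kappa> * x)"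
      by (simp add: mult_exp_exp algebra_simps)
    then show ?thesis
      unfolding g1[OF True] euler_form_def E u(2)[symmetric] by simp
  next
    case False
    then show ?thesis using x u g0[of 0] by (auto simp: euler_form_def)
  qed
  have integrand: "meijer_integrand 2 0 [of_real (\<alpha>\<^sub>1 + \<beta>\<^sub>1), of_real (\<alpha>\<^sub>2 + \<beta>\<^sub>2)] [of_real \<alpha>\<^sub>1, of_real \<alpha>\<^sub>2] (of_real u) (Complex \<kappa> t) * \<i>
      = fourier g t * cis (t * x) * C" for t
  proof -
    have "of_real u powr (- Complex \<kappa> t) = exp (Complex \<kappa> t * of_real x)"
      using u(1) by (simp add: powr_def x_def Ln_of_real)
    also have "Complex \<kappa> t * of_real x = of_real (\<kappa> * x) + \<i> * of_real (t * x)"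
      by (simp add: complex_eq_iff)
    also have "exp \<dots> = of_real (exp (\<kappa> * x)) * cis (t * x)"
      by (simp only: exp_add cis_conv_exp exp_of_real)
    finally have pw: "of_real u powr (- Complex \<kappa> t) = of_real (exp (\<kappa> * x)) * cis (t * x)" .
    have arg: "of_real \<alpha>\<^sub>1 + Complex \<kappa> t = Complex (\<alpha>\<^sub>1 + \<kappa>) t" "of_real \<alpha>\<^sub>2 + Complex \<kappa> t = Complex (\<alpha>\<^sub>2 + \<kappa>) t"
      "of_real (\<alpha>\<^sub>1 + \<beta>\<^sub>1) + Complex \<kappa> t = Complex (\<alpha>\<^sub>1 + \<kappa>) t + of_real \<beta>\<^sub>1"
      "of_real (\<alpha>\<^sub>2 + \<beta>\<^sub>2) + Complex \<kappa> t = Complex (\<alpha>\<^sub>2 + \<kappa>) t + of_real \<beta>\<^sub>2"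
      by (auto simp: complex_eq_iff)
    have sets: "{..<2::nat} = {0, 1}" "{0..<2::nat} = {0, 1}" by auto
    have "meijer_integrand 2 0 [of_real (\<alpha>\<^sub>1 + \<beta>\<^sub>1), of_real (\<alpha>\<^sub>2 + \<beta>\<^sub>2)] [of_real \<alpha>\<^sub>1, of_real \<alpha>\<^sub>2] (of_real u) (Complex \<kappa> t)
        = Gamma (Complex (\<alpha>\<^sub>1 + \<kappa>) t) * Gamma (Complex (\<alpha>\<^sub>2 + \<kappa>) t) * (rGamma (Complex (\<alpha>\<^sub>1 + \<kappa>) t + of_real \<beta>\<^sub>1)
          * rGamma (Complex (\<alpha>\<^sub>2 + \<kappa>) t + of_real \<beta>\<^sub>2)) * (of_real (exp (\<kappa> * x)) * cis (t * x))"
      unfolding meijer_integrand_def pw by (simp add: sets arg del: of_real_add)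
    then show ?thesis
      using nz unfolding Fg C_def by (simp add: Gamma_complex_of_real)
  qed
  have "((\<lambda>t. fourier g t * cis (t * x) * C) has_integral of_real (2 * pi * g x) * C) UNIV"
    by (rule has_integral_mult_left[OF inv])
  moreover have eq: "of_real (2 * pi * g x) * C = 2 * of_real pi * \<i> * of_real (euler_form \<alpha>\<^sub>1 \<beta>\<^sub>1 \<alpha>\<^sub>2 \<beta>\<^sub>2 u)"
    unfolding form C_def by simp
  ultimately show "((\<lambda>t. meijer_integrand 2 0 [of_real (\<alpha>\<^sub>1 + \<beta>\<^sub>1), of_real (\<alpha>\<^sub>2 + \<beta>\<^sub>2)] [of_real \<alpha>\<^sub>1, of_real \<alpha>\<^sub>2]
        (of_real u) (Complex \<kappa> t) * \<i>) has_integral 2 * of_real pi * \<i> * of_real (euler_form \<alpha>\<^sub>1 \<beta>\<^sub>1 \<alpha>\<^sub>2 \<beta>\<^sub>2 u)) UNIV"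
    unfolding integrand eq[symmetric] by blast
qed

section \<open>The hypergeometric form\<close>

lemma beta_series_suminf_real:
  fixes x :: real
  assumes "b > 0" "x \<notin> \<int>\<^sub>\<le>\<^sub>0"
  shows "summable (\<lambda>k. \<bar>binom_coeff b k / (x + real k)\<bar>)"
    and "(\<Sum>k. binom_coeff b k / (x + real k)) = Gamma x * Gamma b * rGamma (x + b)"
proof -
  have x: "complex_of_real x \<notin> \<int>\<^sub>\<le>\<^sub>0" using assms(2) by (simp add: of_real_in_nonpos_Ints_iff)
  have eq: "complex_of_real (binom_coeff b k) / (of_real x + of_nat k) = of_real (binom_coeff b k / (x + real k))" for k
    by simp
  show sm: "summable (\<lambda>k. \<bar>binom_coeff b k / (x + real k)\<bar>)"
    using beta_series_summable[OF assms(1) x] unfolding eq norm_of_real .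
  have "complex_of_real (\<Sum>k. binom_coeff b k / (x + real k)) = beta_series b (of_real x)"
    unfolding beta_series_def eq by (rule suminf_of_real[OF summable_rabs_cancel[OF sm]])
  also have "\<dots> = of_real (Gamma x * Gamma b * rGamma (x + b))"
    unfolding beta_series_eq_Gamma[OF assms(1) x]
    by (simp add: Gamma_complex_of_real rGamma_complex_of_real flip: of_real_add)
  finally show "(\<Sum>k. binom_coeff b k / (x + real k)) = Gamma x * Gamma b * rGamma (x + b)"
    by (simp only: of_real_eq_iff)
qed

text \<open>
  A real number that is not an integer has a positive distance from all integers, so the denominators
  \<open>c - j + k\<close> are bounded away from 0 uniformly in \<open>j\<close> and \<open>k\<close>.
\<close>
lemma non_Ints_distance:
  assumes "c \<notin> (\<int> :: real set)"
  obtains d where "d > 0" "\<And>n :: int. d \<le> \<bar>c + of_int n\<bar>"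
proof -
  define d where "d = min (frac c) (1 - frac c)"
  have "d > 0" using assms frac_gt_0_iff[of c] frac_lt_1[of c] by (simp add: d_def)
  moreover have "d \<le> \<bar>c + of_int n\<bar>" for n :: int
  proof (cases "\<lfloor>c\<rfloor> + n \<ge> 0")
    case True
    then have "0 \<le> real_of_int (\<lfloor>c\<rfloor> + n)" by (simp only: of_int_0_le_iff)
    then show ?thesis unfolding d_def frac_def by simp
  next
    case False
    then have "real_of_int (\<lfloor>c\<rfloor> + n) \<le> of_int (- 1)" by (simp only: of_int_le_iff)
    then show ?thesis unfolding d_def frac_def by simp
  qed
  ultimately show ?thesis using that by blast
qed

text \<open>
  The part of the \<open>(j, k)\<close>-th term of the integrated double binomial series that comes from the
  upper limit \<open>v = 1\<close>.  Up to the factor \<open>u powr c\<close>, the part from the lower limit is of the same shape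
  with the parameters and the indices interchanged and \<open>c\<close> replaced by \<open>- c\<close>.
\<close>
definition cross_term :: "real \<Rightarrow> real \<Rightarrow> real \<Rightarrow> real \<Rightarrow> nat \<times> nat \<Rightarrow> real" where
  "cross_term b\<^sub>1 b\<^sub>2 c u = (\<lambda>(j, k). (binom_coeff b\<^sub>1 j * u ^ j) * (binom_coeff b\<^sub>2 k / (c - real j + real k)))"

text \<open>
  The inner sum over \<open>k\<close> grows at most linearly in \<open>j\<close>, and the geometric factor \<open>u ^ j\<close> absorbs this
  growth.
\<close>
lemma cross_term_summable:
  assumes "b\<^sub>1 > 0" "b\<^sub>2 > 0" "c \<notin> \<int>" "0 < u" "u < 1"
  shows "Infinite_Set_Sum.abs_summable_on (cross_term b\<^sub>1 b\<^sub>2 c u) UNIV"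
proof -
  obtain d where d: "d > 0" "\<And>n :: int. d \<le> \<bar>c + of_int n\<bar>"
    using non_Ints_distance[OF assms(3)] by blast
  define Q where "Q = (\<Sum>k. \<bar>binom_coeff b\<^sub>2 k\<bar> / (real k + 1))"
  define R where "R = 1 + (\<bar>c\<bar> + 1) / d + 1 / d"
  have R: "R \<ge> 0" using d by (simp add: R_def)
  have nonint: "c - real j \<notin> \<int>\<^sub>\<le>\<^sub>0" for j
    using assms(3) by (metis Ints_add Ints_of_nat diff_add_cancel nonpos_Ints_subset_Ints subsetD)
  have inner: "summable (\<lambda>k. \<bar>binom_coeff b\<^sub>2 k / (c - real j + real k)\<bar>)" for j
    by (rule beta_series_suminf_real(1)[OF assms(2) nonint])
  have inner_bound: "(\<Sum>k. \<bar>binom_coeff b\<^sub>2 k / (c - real j + real k)\<bar>) \<le> (R * (real j + 1)) * Q" for j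
  proof -
    have "\<bar>binom_coeff b\<^sub>2 k / (c - real j + real k)\<bar> \<le> (R * (real j + 1)) * (\<bar>binom_coeff b\<^sub>2 k\<bar> / (real k + 1))" for k
    proof -
      have "d \<le> cmod (of_real (c - real j) + of_nat k)" for k
      proof -
        have "d \<le> \<bar>c - real j + real k\<bar>" using d(2)[of "int k - int j"] by (simp add: algebra_simps)
        also have "\<dots> = cmod (of_real (c - real j + real k))" by (simp only: norm_of_real)
        finally show ?thesis by simp
      qed
      then have "norm (of_real (binom_coeff b\<^sub>2 k) / (complex_of_real (c - real j) + of_nat k))
         \<le> (1 + (\<bar>c\<bar> + real j + 1) / d) * (\<bar>binom_coeff b\<^sub>2 k\<bar> / (real k + 1))"
        using d(1)
      proof (rule beta_series_term_bound)
        show "cmod (complex_of_real (c - real j)) \<le> \<bar>c\<bar> + real j" by (simp only: norm_of_real)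
      qed
      moreover have "of_real (binom_coeff b\<^sub>2 k) / (complex_of_real (c - real j) + of_nat k) = of_real (binom_coeff b\<^sub>2 k / (c - real j + real k))"
        by simp
      ultimately have "\<bar>binom_coeff b\<^sub>2 k / (c - real j + real k)\<bar>
         \<le> (1 + (\<bar>c\<bar> + real j + 1) / d) * (\<bar>binom_coeff b\<^sub>2 k\<bar> / (real k + 1))"
        by (simp only: norm_of_real)
      also have "\<dots> \<le> (R * (real j + 1)) * (\<bar>binom_coeff b\<^sub>2 k\<bar> / (real k + 1))"
      proof (rule mult_right_mono)
        have "R * (real j + 1) - (1 + (\<bar>c\<bar> + real j + 1) / d) = (1 + (\<bar>c\<bar> + 1) / d) * real j + 1 / d"
          by (simp add: R_def algebra_simps add_divide_distrib)
        moreover have "0 \<le> (1 + (\<bar>c\<bar> + 1) / d) * real j + 1 / d" using d by simp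
        ultimately show "(1 + (\<bar>c\<bar> + real j + 1) / d) \<le> R * (real j + 1)" by linarith
      qed simp
      finally show ?thesis .
    qed
    then show ?thesis
      unfolding Q_def by (subst suminf_mult[symmetric]; intro suminf_le inner summable_mult summable_abs_binom_coeff assms)
  qed
  \<comment> \<open>One factor \<open>j + 1\<close> is the growth of the inner sum, the other one is traded for the summability of
    \<open>\<bar>binom_coeff b\<^sub>1 j\<bar> / (j + 1)\<close>.\<close>
  obtain M where M: "\<And>j. (real j + 1)\<^sup>2 * u ^ j \<le> M"
  proof -
    have "(\<lambda>j. (real j + 1)\<^sup>2 * u ^ j) \<longlonglongrightarrow> 0" using assms by real_asymp
    then have "Bseq (\<lambda>j. (real j + 1)\<^sup>2 * u ^ j)" by (rule convergent_imp_Bseq[OF convergentI])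
    then obtain K where K: "\<And>j. norm ((real j + 1)\<^sup>2 * u ^ j) \<le> K" by (elim BseqE) blast
    have "(real j + 1)\<^sup>2 * u ^ j \<le> K" for j
      using order_trans[OF abs_ge_self K[of j, unfolded real_norm_def]] .
    then show ?thesis using that by blast
  qed
  have outer: "summable (\<lambda>j. \<bar>binom_coeff b\<^sub>1 j * u ^ j\<bar> * ((R * (real j + 1)) * Q))"
  proof (rule summable_comparison_test'[where N = 0])
    show "summable (\<lambda>j. (\<bar>binom_coeff b\<^sub>1 j\<bar> / (real j + 1)) * (M * R * Q))"
      by (intro summable_mult2 summable_abs_binom_coeff assms)
    fix j :: nat
    have Q: "Q \<ge> 0" unfolding Q_def by (intro suminf_nonneg summable_abs_binom_coeff assms) auto
    have "\<bar>binom_coeff b\<^sub>1 j * u ^ j\<bar> * ((R * (real j + 1)) * Q)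
       = (\<bar>binom_coeff b\<^sub>1 j\<bar> / (real j + 1)) * (((real j + 1)\<^sup>2 * u ^ j) * (R * Q))"
      using assms by (simp add: abs_mult power2_eq_square)
    also have "\<dots> \<le> (\<bar>binom_coeff b\<^sub>1 j\<bar> / (real j + 1)) * (M * (R * Q))"
      using Q R by (intro mult_left_mono mult_right_mono M) auto
    finally show "norm (\<bar>binom_coeff b\<^sub>1 j * u ^ j\<bar> * ((R * (real j + 1)) * Q)) \<le> (\<bar>binom_coeff b\<^sub>1 j\<bar> / (real j + 1)) * (M * R * Q)"
      using Q R by (simp add: mult.assoc)
  qed
  have "Infinite_Set_Sum.abs_summable_on (cross_term b\<^sub>1 b\<^sub>2 c u) (UNIV \<times> UNIV)"
  proof (subst Infinite_Set_Sum.abs_summable_on_Sigma_iff; (intro conjI ballI)?)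
    fix j :: nat
    show *: "Infinite_Set_Sum.abs_summable_on (\<lambda>k. cross_term b\<^sub>1 b\<^sub>2 c u (j, k)) UNIV" for j
      unfolding abs_summable_on_nat_iff' cross_term_def using summable_mult[OF inner[of j], of "\<bar>binom_coeff b\<^sub>1 j * u ^ j\<bar>"]
      by (simp add: abs_mult)
    show "Infinite_Set_Sum.abs_summable_on (\<lambda>j. infsetsum (\<lambda>k. norm (cross_term b\<^sub>1 b\<^sub>2 c u (j, k))) UNIV) UNIV"
      unfolding abs_summable_on_nat_iff'
    proof (rule summable_comparison_test'[OF outer, of 0])
      fix j :: nat
      have "infsetsum (\<lambda>k. norm (cross_term b\<^sub>1 b\<^sub>2 c u (j, k))) UNIV = (\<Sum>k. norm (cross_term b\<^sub>1 b\<^sub>2 c u (j, k)))"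
        using *[of j] by (intro infsetsum_nat') (simp only: Infinite_Set_Sum.abs_summable_on_norm_iff)
      also have "\<dots> = \<bar>binom_coeff b\<^sub>1 j * u ^ j\<bar> * (\<Sum>k. \<bar>binom_coeff b\<^sub>2 k / (c - real j + real k)\<bar>)"
        unfolding suminf_mult[OF inner, symmetric] by (simp add: cross_term_def abs_mult)
      finally have eq: "infsetsum (\<lambda>k. norm (cross_term b\<^sub>1 b\<^sub>2 c u (j, k))) UNIV = \<dots>" .
      have "0 \<le> (\<Sum>k. \<bar>binom_coeff b\<^sub>2 k / (c - real j + real k)\<bar>)"
        by (intro suminf_nonneg inner) auto
      then have "norm (infsetsum (\<lambda>k. norm (cross_term b\<^sub>1 b\<^sub>2 c u (j, k))) UNIV)
          = \<bar>binom_coeff b\<^sub>1 j * u ^ j\<bar> * (\<Sum>k. \<bar>binom_coeff b\<^sub>2 k / (c - real j + real k)\<bar>)"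
        unfolding eq by (subst real_norm_def, subst abs_of_nonneg) (auto intro: mult_nonneg_nonneg)
      also have "\<dots> \<le> \<bar>binom_coeff b\<^sub>1 j * u ^ j\<bar> * ((R * (real j + 1)) * Q)"
        by (intro mult_left_mono inner_bound) auto
      finally show "norm (norm (infsetsum (\<lambda>k. norm (cross_term b\<^sub>1 b\<^sub>2 c u (j, k))) UNIV)) \<le> \<bar>binom_coeff b\<^sub>1 j * u ^ j\<bar> * ((R * (real j + 1)) * Q)"
        by (simp only: real_norm_def abs_abs)
    qed
  qed auto
  then show ?thesis by simp
qed

text \<open>
  The sum over \<open>k\<close> is a Beta series at \<open>c - j\<close>.  Shifting the Gamma functions from \<open>c - j\<close> back to \<open>c\<close>
  produces the Pochhammer symbols of the Gauss series; the signs \<open>(- 1) ^ j\<close> cancel.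
\<close>
lemma cross_term_sum:
  assumes "b\<^sub>1 > 0" "b\<^sub>2 > 0" "c \<notin> \<int>" "0 < u" "u < 1"
  shows "infsetsum (cross_term b\<^sub>1 b\<^sub>2 c u) UNIV
    = Gamma c * Gamma b\<^sub>2 * rGamma (c + b\<^sub>2) * hyp2F1 (1 - b\<^sub>1) (1 - c - b\<^sub>2) (1 - c) u"
proof -
  have nonint: "c - real j \<notin> \<int>\<^sub>\<le>\<^sub>0" for j
    using assms(3) by (metis Ints_add Ints_of_nat diff_add_cancel nonpos_Ints_subset_Ints subsetD)
  note summ = cross_term_summable[OF assms]
  define G where "G = Gamma c * Gamma b\<^sub>2 * rGamma (c + b\<^sub>2)"
  have inner: "infsetsum (\<lambda>k. cross_term b\<^sub>1 b\<^sub>2 c u (j, k)) UNIV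
     = G * (pochhammer (1 - b\<^sub>1) j * pochhammer (1 - c - b\<^sub>2) j / (pochhammer (1 - c) j * fact j) * u ^ j)" for j
  proof -
    have "Infinite_Set_Sum.abs_summable_on (\<lambda>k. cross_term b\<^sub>1 b\<^sub>2 c u (j, k)) UNIV"
      unfolding abs_summable_on_nat_iff' cross_term_def
      using summable_mult[OF beta_series_suminf_real(1)[OF assms(2) nonint[of j]], of "\<bar>binom_coeff b\<^sub>1 j * u ^ j\<bar>"]
      by (simp add: abs_mult)
    then have "infsetsum (\<lambda>k. cross_term b\<^sub>1 b\<^sub>2 c u (j, k)) UNIV = (\<Sum>k. cross_term b\<^sub>1 b\<^sub>2 c u (j, k))"
      by (rule infsetsum_nat')
    also have "\<dots> = (binom_coeff b\<^sub>1 j * u ^ j) * (Gamma (c - real j) * Gamma b\<^sub>2 * rGamma (c - real j + b\<^sub>2))"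
      unfolding beta_series_suminf_real(2)[OF assms(2) nonint, symmetric] cross_term_def prod.case
      by (rule suminf_mult[OF summable_rabs_cancel[OF beta_series_suminf_real(1)[OF assms(2) nonint]]])
    also have "rGamma (c - real j + b\<^sub>2) = pochhammer (c - real j + b\<^sub>2) j * rGamma (c + b\<^sub>2)"
      by (subst pochhammer_rGamma[of _ j]) (simp add: algebra_simps)
    also have "Gamma (c - real j) = Gamma c / pochhammer (c - real j) j"
    proof -
      have "Gamma c = pochhammer (c - real j) j * Gamma (c - real j)"
        using pochhammer_Gamma[OF nonint[of j], of j] Gamma_eq_zero_iff[of "c - real j"] nonint[of j] by simp
      moreover have "Gamma c \<noteq> 0" using nonint[of 0] Gamma_eq_zero_iff[of c] by simp
      ultimately show ?thesis by auto
    qed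
    also have "pochhammer (c - real j + b\<^sub>2) j = (- 1) ^ j * pochhammer (1 - c - b\<^sub>2) j"
      using pochhammer_minus'[of "c + b\<^sub>2 - 1" j] by (simp add: algebra_simps)
    also have "pochhammer (c - real j) j = (- 1) ^ j * pochhammer (1 - c) j"
      using pochhammer_minus'[of "c - 1" j] by (simp add: algebra_simps)
    finally show ?thesis by (simp add: G_def binom_coeff_def mult_ac)
  qed
  have sum1: "infsetsum (cross_term b\<^sub>1 b\<^sub>2 c u) (UNIV \<times> UNIV) = infsetsum (\<lambda>j. infsetsum (\<lambda>k. cross_term b\<^sub>1 b\<^sub>2 c u (j, k)) UNIV) UNIV"
    using summ by (intro infsetsum_Sigma) auto
  have summ': "Infinite_Set_Sum.abs_summable_on (\<lambda>j. infsetsum (\<lambda>k. cross_term b\<^sub>1 b\<^sub>2 c u (j, k)) UNIV) UNIV"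
    using abs_summable_on_Sigma_project1'[of "\<lambda>j k. cross_term b\<^sub>1 b\<^sub>2 c u (j, k)" UNIV "\<lambda>_. UNIV"] summ by simp
  from infsetsum_nat'[OF this] have "infsetsum (\<lambda>j. infsetsum (\<lambda>k. cross_term b\<^sub>1 b\<^sub>2 c u (j, k)) UNIV) UNIV
      = (\<Sum>j. infsetsum (\<lambda>k. cross_term b\<^sub>1 b\<^sub>2 c u (j, k)) UNIV)" .
  also have "\<dots> = G * hyp2F1 (1 - b\<^sub>1) (1 - c - b\<^sub>2) (1 - c) u"
  \<comment> \<open>Summability of the Gauss series is read off from that of its multiple by \<open>G\<close>, unless \<open>G = 0\<close>.\<close>
  proof (cases "G = 0")
    case False
    let ?t = "\<lambda>j. pochhammer (1 - b\<^sub>1) j * pochhammer (1 - c - b\<^sub>2) j / (pochhammer (1 - c) j * fact j) * u ^ j"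
    have "summable (\<lambda>j. G * ?t j)"
      using summable_norm_cancel[OF summ'[unfolded abs_summable_on_nat_iff']] unfolding inner .
    then have "summable ?t" using False by (simp only: summable_cmult_iff) simp
    then show ?thesis unfolding inner hyp2F1_eq_suminf by (rule suminf_mult)
  qed (simp add: inner)
  finally show ?thesis using sum1 by (simp add: G_def)
qed

lemma powr_integral:
  fixes e :: real
  assumes "0 < u" "u < 1" "e \<noteq> 0"
  shows "integrable lborel (\<lambda>v. indicat_real {u<..<1} v * v powr (e - 1))"
    and "(\<integral>v. indicat_real {u<..<1} v * v powr (e - 1) \<partial>lborel) = (1 - u powr e) / e"
proof -
  have cont: "continuous_on {u..1} (\<lambda>v. v powr (e - 1))"
    using assms by (intro continuous_intros) auto
  have "set_integrable lborel {u<..<1} (\<lambda>v. v powr (e - 1))"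
    by (rule set_integrable_subset[OF borel_integrable_atLeastAtMost'[OF cont]]) auto
  then show "integrable lborel (\<lambda>v. indicat_real {u<..<1} v * v powr (e - 1))"
    by (simp add: set_integrable_def)
  have "(LBINT v=ereal u..ereal 1. v powr (e - 1)) = 1 powr e / e - u powr e / e"
  proof (rule interval_integral_FTC_finite)
    show "continuous_on {min u 1..max u 1} (\<lambda>v. v powr (e - 1))" using cont assms by simp
    fix v assume "min u 1 \<le> v" "v \<le> max u 1"
    then have "((\<lambda>v. v powr e / e) has_real_derivative v powr (e - 1)) (at v within {min u 1..max u 1})"
      using assms by (auto intro!: derivative_eq_intros)
    then show "((\<lambda>v. v powr e / e) has_vector_derivative v powr (e - 1)) (at v within {min u 1..max u 1})"
      by (simp add: has_real_derivative_iff_has_vector_derivative)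
  qed
  then show "(\<integral>v. indicat_real {u<..<1} v * v powr (e - 1) \<partial>lborel) = (1 - u powr e) / e"
    using assms by (simp add: interval_lebesgue_integral_def set_lebesgue_integral_def diff_divide_distrib)
qed

text \<open>
  Fubini's theorem for the product of a counting measure on pairs of indices with Lebesgue measure.
  All terms have constant sign in \<open>v\<close>, so the absolute integrals are the absolute values of the
  integrals, and absolute summability of the cross terms is exactly what is required.
\<close>
lemma euler_integral_eq_cross_terms:
  assumes "\<beta>\<^sub>1 > 0" "\<beta>\<^sub>2 > 0" "\<alpha>\<^sub>2 - \<alpha>\<^sub>1 \<notin> \<int>" "0 < u" "u < 1"
  defines "c \<equiv> \<alpha>\<^sub>2 - \<alpha>\<^sub>1"
  shows "(\<integral>v. indicat_real {u..1} v * euler_integrand \<alpha>\<^sub>1 \<beta>\<^sub>1 \<alpha>\<^sub>2 \<beta>\<^sub>2 u v \<partial>lborel)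
    = infsetsum (cross_term \<beta>\<^sub>1 \<beta>\<^sub>2 c u) UNIV + u powr c * infsetsum (cross_term \<beta>\<^sub>2 \<beta>\<^sub>1 (- c) u) UNIV"
proof -
  have c1: "c \<notin> \<int>" using assms(3) by (simp add: c_def)
  then have c: "c \<notin> \<int>" "- c \<notin> \<int>" by simp_all
  define e where "e = (\<lambda>(j, k). c - real j + real k)"
  define F where "F = (\<lambda>(jk, v). case jk of (j, k) \<Rightarrow> (binom_coeff \<beta>\<^sub>1 j * binom_coeff \<beta>\<^sub>2 k * u ^ j) *
      (indicat_real {u<..<1} v * v powr (e (j, k) - 1)))"
  define T where "T = (\<lambda>(j, k). (binom_coeff \<beta>\<^sub>1 j * binom_coeff \<beta>\<^sub>2 k * u ^ j) * ((1 - u powr e (j, k)) / e (j, k)))"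
  have e: "e jk \<noteq> 0" for jk
  proof
    assume "e jk = 0"
    then have "c = of_int (int (fst jk) - int (snd jk))" by (simp add: e_def case_prod_beta)
    then show False using c(1) Ints_of_int by metis
  qed
  \<comment> \<open>Here \<open>u ^ j * u powr (c - j + k) = u powr c * u ^ k\<close>: in the part from the lower limit it is \<open>k\<close> that
    becomes the index of the power series.\<close>
  have T: "T jk = cross_term \<beta>\<^sub>1 \<beta>\<^sub>2 c u jk + u powr c * cross_term \<beta>\<^sub>2 \<beta>\<^sub>1 (- c) u (prod.swap jk)" for jk
  proof (cases jk)
    case (Pair j k)
    have "u ^ j * u powr e (j, k) = u powr c * u ^ k"
      using assms by (simp add: e_def powr_add powr_diff powr_realpow)
    moreover have "- c - real k + real j = - e (j, k)" by (simp add: e_def)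
    moreover have "c - real j + real k = e (j, k)" by (simp add: e_def)
    ultimately have "T (j, k) = binom_coeff \<beta>\<^sub>1 j * binom_coeff \<beta>\<^sub>2 k * u ^ j / e (j, k)
       - binom_coeff \<beta>\<^sub>1 j * binom_coeff \<beta>\<^sub>2 k * (u powr c * u ^ k) / e (j, k)"
      by (simp add: T_def diff_divide_distrib right_diff_distrib)
    then show ?thesis
      unfolding Pair cross_term_def prod.swap_def fst_conv snd_conv prod.case
        \<open>- c - real k + real j = - e (j, k)\<close> \<open>c - real j + real k = e (j, k)\<close>
      by (simp add: mult_ac)
  qed
  have s1: "Infinite_Set_Sum.abs_summable_on (cross_term \<beta>\<^sub>1 \<beta>\<^sub>2 c u) UNIV"
    by (intro cross_term_summable assms c)
  have s2: "Infinite_Set_Sum.abs_summable_on (cross_term \<beta>\<^sub>2 \<beta>\<^sub>1 (- c) u) UNIV"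
    by (intro cross_term_summable assms c)
  have bij: "bij_betw prod.swap (UNIV :: (nat \<times> nat) set) UNIV" by simp
  have s2': "Infinite_Set_Sum.abs_summable_on (\<lambda>jk. u powr c * cross_term \<beta>\<^sub>2 \<beta>\<^sub>1 (- c) u (prod.swap jk)) UNIV"
    using s2 abs_summable_on_reindex_bij_betw[OF bij, of "cross_term \<beta>\<^sub>2 \<beta>\<^sub>1 (- c) u"]
    by (intro Infinite_Set_Sum.abs_summable_on_cmult_right) auto
  have sT: "Infinite_Set_Sum.abs_summable_on T UNIV"
    unfolding T by (intro Infinite_Set_Sum.abs_summable_on_add s1 s2')
  have sumT: "infsetsum T UNIV = infsetsum (cross_term \<beta>\<^sub>1 \<beta>\<^sub>2 c u) UNIV + u powr c * infsetsum (cross_term \<beta>\<^sub>2 \<beta>\<^sub>1 (- c) u) UNIV"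
    unfolding T
    using infsetsum_add[OF s1 s2'] infsetsum_reindex_bij_betw[OF bij, of "cross_term \<beta>\<^sub>2 \<beta>\<^sub>1 (- c) u"]
    by (simp add: infsetsum_def)
  interpret pair_sigma_finite "count_space (UNIV :: (nat \<times> nat) set)" "lborel :: real measure"
    by (intro pair_sigma_finite.intro sigma_finite_measure_count_space sigma_finite_lborel)
  have FT: "(\<integral>v. F (jk, v) \<partial>lborel) = T jk" and Fint: "integrable lborel (\<lambda>v. F (jk, v))" for jk
  proof -
    obtain j k where jk: "jk = (j, k)" by (cases jk)
    have F: "F (jk, v) = (binom_coeff \<beta>\<^sub>1 j * binom_coeff \<beta>\<^sub>2 k * u ^ j) * (indicat_real {u<..<1} v * v powr (e jk - 1))" for v
      by (simp add: F_def jk)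
    show "(\<integral>v. F (jk, v) \<partial>lborel) = T jk"
      unfolding F integral_mult_right_zero powr_integral(2)[OF assms(4,5) e] by (simp add: T_def jk)
    show "integrable lborel (\<lambda>v. F (jk, v))"
      unfolding F by (intro integrable_mult_right powr_integral(1)[OF assms(4,5) e])
  qed
  have FN: "(\<integral>v. norm (F (jk, v)) \<partial>lborel) = norm (T jk)" for jk
  proof (cases jk)
    case (Pair j k)
    let ?p = "binom_coeff \<beta>\<^sub>1 j * binom_coeff \<beta>\<^sub>2 k * u ^ j"
    have "0 \<le> (\<integral>v. indicat_real {u<..<1} v * v powr (e jk - 1) \<partial>lborel)" by simp
    then have nonneg: "0 \<le> (1 - u powr e jk) / e jk" unfolding powr_integral(2)[OF assms(4,5) e[of jk]] .
    have "norm (F (jk, v)) = \<bar>?p\<bar> * (indicat_real {u<..<1} v * v powr (e jk - 1))" for v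
      by (simp add: F_def Pair abs_mult)
    then have "(\<integral>v. norm (F (jk, v)) \<partial>lborel) = \<bar>?p\<bar> * ((1 - u powr e jk) / e jk)"
      using powr_integral(2)[OF assms(4,5) e[of jk]] by simp
    also have "\<dots> = norm (?p * ((1 - u powr e jk) / e jk))"
      unfolding real_norm_def abs_mult[of ?p] abs_of_nonneg[OF nonneg] ..
    finally show ?thesis by (simp add: T_def Pair)
  qed
  have "integrable (count_space UNIV \<Otimes>\<^sub>M lborel) F"
  proof (rule Fubini_integrable)
    show "F \<in> borel_measurable (count_space UNIV \<Otimes>\<^sub>M lborel)"
      by (rule measurable_pair_measure_countable1) (use Fint in auto)
    show "integrable (count_space UNIV) (\<lambda>jk. \<integral>v. norm (F (jk, v)) \<partial>lborel)"
      unfolding FN using sT by (simp add: Infinite_Set_Sum.abs_summable_on_def)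
  qed (use Fint in auto)
  then have "integrable (count_space UNIV \<Otimes>\<^sub>M lborel) (case_prod (\<lambda>jk v. F (jk, v)))" by simp
  from Fubini_integral[OF this]
  have fub: "(\<integral>v. infsetsum (\<lambda>jk. F (jk, v)) UNIV \<partial>lborel) = infsetsum T UNIV"
    by (simp add: infsetsum_def FT)
  have "infsetsum (\<lambda>jk. F (jk, v)) UNIV = indicat_real {u..1} v * euler_integrand \<alpha>\<^sub>1 \<beta>\<^sub>1 \<alpha>\<^sub>2 \<beta>\<^sub>2 u v" for v
  proof (cases "u < v \<and> v < 1")
    case True
    then have v: "0 < v" "\<bar>u / v\<bar> < 1" "\<bar>v\<bar> < 1" using assms by auto
    have abs_summable: "Infinite_Set_Sum.abs_summable_on (\<lambda>k. binom_coeff b k * x ^ k) UNIV" if x: "\<bar>x\<bar> < 1" for b x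
    proof -
      obtain r where r: "\<bar>x\<bar> < r" "r < 1" using dense[OF x] by blast
      show ?thesis unfolding abs_summable_on_nat_iff'
        by (rule powser_insidea[of _ r]) (use r binom_coeff_sums[of r b] in \<open>auto simp: sums_iff\<close>)
    qed
    have infsum: "infsetsum (\<lambda>k. binom_coeff b k * x ^ k) UNIV = (1 - x) powr (b - 1)" if "\<bar>x\<bar> < 1" for b x
      using infsetsum_nat'[OF abs_summable[OF that]] binom_coeff_sums[OF that, of b] by (simp add: sums_iff)
    have "F (jk, v) = v powr (c - 1) * (case jk of (j, k) \<Rightarrow> (binom_coeff \<beta>\<^sub>1 j * (u / v) ^ j) * (binom_coeff \<beta>\<^sub>2 k * v ^ k))" for jk
    proof (cases jk)
      case (Pair j k)
      have "e (j, k) - 1 = (c - 1) - real j + real k" by (simp add: e_def)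
      then have "v powr (e (j, k) - 1) = v powr (c - 1) / v ^ j * v ^ k"
        using v(1) by (simp only: powr_add powr_diff powr_realpow)
      then show ?thesis using True by (simp add: F_def Pair power_divide)
    qed
    then have "infsetsum (\<lambda>jk. F (jk, v)) UNIV
        = v powr (c - 1) * infsetsum (\<lambda>(j, k). (binom_coeff \<beta>\<^sub>1 j * (u / v) ^ j) * (binom_coeff \<beta>\<^sub>2 k * v ^ k)) (UNIV \<times> UNIV)"
      by (simp add: infsetsum_def)
    also have "\<dots> = v powr (c - 1) * ((1 - u / v) powr (\<beta>\<^sub>1 - 1) * (1 - v) powr (\<beta>\<^sub>2 - 1))"
      by (subst infsetsum_product) (use v in \<open>auto intro!: abs_summable simp: infsum\<close>)
    also have "\<dots> = euler_integrand \<alpha>\<^sub>1 \<beta>\<^sub>1 \<alpha>\<^sub>2 \<beta>\<^sub>2 u v"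
    proof -
      have "v - u = v * (1 - u / v)" using v by (simp add: field_simps)
      then have "(v - u) powr (\<beta>\<^sub>1 - 1) = v powr (\<beta>\<^sub>1 - 1) * (1 - u / v) powr (\<beta>\<^sub>1 - 1)"
        using v True by (simp only: powr_mult)
      moreover have "v powr (c - 1) = v powr (\<alpha>\<^sub>2 - \<alpha>\<^sub>1 - \<beta>\<^sub>1) * v powr (\<beta>\<^sub>1 - 1)"
        unfolding powr_add[symmetric] by (simp add: c_def algebra_simps)
      ultimately show ?thesis by (simp add: euler_integrand_def)
    qed
    finally show ?thesis using True by simp
  next
    case False
    have "F (jk, v) = 0" for jk using False by (auto simp: F_def split: prod.split)
    moreover have "v \<notin> {u..1} \<or> v = u \<or> v = 1" using False by auto
    ultimately show ?thesis by (auto simp: euler_integrand_def)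
  qed
  then show ?thesis using fub sumT by simp
qed

text \<open>
  The two sums of cross terms are the two Gauss series with their Gamma factors; the second one
  carries \<open>u powr (\<alpha>\<^sub>2 - \<alpha>\<^sub>1)\<close>, which turns the common factor \<open>u powr \<alpha>\<^sub>1\<close> into \<open>u powr \<alpha>\<^sub>2\<close>.
\<close>
theorem euler_form_eq_hypergeo_form:
  assumes "\<beta>\<^sub>1 > 0" "\<beta>\<^sub>2 > 0" "\<alpha>\<^sub>2 - \<alpha>\<^sub>1 \<notin> \<int>" "0 < u" "u < 1"
  shows "euler_form \<alpha>\<^sub>1 \<beta>\<^sub>1 \<alpha>\<^sub>2 \<beta>\<^sub>2 u = hypergeo_form \<alpha>\<^sub>1 \<beta>\<^sub>1 \<alpha>\<^sub>2 \<beta>\<^sub>2 u"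
proof -
  define c where "c = \<alpha>\<^sub>2 - \<alpha>\<^sub>1"
  have c1: "c \<notin> \<int>" using assms(3) by (simp add: c_def)
  then have c: "c \<notin> \<int>" "- c \<notin> \<int>" by simp_all
  have nz: "Gamma \<beta>\<^sub>1 \<noteq> 0" "Gamma \<beta>\<^sub>2 \<noteq> 0"
    using Gamma_real_pos[OF assms(1)] Gamma_real_pos[OF assms(2)] by auto
  have "integral {u..1} (euler_integrand \<alpha>\<^sub>1 \<beta>\<^sub>1 \<alpha>\<^sub>2 \<beta>\<^sub>2 u)
     = infsetsum (cross_term \<beta>\<^sub>1 \<beta>\<^sub>2 c u) UNIV + u powr c * infsetsum (cross_term \<beta>\<^sub>2 \<beta>\<^sub>1 (- c) u) UNIV"
    using set_borel_integral_eq_integral(2)[OF euler_integral_eq_kernel(1)[OF assms(1,2,4,5), of \<alpha>\<^sub>1 \<alpha>\<^sub>2]]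
      euler_integral_eq_cross_terms[OF assms] by (simp add: set_lebesgue_integral_def c_def)
  also have "\<dots> = Gamma c * Gamma \<beta>\<^sub>2 * rGamma (c + \<beta>\<^sub>2) * hyp2F1 (1 - \<beta>\<^sub>1) (1 - c - \<beta>\<^sub>2) (1 - c) u
      + u powr c * (Gamma (- c) * Gamma \<beta>\<^sub>1 * rGamma (- c + \<beta>\<^sub>1) * hyp2F1 (1 - \<beta>\<^sub>2) (1 - (- c) - \<beta>\<^sub>1) (1 - (- c)) u)"
    by (simp only: cross_term_sum[OF assms(1,2) c(1) assms(4,5)] cross_term_sum[OF assms(2,1) c(2) assms(4,5)])
  finally have I: "integral {u..1} (euler_integrand \<alpha>\<^sub>1 \<beta>\<^sub>1 \<alpha>\<^sub>2 \<beta>\<^sub>2 u) = \<dots>" .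
  have pw: "u powr \<alpha>\<^sub>2 = u powr \<alpha>\<^sub>1 * u powr c" by (simp add: c_def flip: powr_add)
  have args: "\<alpha>\<^sub>1 - \<alpha>\<^sub>2 = - c" "\<alpha>\<^sub>2 - \<alpha>\<^sub>1 = c" "\<alpha>\<^sub>2 + \<beta>\<^sub>2 - \<alpha>\<^sub>1 = c + \<beta>\<^sub>2" "\<alpha>\<^sub>1 + \<beta>\<^sub>1 - \<alpha>\<^sub>2 = - c + \<beta>\<^sub>1"
    "1 + \<alpha>\<^sub>1 - \<alpha>\<^sub>2 - \<beta>\<^sub>2 = 1 - c - \<beta>\<^sub>2" "1 + \<alpha>\<^sub>1 - \<alpha>\<^sub>2 = 1 - c"
    "1 + \<alpha>\<^sub>2 - \<alpha>\<^sub>1 - \<beta>\<^sub>1 = 1 - (- c) - \<beta>\<^sub>1" "1 + \<alpha>\<^sub>2 - \<alpha>\<^sub>1 = 1 - (- c)"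
    by (auto simp: c_def)
  show ?thesis
    unfolding euler_form_def hypergeo_form_def I pw args rGamma_inverse_Gamma[of \<beta>\<^sub>1] rGamma_inverse_Gamma[of \<beta>\<^sub>2]
    using nz by (simp add: field_simps)
qed

section \<open>Limits at the endpoints\<close>

lemma euler_kernel_mono:
  assumes "b\<^sub>1 > 0" "b\<^sub>2 > 0" "0 < u" "u \<le> v" "v \<le> 1"
  shows "c \<ge> 0 \<Longrightarrow> euler_kernel c b\<^sub>1 b\<^sub>2 u \<le> euler_kernel c b\<^sub>1 b\<^sub>2 v"
    and "c \<le> 0 \<Longrightarrow> euler_kernel c b\<^sub>1 b\<^sub>2 v \<le> euler_kernel c b\<^sub>1 b\<^sub>2 u"
proof -
  let ?W = "\<lambda>w. w powr (b\<^sub>1 - 1) * (1 - w) powr (b\<^sub>2 - 1)"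
  have base: "0 < u + (1 - u) * w" "u + (1 - u) * w \<le> v + (1 - v) * w" if "w \<in> {0..1}" for w
  proof -
    show "0 < u + (1 - u) * w"
      by (rule less_le_trans[OF _ kernel_base_bounds(1)]) (use assms that in auto)
    have "0 \<le> (v - u) * (1 - w)" using assms that by simp
    then show "u + (1 - u) * w \<le> v + (1 - v) * w" by (simp add: algebra_simps)
  qed
  have int: "integrable lborel (\<lambda>w. indicat_real {0..1} w * ((x + (1 - x) * w) powr c * ?W w))" if "x = u \<or> x = v" for x
    using assms that by (intro euler_kernel_integrable) auto
  have le: "indicat_real {0..1} w * (x powr c * ?W w) \<le> indicat_real {0..1} w * (y powr c * ?W w)"
    if "w \<in> {0..1} \<Longrightarrow> x powr c \<le> y powr c" for x y w
    using that by (cases "w \<in> {0..1}") (auto intro: mult_right_mono)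
  show "euler_kernel c b\<^sub>1 b\<^sub>2 u \<le> euler_kernel c b\<^sub>1 b\<^sub>2 v" if "c \<ge> 0"
    unfolding euler_kernel_def
  proof (rule integral_mono[OF int int le])
    fix w :: real assume "w \<in> {0..1}"
    then show "(u + (1 - u) * w) powr c \<le> (v + (1 - v) * w) powr c"
      using base[of w] that by (intro powr_mono2) auto
  qed auto
  show "euler_kernel c b\<^sub>1 b\<^sub>2 v \<le> euler_kernel c b\<^sub>1 b\<^sub>2 u" if "c \<le> 0"
    unfolding euler_kernel_def
  proof (rule integral_mono[OF int int le])
    fix w :: real assume "w \<in> {0..1}"
    then show "(v + (1 - v) * w) powr c \<le> (u + (1 - u) * w) powr c"
      using base[of w] that by (intro powr_mono2') auto
  qed auto
qed

text \<open>
  The limit is taken in the extended reals because the kernel may tend to infinity.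
\<close>
lemma antimono_limit_at_right_0:
  fixes f :: "real \<Rightarrow> real"
  assumes "\<And>u v. 0 < u \<Longrightarrow> u \<le> v \<Longrightarrow> v < 1 \<Longrightarrow> f v \<le> f u"
  shows "((\<lambda>u. ereal (f u)) \<longlongrightarrow> (SUP u\<in>{0<..<1}. ereal (f u))) (at_right 0)"
proof (rule order_tendstoI)
  fix l assume "l < (SUP u\<in>{0<..<1}. ereal (f u))"
  then obtain v where v: "v \<in> {0<..<1}" "l < ereal (f v)" by (auto simp: less_SUP_iff)
  have "eventually (\<lambda>u. 0 < u \<and> u < v) (at_right 0)"
    using v by (intro eventually_conj eventually_at_right_less order_tendstoD[OF tendsto_ident_at]) auto
  then show "eventually (\<lambda>u. l < ereal (f u)) (at_right 0)"
  proof eventually_elim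
    case (elim u)
    then have "ereal (f v) \<le> ereal (f u)" using assms[of u v] v by simp
    then show ?case by (rule less_le_trans[OF v(2)])
  qed
next
  fix l assume l: "(SUP u\<in>{0<..<1}. ereal (f u)) < l"
  have "eventually (\<lambda>u::real. 0 < u \<and> u < 1) (at_right 0)"
    by (intro eventually_conj eventually_at_right_less order_tendstoD[OF tendsto_ident_at]) auto
  then show "eventually (\<lambda>u. ereal (f u) < l) (at_right 0)"
  proof eventually_elim
    case (elim u)
    then have "ereal (f u) \<le> (SUP u\<in>{0<..<1}. ereal (f u))" by (intro SUP_upper) auto
    then show ?case using l by (rule le_less_trans)
  qed
qed

lemma euler_kernel_limit_0:
  assumes "b\<^sub>1 > 0" "b\<^sub>2 > 0"
  obtains L where "((\<lambda>u. ereal (euler_kernel c b\<^sub>1 b\<^sub>2 u)) \<longlongrightarrow> L) (at_right 0)"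
proof (cases "c \<le> 0")
  case True
  then show ?thesis
    using antimono_limit_at_right_0[of "euler_kernel c b\<^sub>1 b\<^sub>2"] euler_kernel_mono(2)[OF assms] that by auto
next
  case False
  then have "((\<lambda>u. ereal (- euler_kernel c b\<^sub>1 b\<^sub>2 u)) \<longlongrightarrow> (SUP u\<in>{0<..<1}. ereal (- euler_kernel c b\<^sub>1 b\<^sub>2 u))) (at_right 0)"
    using euler_kernel_mono(1)[OF assms] by (intro antimono_limit_at_right_0) auto
  from tendsto_uminus_ereal[OF this] show ?thesis using that by simp
qed

lemma eventually_unit_interval:
  "eventually (\<lambda>u::real. 0 < u \<and> u < 1) (at_right 0)" "eventually (\<lambda>u::real. 0 < u \<and> u < 1) (at_left 1)"
  using eventually_at_right_real[of 0 1] eventually_at_left_real[of 0 1] by simp_all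

text \<open>
  The power of the base is split so that the exponent \<open>- \<epsilon>\<close> falls on the bound \<open>u\<close> and the rest on the
  bound \<open>w\<close>; a positive exponent \<open>\<epsilon>\<close> remains at \<open>w = 0\<close> and the integral converges.
\<close>
lemma euler_kernel_upper:
  assumes "b\<^sub>1 > 0" "b\<^sub>2 > 0" "- b\<^sub>1 \<le> c" "0 < \<epsilon>" "\<epsilon> \<le> b\<^sub>1" "0 < u" "u \<le> 1"
  shows "euler_kernel c b\<^sub>1 b\<^sub>2 u \<le> u powr (- \<epsilon>) * Beta \<epsilon> b\<^sub>2"
proof (rule euler_kernel_le_Beta)
  fix w :: real assume w: "0 < w" "w < 1"
  let ?x = "u + (1 - u) * w"
  have x: "u \<le> ?x" "w \<le> ?x" "?x \<le> 1" using kernel_base_bounds[of u w] assms w by auto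
  have "?x powr c \<le> ?x powr (- b\<^sub>1)" using x w assms by (intro powr_mono') auto
  also have "\<dots> = ?x powr (- \<epsilon>) * ?x powr (\<epsilon> - b\<^sub>1)" by (simp flip: powr_add)
  also have "\<dots> \<le> u powr (- \<epsilon>) * w powr (\<epsilon> - b\<^sub>1)"
    using x w assms by (intro mult_mono powr_mono2') auto
  finally have "?x powr c * w powr (b\<^sub>1 - 1) \<le> u powr (- \<epsilon>) * w powr (\<epsilon> - b\<^sub>1) * w powr (b\<^sub>1 - 1)"
    by (intro mult_right_mono) auto
  also have "\<dots> = u powr (- \<epsilon>) * w powr (\<epsilon> - 1)"
    by (simp add: mult.assoc flip: powr_add)
  finally show "?x powr c * w powr (b\<^sub>1 - 1) \<le> u powr (- \<epsilon>) * w powr (\<epsilon> - 1)" .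
qed (use assms in auto)

lemma euler_kernel_lower:
  assumes "b\<^sub>1 > 0" "b\<^sub>2 > 0" "0 < u" "u \<le> 1"
  shows "Beta (b\<^sub>1 + \<bar>c\<bar>) b\<^sub>2 \<le> euler_kernel c b\<^sub>1 b\<^sub>2 u"
proof -
  have "1 * Beta (b\<^sub>1 + \<bar>c\<bar>) b\<^sub>2 \<le> euler_kernel c b\<^sub>1 b\<^sub>2 u"
  proof (rule Beta_le_euler_kernel)
    fix w :: real assume w: "0 < w" "w < 1"
    let ?x = "u + (1 - u) * w"
    have x: "u \<le> ?x" "w \<le> ?x" "?x \<le> 1" using kernel_base_bounds[of u w] assms w by auto
    have "w powr \<bar>c\<bar> \<le> ?x powr c"
    proof (cases "c \<ge> 0")
      case True
      then show ?thesis using x w by (auto intro!: powr_mono2)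
    next
      case False
      have "w powr \<bar>c\<bar> \<le> 1 powr \<bar>c\<bar>" using w by (intro powr_mono2) auto
      moreover have "1 powr c \<le> ?x powr c" using False x w by (intro powr_mono2') auto
      ultimately show ?thesis by simp
    qed
    then have "w powr \<bar>c\<bar> * w powr (b\<^sub>1 - 1) \<le> ?x powr c * w powr (b\<^sub>1 - 1)"
      by (intro mult_right_mono) auto
    then show "1 * w powr (b\<^sub>1 + \<bar>c\<bar> - 1) \<le> ?x powr c * w powr (b\<^sub>1 - 1)"
      by (simp add: algebra_simps flip: powr_add)
  qed (use assms in auto)
  then show ?thesis by simp
qed

text \<open>
  If \<open>\<alpha>\<^sub>1 < 0\<close>, the kernel is bounded below by a positive constant and the limit is infinite.  If
  \<open>\<alpha>\<^sub>1 > 0\<close>, the kernel grows more slowly than any negative power of \<open>u\<close>, because \<open>\<alpha>\<^sub>1 \<le> \<alpha>\<^sub>2\<close>, and the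
  limit is 0.  If \<open>\<alpha>\<^sub>1 = 0\<close>, the limit is, up to a constant, that of the kernel, which exists in the
  extended reals by monotonicity.
\<close>
lemma euler_form_limit_0:
  assumes "\<beta>\<^sub>1 > 0" "\<beta>\<^sub>2 > 0" "\<alpha>\<^sub>1 \<le> \<alpha>\<^sub>2"
  obtains L where "((\<lambda>u. ereal (euler_form \<alpha>\<^sub>1 \<beta>\<^sub>1 \<alpha>\<^sub>2 \<beta>\<^sub>2 u)) \<longlongrightarrow> L) (at_right 0)"
proof -
  define C where "C = 1 / (Gamma \<beta>\<^sub>1 * Gamma \<beta>\<^sub>2)"
  define c where "c = \<alpha>\<^sub>2 - \<alpha>\<^sub>1 - \<beta>\<^sub>1"
  define K where "K = euler_kernel c \<beta>\<^sub>1 \<beta>\<^sub>2"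
  let ?b = "\<beta>\<^sub>1 + \<beta>\<^sub>2 - 1"
  have C: "C > 0" using Gamma_real_pos assms by (simp add: C_def)
  have form: "euler_form \<alpha>\<^sub>1 \<beta>\<^sub>1 \<alpha>\<^sub>2 \<beta>\<^sub>2 u = C * u powr \<alpha>\<^sub>1 * ((1 - u) powr ?b * K u)" if "0 < u" "u < 1" for u
    using euler_form_eq_kernel(2)[OF assms(1,2) that] by (simp add: C_def K_def c_def)
  have K0: "K u \<ge> Beta (\<beta>\<^sub>1 + \<bar>c\<bar>) \<beta>\<^sub>2" if "0 < u" "u < 1" for u
    unfolding K_def using assms that by (intro euler_kernel_lower) auto
  have m: "Beta (\<beta>\<^sub>1 + \<bar>c\<bar>) \<beta>\<^sub>2 > 0" using assms by (intro Beta_pos) auto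
  have one: "((\<lambda>u. (1 - u) powr ?b) \<longlongrightarrow> 1) (at_right 0)"
    by (rule tendsto_eq_intros refl)+ auto
  consider "\<alpha>\<^sub>1 < 0" | "\<alpha>\<^sub>1 = 0" | "\<alpha>\<^sub>1 > 0" by linarith
  then show ?thesis
  proof cases
    case 1
    have top: "filterlim (\<lambda>u. u powr \<alpha>\<^sub>1) at_top (at_right 0)" using 1 by real_asymp
    have D: "((\<lambda>u. C * ((1 - u) powr ?b * Beta (\<beta>\<^sub>1 + \<bar>c\<bar>) \<beta>\<^sub>2)) \<longlongrightarrow> C * (1 * Beta (\<beta>\<^sub>1 + \<bar>c\<bar>) \<beta>\<^sub>2)) (at_right 0)"
      by (intro tendsto_intros one)
    have "filterlim (\<lambda>u. C * ((1 - u) powr ?b * Beta (\<beta>\<^sub>1 + \<bar>c\<bar>) \<beta>\<^sub>2) * u powr \<alpha>\<^sub>1) at_top (at_right 0)"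
      by (rule filterlim_tendsto_pos_mult_at_top[OF D _ top]) (use C m in simp)
    then have "filterlim (\<lambda>u. euler_form \<alpha>\<^sub>1 \<beta>\<^sub>1 \<alpha>\<^sub>2 \<beta>\<^sub>2 u) at_top (at_right 0)"
    proof (rule filterlim_at_top_mono)
      show "eventually (\<lambda>u. C * ((1 - u) powr ?b * Beta (\<beta>\<^sub>1 + \<bar>c\<bar>) \<beta>\<^sub>2) * u powr \<alpha>\<^sub>1 \<le> euler_form \<alpha>\<^sub>1 \<beta>\<^sub>1 \<alpha>\<^sub>2 \<beta>\<^sub>2 u) (at_right 0)"
        using eventually_unit_interval(1)
      proof eventually_elim
        case (elim u)
        have "C * u powr \<alpha>\<^sub>1 * ((1 - u) powr ?b * Beta (\<beta>\<^sub>1 + \<bar>c\<bar>) \<beta>\<^sub>2) \<le> C * u powr \<alpha>\<^sub>1 * ((1 - u) powr ?b * K u)"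
          using C K0[of u] elim by (intro mult_left_mono) auto
        then show ?case using form[of u] elim by (simp add: mult_ac)
      qed
    qed
    then have "((\<lambda>u. ereal (euler_form \<alpha>\<^sub>1 \<beta>\<^sub>1 \<alpha>\<^sub>2 \<beta>\<^sub>2 u)) \<longlongrightarrow> \<infinity>) (at_right 0)"
      by (simp add: tendsto_PInfty_eq_at_top)
    then show ?thesis by (rule that)
  next
    case 2
    obtain L where L: "((\<lambda>u. ereal (K u)) \<longlongrightarrow> L) (at_right 0)"
      unfolding K_def using euler_kernel_limit_0[OF assms(1,2)] by blast
    have "((\<lambda>u. ereal (C * (1 - u) powr ?b)) \<longlongrightarrow> ereal (C * 1)) (at_right 0)"
      by (intro tendsto_intros one)
    from tendsto_mult_ereal[OF this L] have "((\<lambda>u. ereal (C * (1 - u) powr ?b) * ereal (K u)) \<longlongrightarrow> ereal (C * 1) * L) (at_right 0)"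
      using C by simp
    moreover have "eventually (\<lambda>u. ereal (C * (1 - u) powr ?b) * ereal (K u) = ereal (euler_form \<alpha>\<^sub>1 \<beta>\<^sub>1 \<alpha>\<^sub>2 \<beta>\<^sub>2 u)) (at_right 0)"
      using eventually_unit_interval(1)
    proof eventually_elim
      case (elim u)
      then show ?case using form[of u] 2 by simp
    qed
    ultimately show ?thesis using that by (blast intro: Lim_transform_eventually)
  next
    case 3
    \<comment> \<open>Less than \<open>\<alpha>\<^sub>1\<close>, so that a positive power of \<open>u\<close> is left over, and at most \<open>\<beta>\<^sub>1\<close>, as the
      bound on the kernel requires.\<close>
    define \<epsilon> where "\<epsilon> = min \<alpha>\<^sub>1 \<beta>\<^sub>1 / 2"
    have \<epsilon>: "0 < \<epsilon>" "\<epsilon> \<le> \<beta>\<^sub>1" "\<epsilon> < \<alpha>\<^sub>1" using 3 assms by (auto simp: \<epsilon>_def min_def)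
    have "((\<lambda>u. u powr (\<alpha>\<^sub>1 - \<epsilon>)) \<longlongrightarrow> 0) (at_right 0)" using \<epsilon> by real_asymp
    then have bound: "((\<lambda>u. C * u powr (\<alpha>\<^sub>1 - \<epsilon>) * ((1 - u) powr ?b * Beta \<epsilon> \<beta>\<^sub>2)) \<longlongrightarrow> C * 0 * (1 * Beta \<epsilon> \<beta>\<^sub>2)) (at_right 0)"
      by (intro tendsto_intros one)
    have "((\<lambda>u. euler_form \<alpha>\<^sub>1 \<beta>\<^sub>1 \<alpha>\<^sub>2 \<beta>\<^sub>2 u) \<longlongrightarrow> 0) (at_right 0)"
    proof (rule Lim_null_comparison)
      show "((\<lambda>u. C * u powr (\<alpha>\<^sub>1 - \<epsilon>) * ((1 - u) powr ?b * Beta \<epsilon> \<beta>\<^sub>2)) \<longlongrightarrow> 0) (at_right 0)"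
        using bound by simp
      show "eventually (\<lambda>u. norm (euler_form \<alpha>\<^sub>1 \<beta>\<^sub>1 \<alpha>\<^sub>2 \<beta>\<^sub>2 u) \<le> C * u powr (\<alpha>\<^sub>1 - \<epsilon>) * ((1 - u) powr ?b * Beta \<epsilon> \<beta>\<^sub>2)) (at_right 0)"
        using eventually_unit_interval(1)
      proof eventually_elim
        case (elim u)
        have "K u \<le> u powr (- \<epsilon>) * Beta \<epsilon> \<beta>\<^sub>2"
          unfolding K_def using assms \<epsilon> elim by (intro euler_kernel_upper) (auto simp: c_def)
        then have "C * u powr \<alpha>\<^sub>1 * ((1 - u) powr ?b * K u) \<le> C * u powr \<alpha>\<^sub>1 * ((1 - u) powr ?b * (u powr (- \<epsilon>) * Beta \<epsilon> \<beta>\<^sub>2))"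
          using C by (intro mult_left_mono) auto
        also have "\<dots> = C * u powr (\<alpha>\<^sub>1 - \<epsilon>) * ((1 - u) powr ?b * Beta \<epsilon> \<beta>\<^sub>2)"
        proof -
          have "u powr (\<alpha>\<^sub>1 - \<epsilon>) = u powr \<alpha>\<^sub>1 * u powr (- \<epsilon>)" by (simp flip: powr_add)
          then show ?thesis by (simp only: mult_ac)
        qed
        finally have "euler_form \<alpha>\<^sub>1 \<beta>\<^sub>1 \<alpha>\<^sub>2 \<beta>\<^sub>2 u \<le> \<dots>" using form[of u] elim by simp
        moreover have "0 \<le> euler_form \<alpha>\<^sub>1 \<beta>\<^sub>1 \<alpha>\<^sub>2 \<beta>\<^sub>2 u"
          using form[of u] elim C K0[of u] m by (auto intro!: mult_nonneg_nonneg)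
        ultimately show ?case by simp
      qed
    qed
    then have "((\<lambda>u. ereal (euler_form \<alpha>\<^sub>1 \<beta>\<^sub>1 \<alpha>\<^sub>2 \<beta>\<^sub>2 u)) \<longlongrightarrow> ereal 0) (at_right 0)" by (intro tendsto_intros)
    then show ?thesis by (rule that)
  qed
qed

text \<open>
  The kernel tends to a positive number, so the power of \<open>1 - u\<close> decides.
\<close>
lemma euler_form_limit_1:
  assumes "\<beta>\<^sub>1 > 0" "\<beta>\<^sub>2 > 0"
  obtains L where "((\<lambda>u. ereal (euler_form \<alpha>\<^sub>1 \<beta>\<^sub>1 \<alpha>\<^sub>2 \<beta>\<^sub>2 u)) \<longlongrightarrow> L) (at_left 1)"
proof -
  define C where "C = 1 / (Gamma \<beta>\<^sub>1 * Gamma \<beta>\<^sub>2)"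
  define K where "K = euler_kernel (\<alpha>\<^sub>2 - \<alpha>\<^sub>1 - \<beta>\<^sub>1) \<beta>\<^sub>1 \<beta>\<^sub>2"
  define D where "D u = C * u powr \<alpha>\<^sub>1 * K u" for u
  let ?b = "\<beta>\<^sub>1 + \<beta>\<^sub>2 - 1"
  have C: "C > 0" using Gamma_real_pos assms by (simp add: C_def)
  have form: "euler_form \<alpha>\<^sub>1 \<beta>\<^sub>1 \<alpha>\<^sub>2 \<beta>\<^sub>2 u = D u * (1 - u) powr ?b" if "0 < u" "u < 1" for u
    using euler_form_eq_kernel(2)[OF assms(1,2) that] by (simp add: C_def K_def D_def)
  have K1: "K 1 > 0"
    using euler_kernel_lower[OF assms, of 1] Beta_pos[of "\<beta>\<^sub>1 + \<bar>\<alpha>\<^sub>2 - \<alpha>\<^sub>1 - \<beta>\<^sub>1\<bar>" \<beta>\<^sub>2] assms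
    unfolding K_def by (smt (verit))
  have K: "(K \<longlongrightarrow> K 1) (at_left 1)"
  proof -
    from euler_kernel_Lipschitz[OF assms, of "1 / 2"] obtain L where
      L: "\<And>u u'. u \<in> {1 / 2..1} \<Longrightarrow> u' \<in> {1 / 2..1} \<Longrightarrow> \<bar>K u - K u'\<bar> \<le> L * \<bar>u - u'\<bar>"
      unfolding K_def by auto
    have "((\<lambda>u. K u - K 1) \<longlongrightarrow> 0) (at_left 1)"
    proof (rule Lim_null_comparison)
      have "eventually (\<lambda>u. 1 / 2 < u \<and> u < (1::real)) (at_left 1)"
        using eventually_at_left_real[of "1 / 2" 1] by simp
      then show "eventually (\<lambda>u. norm (K u - K 1) \<le> L * \<bar>u - 1\<bar>) (at_left 1)"
      proof eventually_elim
        case (elim u)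
        then have "\<bar>K u - K 1\<bar> \<le> L * \<bar>u - 1\<bar>" by (intro L) auto
        then show ?case by (simp only: real_norm_def)
      qed
      show "((\<lambda>u. L * \<bar>u - 1\<bar>) \<longlongrightarrow> 0) (at_left 1)" by (rule tendsto_eq_intros refl)+ auto
    qed
    then show ?thesis by (simp add: LIM_zero_iff)
  qed
  have D: "(D \<longlongrightarrow> C * 1 powr \<alpha>\<^sub>1 * K 1) (at_left 1)"
    unfolding D_def by (intro tendsto_intros K) auto
  have eq: "eventually (\<lambda>u. D u * (1 - u) powr ?b = euler_form \<alpha>\<^sub>1 \<beta>\<^sub>1 \<alpha>\<^sub>2 \<beta>\<^sub>2 u) (at_left 1)"
    using eventually_unit_interval(2) by eventually_elim (simp add: form)
  consider "?b > 0" | "?b = 0" | "?b < 0" by linarith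
  then show ?thesis
  proof cases
    case 1
    have "((\<lambda>u. (1 - u) powr ?b) \<longlongrightarrow> 0) (at_left 1)" using 1 by real_asymp
    from Lim_transform_eventually[OF tendsto_mult[OF D this] eq]
    show ?thesis using that by (metis tendsto_ereal)
  next
    case 2
    have "eventually (\<lambda>u. (1 - u) powr ?b = 1) (at_left 1)"
      using eventually_unit_interval(2) by eventually_elim (simp add: 2)
    then have "((\<lambda>u. (1 - u) powr ?b) \<longlongrightarrow> 1) (at_left 1)" by (rule tendsto_eventually)
    from Lim_transform_eventually[OF tendsto_mult[OF D this] eq]
    show ?thesis using that by (metis tendsto_ereal)
  next
    case 3
    have "filterlim (\<lambda>u. (1 - u) powr ?b) at_top (at_left 1)" using 3 by real_asymp
    from filterlim_tendsto_pos_mult_at_top[OF D _ this]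
    have "filterlim (\<lambda>u. D u * (1 - u) powr ?b) at_top (at_left 1)" using C K1 by simp
    then have "filterlim (\<lambda>u. euler_form \<alpha>\<^sub>1 \<beta>\<^sub>1 \<alpha>\<^sub>2 \<beta>\<^sub>2 u) at_top (at_left 1)"
      using filterlim_cong[OF refl refl eq] by blast
    then have "((\<lambda>u. ereal (euler_form \<alpha>\<^sub>1 \<beta>\<^sub>1 \<alpha>\<^sub>2 \<beta>\<^sub>2 u)) \<longlongrightarrow> \<infinity>) (at_left 1)"
      by (simp add: tendsto_PInfty_eq_at_top)
    then show ?thesis by (rule that)
  qed
qed

section \<open>Equality of the four expressions\<close>

text \<open>
  Both the integrand and the condition on the line are symmetric in the pairs of parameters.
\<close>
lemma has_meijer_G_2_0_swap:
  "has_meijer_G 2 0 [a\<^sub>2, a\<^sub>1] [b\<^sub>2, b\<^sub>1] z w \<longleftrightarrow> has_meijer_G 2 0 [a\<^sub>1, a\<^sub>2] [b\<^sub>1, b\<^sub>2] z w"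
proof -
  have sets: "{..<2::nat} = {0, 1}" "{0..<2::nat} = {0, 1}" by auto
  have 1: "meijer_line 2 0 [a\<^sub>2, a\<^sub>1] [b\<^sub>2, b\<^sub>1] \<kappa> \<longleftrightarrow> meijer_line 2 0 [a\<^sub>1, a\<^sub>2] [b\<^sub>1, b\<^sub>2] \<kappa>" for \<kappa>
    unfolding meijer_line_def by (auto simp: numeral_2_eq_2 less_Suc_eq)
  have 2: "meijer_integrand 2 0 [a\<^sub>2, a\<^sub>1] [b\<^sub>2, b\<^sub>1] z s = meijer_integrand 2 0 [a\<^sub>1, a\<^sub>2] [b\<^sub>1, b\<^sub>2] z s" for s
    unfolding meijer_integrand_def by (simp add: sets mult_ac)
  show ?thesis unfolding has_meijer_G_def 1 2 ..
qed

text \<open>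
  Both sides are values of one and the same line integral.
\<close>
lemma euler_form_symmetric:
  assumes "\<beta>\<^sub>1 > 0" "\<beta>\<^sub>2 > 0" "0 < u \<and> u < 1 \<or> u = 1 \<and> \<beta>\<^sub>1 + \<beta>\<^sub>2 > 1"
  shows "euler_form \<alpha>\<^sub>1 \<beta>\<^sub>1 \<alpha>\<^sub>2 \<beta>\<^sub>2 u = euler_form \<alpha>\<^sub>2 \<beta>\<^sub>2 \<alpha>\<^sub>1 \<beta>\<^sub>1 u"
proof -
  note has_meijer_G_euler_form[OF assms, of \<alpha>\<^sub>1 \<alpha>\<^sub>2]
  moreover have "has_meijer_G 2 0 [of_real (\<alpha>\<^sub>1 + \<beta>\<^sub>1), of_real (\<alpha>\<^sub>2 + \<beta>\<^sub>2)] [of_real \<alpha>\<^sub>1, of_real \<alpha>\<^sub>2]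
      (of_real u) (of_real (euler_form \<alpha>\<^sub>2 \<beta>\<^sub>2 \<alpha>\<^sub>1 \<beta>\<^sub>1 u))"
    using has_meijer_G_euler_form[of \<beta>\<^sub>2 \<beta>\<^sub>1 u \<alpha>\<^sub>2 \<alpha>\<^sub>1] assms
    by (subst has_meijer_G_2_0_swap) (simp add: add.commute)
  ultimately show ?thesis
    using has_meijer_G_unique of_real_eq_iff by blast
qed

theorem theorem2p3:
  fixes \<alpha>\<^sub>1 \<alpha>\<^sub>2 \<beta>\<^sub>1 \<beta>\<^sub>2 :: real
  assumes "\<alpha>\<^sub>1 > -1" "\<alpha>\<^sub>2 > -1" "\<beta>\<^sub>1 > 0" "\<beta>\<^sub>2 > 0"
  shows
    "(\<forall>u::real. 0 < u \<and> u < 1 \<or> u = 1 \<and> \<beta>\<^sub>1 + \<beta>\<^sub>2 > 1 \<longrightarrow>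
       euler_integrand \<alpha>\<^sub>1 \<beta>\<^sub>1 \<alpha>\<^sub>2 \<beta>\<^sub>2 u integrable_on {u..1} \<and>
       euler_integrand \<alpha>\<^sub>2 \<beta>\<^sub>2 \<alpha>\<^sub>1 \<beta>\<^sub>1 u integrable_on {u..1} \<and>
       has_meijer_G 2 0 [of_real (\<alpha>\<^sub>1 + \<beta>\<^sub>1), of_real (\<alpha>\<^sub>2 + \<beta>\<^sub>2)] [of_real \<alpha>\<^sub>1, of_real \<alpha>\<^sub>2]
         (of_real u) (of_real (euler_form \<alpha>\<^sub>1 \<beta>\<^sub>1 \<alpha>\<^sub>2 \<beta>\<^sub>2 u)) \<and>
       euler_form \<alpha>\<^sub>1 \<beta>\<^sub>1 \<alpha>\<^sub>2 \<beta>\<^sub>2 u = euler_form \<alpha>\<^sub>2 \<beta>\<^sub>2 \<alpha>\<^sub>1 \<beta>\<^sub>1 u)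
    \<and>
    ((\<forall>\<nu>::nat. \<alpha>\<^sub>1 - \<alpha>\<^sub>2 \<noteq> real \<nu> \<and> \<alpha>\<^sub>1 - \<alpha>\<^sub>2 \<noteq> - real \<nu>) \<longrightarrow>
       (\<forall>u::real. 0 < u \<and> u < 1 \<longrightarrow>
          has_meijer_G 2 0 [of_real (\<alpha>\<^sub>1 + \<beta>\<^sub>1), of_real (\<alpha>\<^sub>2 + \<beta>\<^sub>2)] [of_real \<alpha>\<^sub>1, of_real \<alpha>\<^sub>2]
            (of_real u) (of_real (hypergeo_form \<alpha>\<^sub>1 \<beta>\<^sub>1 \<alpha>\<^sub>2 \<beta>\<^sub>2 u)) \<and>
          euler_form \<alpha>\<^sub>1 \<beta>\<^sub>1 \<alpha>\<^sub>2 \<beta>\<^sub>2 u = hypergeo_form \<alpha>\<^sub>1 \<beta>\<^sub>1 \<alpha>\<^sub>2 \<beta>\<^sub>2 u \<and>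
          euler_form \<alpha>\<^sub>2 \<beta>\<^sub>2 \<alpha>\<^sub>1 \<beta>\<^sub>1 u = hypergeo_form \<alpha>\<^sub>1 \<beta>\<^sub>1 \<alpha>\<^sub>2 \<beta>\<^sub>2 u))
    \<and>
    (\<exists>L::ereal.
       ((\<lambda>u. ereal (Re (meijer_G 2 0 [of_real (\<alpha>\<^sub>1 + \<beta>\<^sub>1), of_real (\<alpha>\<^sub>2 + \<beta>\<^sub>2)]
          [of_real \<alpha>\<^sub>1, of_real \<alpha>\<^sub>2] (of_real u)))) \<longlongrightarrow> L) (at_right 0) \<and>
       ((\<lambda>u. ereal (euler_form \<alpha>\<^sub>1 \<beta>\<^sub>1 \<alpha>\<^sub>2 \<beta>\<^sub>2 u)) \<longlongrightarrow> L) (at_right 0) \<and>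
       ((\<lambda>u. ereal (euler_form \<alpha>\<^sub>2 \<beta>\<^sub>2 \<alpha>\<^sub>1 \<beta>\<^sub>1 u)) \<longlongrightarrow> L) (at_right 0) \<and>
       ((\<forall>\<nu>::nat. \<alpha>\<^sub>1 - \<alpha>\<^sub>2 \<noteq> real \<nu> \<and> \<alpha>\<^sub>1 - \<alpha>\<^sub>2 \<noteq> - real \<nu>) \<longrightarrow>
          ((\<lambda>u. ereal (hypergeo_form \<alpha>\<^sub>1 \<beta>\<^sub>1 \<alpha>\<^sub>2 \<beta>\<^sub>2 u)) \<longlongrightarrow> L) (at_right 0)))
    \<and>
    (\<exists>L::ereal.
       ((\<lambda>u. ereal (Re (meijer_G 2 0 [of_real (\<alpha>\<^sub>1 + \<beta>\<^sub>1), of_real (\<alpha>\<^sub>2 + \<beta>\<^sub>2)]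
          [of_real \<alpha>\<^sub>1, of_real \<alpha>\<^sub>2] (of_real u)))) \<longlongrightarrow> L) (at_left 1) \<and>
       ((\<lambda>u. ereal (euler_form \<alpha>\<^sub>1 \<beta>\<^sub>1 \<alpha>\<^sub>2 \<beta>\<^sub>2 u)) \<longlongrightarrow> L) (at_left 1) \<and>
       ((\<lambda>u. ereal (euler_form \<alpha>\<^sub>2 \<beta>\<^sub>2 \<alpha>\<^sub>1 \<beta>\<^sub>1 u)) \<longlongrightarrow> L) (at_left 1))"
proof -
  let ?G = "\<lambda>u. Re (meijer_G 2 0 [of_real (\<alpha>\<^sub>1 + \<beta>\<^sub>1), of_real (\<alpha>\<^sub>2 + \<beta>\<^sub>2)] [of_real \<alpha>\<^sub>1, of_real \<alpha>\<^sub>2] (of_real u))"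
  let ?E\<^sub>1 = "euler_form \<alpha>\<^sub>1 \<beta>\<^sub>1 \<alpha>\<^sub>2 \<beta>\<^sub>2" and ?E\<^sub>2 = "euler_form \<alpha>\<^sub>2 \<beta>\<^sub>2 \<alpha>\<^sub>1 \<beta>\<^sub>1" and ?H = "hypergeo_form \<alpha>\<^sub>1 \<beta>\<^sub>1 \<alpha>\<^sub>2 \<beta>\<^sub>2"
  have meijer: "has_meijer_G 2 0 [of_real (\<alpha>\<^sub>1 + \<beta>\<^sub>1), of_real (\<alpha>\<^sub>2 + \<beta>\<^sub>2)] [of_real \<alpha>\<^sub>1, of_real \<alpha>\<^sub>2] (of_real u) (of_real (?E\<^sub>1 u))"
    if "0 < u \<and> u < 1 \<or> u = 1 \<and> \<beta>\<^sub>1 + \<beta>\<^sub>2 > 1" for u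
    by (rule has_meijer_G_euler_form[OF assms(3,4) that])
  have integrable: "euler_integrand a\<^sub>1 b\<^sub>1 a\<^sub>2 b\<^sub>2 u integrable_on {u..1}"
    if "0 < u \<and> u < 1 \<or> u = 1" "b\<^sub>1 > 0" "b\<^sub>2 > 0" for u a\<^sub>1 a\<^sub>2 b\<^sub>1 b\<^sub>2
    using that euler_form_eq_kernel(1)[OF that(2,3)] integrable_on_refl[of _ "1::real"] by (auto simp only: cbox_interval)
  have hyper: "?E\<^sub>1 u = ?H u" if "\<forall>\<nu>::nat. \<alpha>\<^sub>1 - \<alpha>\<^sub>2 \<noteq> real \<nu> \<and> \<alpha>\<^sub>1 - \<alpha>\<^sub>2 \<noteq> - real \<nu>" "0 < u" "u < 1" for u
  proof (rule euler_form_eq_hypergeo_form[OF assms(3,4) _ that(2,3)])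
    show "\<alpha>\<^sub>2 - \<alpha>\<^sub>1 \<notin> \<int>"
    proof
      assume "\<alpha>\<^sub>2 - \<alpha>\<^sub>1 \<in> \<int>"
      then obtain n :: int where n: "\<alpha>\<^sub>2 - \<alpha>\<^sub>1 = of_int n" by (elim Ints_cases)
      show False
      proof (cases n rule: int_cases2)
        case (nonneg \<nu>)
        then show False using n that(1)[rule_format, of \<nu>] by simp
      next
        case (nonpos \<nu>)
        then show False using n that(1)[rule_format, of \<nu>] by simp
      qed
    qed
  qed
  have G_eq: "?G u = ?E\<^sub>1 u" if "0 < u" "u < 1" for u
    using meijer_G_eqI[OF meijer[of u]] that by simp
  have E_eq: "?E\<^sub>1 u = ?E\<^sub>2 u" if "0 < u" "u < 1" for u
    using euler_form_symmetric[OF assms(3,4)] that by blast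
  have transfer: "((\<lambda>u. ereal (f u)) \<longlongrightarrow> L) F"
    if "((\<lambda>u. ereal (?E\<^sub>1 u)) \<longlongrightarrow> L) F" "eventually (\<lambda>u. 0 < u \<and> u < 1) F" "\<And>u. 0 < u \<Longrightarrow> u < 1 \<Longrightarrow> ?E\<^sub>1 u = f u" for f L F
    by (rule Lim_transform_eventually[OF that(1)]) (use that(2) in eventually_elim, simp add: that(3))
  \<comment> \<open>The limit at 0 is available for \<open>\<alpha>\<^sub>1 \<le> \<alpha>\<^sub>2\<close>; otherwise the indices are interchanged.\<close>
  obtain L\<^sub>0 where L\<^sub>0: "((\<lambda>u. ereal (?E\<^sub>1 u)) \<longlongrightarrow> L\<^sub>0) (at_right 0)"
  proof (cases "\<alpha>\<^sub>1 \<le> \<alpha>\<^sub>2")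
    case True
    then show ?thesis using euler_form_limit_0[OF assms(3,4)] that by blast
  next
    case False
    then obtain L where "((\<lambda>u. ereal (?E\<^sub>2 u)) \<longlongrightarrow> L) (at_right 0)"
      using euler_form_limit_0[OF assms(4,3), of \<alpha>\<^sub>2 \<alpha>\<^sub>1] by force
    then have "((\<lambda>u. ereal (?E\<^sub>1 u)) \<longlongrightarrow> L) (at_right 0)"
      by (rule Lim_transform_eventually) (use eventually_unit_interval(1) in eventually_elim, simp add: E_eq)
    then show ?thesis by (rule that)
  qed
  obtain L\<^sub>1 where L\<^sub>1: "((\<lambda>u. ereal (?E\<^sub>1 u)) \<longlongrightarrow> L\<^sub>1) (at_left 1)"
    using euler_form_limit_1[OF assms(3,4)] .
  note t0 = transfer[OF L\<^sub>0 eventually_unit_interval(1)] and t1 = transfer[OF L\<^sub>1 eventually_unit_interval(2)]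
  show ?thesis
  proof (intro conjI allI impI)
    fix u :: real assume u: "0 < u \<and> u < 1 \<or> u = 1 \<and> \<beta>\<^sub>1 + \<beta>\<^sub>2 > 1"
    then show "euler_integrand \<alpha>\<^sub>1 \<beta>\<^sub>1 \<alpha>\<^sub>2 \<beta>\<^sub>2 u integrable_on {u..1}"
      "euler_integrand \<alpha>\<^sub>2 \<beta>\<^sub>2 \<alpha>\<^sub>1 \<beta>\<^sub>1 u integrable_on {u..1}"
      using integrable assms by blast+
    show "has_meijer_G 2 0 [of_real (\<alpha>\<^sub>1 + \<beta>\<^sub>1), of_real (\<alpha>\<^sub>2 + \<beta>\<^sub>2)] [of_real \<alpha>\<^sub>1, of_real \<alpha>\<^sub>2] (of_real u) (of_real (?E\<^sub>1 u))"
      by (rule meijer[OF u])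
    show "?E\<^sub>1 u = ?E\<^sub>2 u" by (rule euler_form_symmetric[OF assms(3,4) u])
  next
    fix u :: real assume n: "\<forall>\<nu>::nat. \<alpha>\<^sub>1 - \<alpha>\<^sub>2 \<noteq> real \<nu> \<and> \<alpha>\<^sub>1 - \<alpha>\<^sub>2 \<noteq> - real \<nu>" and u: "0 < u \<and> u < 1"
    show E: "?E\<^sub>1 u = ?H u" using hyper[OF n] u by blast
    show "?E\<^sub>2 u = ?H u" using E E_eq[of u] u by simp
    show "has_meijer_G 2 0 [of_real (\<alpha>\<^sub>1 + \<beta>\<^sub>1), of_real (\<alpha>\<^sub>2 + \<beta>\<^sub>2)] [of_real \<alpha>\<^sub>1, of_real \<alpha>\<^sub>2] (of_real u) (of_real (?H u))"
      using meijer[of u] u unfolding E by blast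
  qed (rule exI[of _ L\<^sub>0], use L\<^sub>0 t0[OF E_eq] t0[OF G_eq[symmetric]] t0[OF hyper] in blast,
       rule exI[of _ L\<^sub>1], use L\<^sub>1 t1[OF E_eq] t1[OF G_eq[symmetric]] in blast)
qed

end
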